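(* Let $(M^8,g,\rho)$ be a $\mathrm{PSU}(3)$-structure of type $\mathcal{W}_1\oplus\dots\oplus\mathcal{W}_5$ with parallel characteristic torsion, i.e. $\nabla^cT^c=0$ and $\nabla^cF^c=0$. Then the curvature tensor $\mathcal{R}^c$ of $\nabla^c$ satisfies, for all vectors $X,Y,Z,V$, $$\mathfrak{S}_{X,Y,Z}\,\mathcal{R}^c(X,Y,Z,V)=\Big[\sum_i\Big((e_i\lrcorner T^c)-\big((e_i\lrcorner\rho)\lrcorner F^c\big)\Big)\wedge\Big((e_i\lrcorner V\lrcorner T^c)-\big(e_i\lrcorner((V\lrcorner\rho)\lrcorner F^c)\big)\Big)\Big](X,Y,Z),$$ where $\mathfrak{S}_{X,Y,Z}$ denotes the cyclic sum over $X,Y,Z$.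
   Context: Algebraic setting. $\mathbb{R}^8$ is oriented Euclidean space, identified with its dual; $(e_1,\dots,e_8)$ is an oriented orthonormal basis, $e_{i_1\dots i_j}=e_{i_1}\wedge\dots\wedge e_{i_j}$, $\Lambda^k$ the space of $k$-forms. For $\alpha\in\Lambda^k,\beta\in\Lambda^l$ put $\sigma_0(\alpha,\beta)=\alpha\wedge\beta$ and $\sigma_j(\alpha,\beta)=\sum_{i_1<\dots<i_j}(e_{i_1}\lrcorner\cdots\lrcorner e_{i_j}\lrcorner\alpha)\wedge(e_{i_1}\lrcorner\cdots\lrcorner e_{i_j}\lrcorner\beta)$. For $k\le l$ the contraction is $\alpha\lrcorner\beta=\sigma_k(\alpha,\beta)$; $\ast$ is the Hodge operator. Let $$(\star)\quad\rho=e_{246}-e_{235}-e_{145}-e_{136}+(e_{12}+e_{34}-2e_{56})\wedge e_7+\sqrt3\,(e_{12}-e_{34})\wedge e_8 ,$$ $\mathrm{PSU}(3)\subset\mathrm{SO}(8)$ its isotropy group, $\sigma_+(\alpha)=\sigma_1(\rho,\alpha)$. Modules: $\Lambda^2_8=\sigma_+(\Lambda^1)$, $\Lambda^2_{20}=\{\omega\in\Lambda^2\mid\omega\wedge\ast\rho=0\}$, $\Lambda^3_8=\{\ast(\omega\wedge\rho)\mid\omega\in\Lambda^2_8\}$, $\Lambda^3_{20}=\sigma_+(\Lambda^2_{20})$, $\Lambda^3_{27}=\{T\in\Lambda^3\mid T\wedge\rho=0,\ T\wedge\ast\rho=0\}$, $\Lambda^4_8=\sigma_+(\Lambda^3_8)$,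 $\Lambda^4_{27}=\sigma_+(\Lambda^3_{27})$. With $\mathfrak{so}(8)=\Lambda^2$ one has $\mathfrak{psu}(3)=\Lambda^2_8$; let $\mathfrak m=\Lambda^2_{20}$ be its orthogonal complement and $\mathrm{pr}_{\mathfrak m}$ the projection. Maps: $\Phi_1(X\otimes\omega)=X\wedge\omega$ and $\Phi_2(X\otimes\omega)=(X\lrcorner\rho)\wedge\omega$ on $\mathbb{R}^8\otimes\mathfrak m$; $\Theta_1(T)=-\frac12\sum_i e_i\otimes\mathrm{pr}_{\mathfrak m}(e_i\lrcorner T)$ for $T\in\Lambda^3$; $\Theta_2(F)=-\sum_i e_i\otimes\mathrm{pr}_{\mathfrak m}((e_i\lrcorner\rho)\lrcorner F)$ for $F\in\Lambda^4$. Put $\mathcal{W}_1=\Theta_1(\Lambda^3_8)$, $\mathcal{W}_2=\Theta_1(\Lambda^3_{20})$, $\mathcal{W}_3=\Theta_1(\Lambda^3_{27})$, $\mathcal{W}_4=\Theta_2(\ast\Lambda^4_8)$, $\mathcal{W}_5=\Theta_2(\ast\Lambda^4_{27})$, $\mathcal{W}_6=\mathrm{Ker}(\Phi_1)\cap\mathrm{Ker}(\Phi_2)$; then $\mathbb{R}^8\otimes\mathfrak m=\mathcal{W}_1\oplus\dots\oplus\mathcal{W}_6$. Geometric setting. A $\mathrm{PSU}(3)$-structure $(M^8,g,\rho)$ is an (oriented) Riemannian 8-manifold with a 3-form $\rho$ such that at every point there is an oriented orthonormal frame $(e_1,\dots,e_8)$ (an adapted frame) realizing $(\star)$; the operators $\sigma_j,\sigma_+,\ast$,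 the modules $\Lambda^k_i$ and $\mathfrak m$, the maps $\Phi_1,\Phi_2,\Theta_1,\Theta_2$ and the spaces $\mathcal{W}_1,\dots,\mathcal{W}_6$ are applied pointwise in adapted frames. Let $\Omega^g=(\omega^g_{ij})$, $\omega^g_{ij}=g(\nabla^g e_i,e_j)$, in an adapted frame. The intrinsic torsion is $\Gamma=\mathrm{pr}_{\mathfrak m}(\Omega^g)=\Gamma_1+\dots+\Gamma_6$, $\Gamma_i\in\mathcal{W}_i$. The structure is of type $\mathcal{W}_{i_1}\oplus\dots\oplus\mathcal{W}_{i_j}$ if $\Gamma\in\mathcal{W}_{i_1}\oplus\dots\oplus\mathcal{W}_{i_j}$. The characteristic forms are $T^c\in\Lambda^3_8\oplus\Lambda^3_{20}\oplus\Lambda^3_{27}$ with $\Theta_1(T^c)=\Gamma_1+\Gamma_2+\Gamma_3$ and $F^c\in\ast\Lambda^4_8\oplus\ast\Lambda^4_{27}$ with $\Theta_2(F^c)=\Gamma_4+\Gamma_5$. For a structure of type $\mathcal{W}_1\oplus\dots\oplus\mathcal{W}_5$ the characteristic connection $\nabla^c$ is the metric connection $g(\nabla^c_XY,Z)=g(\nabla^g_XY,Z)+\frac12T^c(X,Y,Z)+((X\lrcorner\rho)\lrcorner F^c)(Y,Z)$ (it satisfies $\nabla^c\rho=0$). Its curvature as a $(4,0)$-tensor is $\mathcal{R}^c(X,Y,Z,V)=g(\nabla^c_X\nabla^c_YZ-\nabla^c_Y\nabla^c_XZ-\nabla^c_{[X,Y]}Z,V)$. *)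

theory Defs
  imports "HOL-Analysis.Analysis"
begin

section \<open>Exterior algebra of oriented Euclidean 8-space\<close>

text \<open>
  A form is the vector of its coefficients: \<open>\<alpha> $ I\<close> is the coefficient of the basis form
  \<open>e_I = e_i1 \<and> ... \<and> e_ik\<close>, where \<open>I = {i1, ..., ik}\<close> is listed in increasing order. The built-in
  inner product makes the \<open>e_I\<close> orthonormal. Indices are the literals \<open>1, ..., 8\<close> of type \<open>8\<close>.
  In that type \<open>8 = 0\<close>, so the built-in order is wrong; \<open>prec\<close> is the order \<open>1 < 2 < ... < 8\<close>.
\<close>

type_synonym ext = "real ^ (8 set)"

definition prec :: "8 \<Rightarrow> 8 \<Rightarrow> bool" where
  "prec i j \<longleftrightarrow> i - 1 < j - 1"

definition incr :: "8 set \<Rightarrow> 8 list" where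
  "incr I = filter (\<lambda>i. i \<in> I) [1, 2, 3, 4, 5, 6, 7, 8]"

definition shuffle_sign :: "8 set \<Rightarrow> 8 set \<Rightarrow> real" where
  "shuffle_sign I J = (-1) ^ card {(i, j). i \<in> I \<and> j \<in> J \<and> prec j i}"

definition eb :: "8 set \<Rightarrow> ext" where
  "eb I = axis I 1"

definition Lam :: "nat \<Rightarrow> ext set" where
  "Lam k = {\<alpha>. \<forall>I. card I \<noteq> k \<longrightarrow> \<alpha> $ I = 0}"

definition wedge :: "ext \<Rightarrow> ext \<Rightarrow> ext" where
  "wedge \<alpha> \<beta> = (\<chi> K. \<Sum>I\<in>Pow K. shuffle_sign I (K - I) * \<alpha> $ I * \<beta> $ (K - I))"

text \<open>\<open>hook x \<alpha>\<close> is the interior product, which inserts \<open>x\<close> in the first slot of \<open>\<alpha>\<close>.\<close>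

definition hook :: "real ^ 8 \<Rightarrow> ext \<Rightarrow> ext" where
  "hook x \<alpha> = (\<chi> I. \<Sum>i\<in>-I. x $ i * shuffle_sign {i} I * \<alpha> $ insert i I)"

definition hook_e :: "8 \<Rightarrow> ext \<Rightarrow> ext" where
  "hook_e i = hook (axis i 1)"

text \<open>The value of the \<open>k\<close>-form \<open>\<alpha>\<close> on \<open>x1, ..., xk\<close>.\<close>

definition form_eval :: "ext \<Rightarrow> (real ^ 8) list \<Rightarrow> real" where
  "form_eval \<alpha> xs = fold hook xs \<alpha> $ {}"

text \<open>The contraction of a \<open>k\<close>-form \<open>\<alpha>\<close> with \<open>\<beta>\<close> is \<open>sigma k \<alpha> \<beta>\<close>.\<close>

definition sigma :: "nat \<Rightarrow> ext \<Rightarrow> ext \<Rightarrow> ext" where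
  "sigma j \<alpha> \<beta> =
     (\<Sum>I | card I = j. wedge (foldr hook_e (incr I) \<alpha>) (foldr hook_e (incr I) \<beta>))"

definition star :: "ext \<Rightarrow> ext" where
  "star \<alpha> = (\<chi> J. shuffle_sign (- J) J * \<alpha> $ (- J))"

definition rho0 :: ext where
  "rho0 = eb {2,4,6} - eb {2,3,5} - eb {1,4,5} - eb {1,3,6}
     + wedge (eb {1,2} + eb {3,4} - 2 *\<^sub>R eb {5,6}) (eb {7})
     + sqrt 3 *\<^sub>R wedge (eb {1,2} - eb {3,4}) (eb {8})"

definition sigma_plus :: "ext \<Rightarrow> ext" where
  "sigma_plus \<alpha> = sigma 1 rho0 \<alpha>"

definition Lam2_8 :: "ext set" where
  "Lam2_8 = sigma_plus ` Lam 1"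

definition Lam2_20 :: "ext set" where
  "Lam2_20 = {\<omega> \<in> Lam 2. wedge \<omega> (star rho0) = 0}"

definition Lam3_8 :: "ext set" where
  "Lam3_8 = {star (wedge \<omega> rho0) | \<omega>. \<omega> \<in> Lam2_8}"

definition Lam3_20 :: "ext set" where
  "Lam3_20 = sigma_plus ` Lam2_20"

definition Lam3_27 :: "ext set" where
  "Lam3_27 = {T \<in> Lam 3. wedge T rho0 = 0 \<and> wedge T (star rho0) = 0}"

definition Lam4_8 :: "ext set" where
  "Lam4_8 = sigma_plus ` Lam3_8"

definition Lam4_27 :: "ext set" where
  "Lam4_27 = sigma_plus ` Lam3_27"

text \<open>Orthogonal projection onto \<open>Lam2_20\<close>, the space called \<open>m\<close>.\<close>

definition pr_m :: "ext \<Rightarrow> ext" where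
  "pr_m \<omega> = (THE \<eta>. \<eta> \<in> Lam2_20 \<and> (\<forall>\<zeta>\<in>Lam2_20. orthogonal (\<omega> - \<eta>) \<zeta>))"

text \<open>
  An element \<open>\<Sum>i. e_i \<otimes> \<omega>_i\<close> of the tensor product of 8-space with the 2-forms is represented
  by the tuple of the \<open>\<omega>_i\<close>.
\<close>

definition R8_m :: "(ext ^ 8) set" where
  "R8_m = {B. \<forall>i. B $ i \<in> Lam2_20}"

definition Phi1 :: "ext ^ 8 \<Rightarrow> ext" where
  "Phi1 B = (\<Sum>i\<in>UNIV. wedge (eb {i}) (B $ i))"

definition Phi2 :: "ext ^ 8 \<Rightarrow> ext" where
  "Phi2 B = (\<Sum>i\<in>UNIV. wedge (hook_e i rho0) (B $ i))"

definition Theta1 :: "ext \<Rightarrow> ext ^ 8" where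
  "Theta1 T = (\<chi> i. - (1/2) *\<^sub>R pr_m (hook_e i T))"

definition Theta2 :: "ext \<Rightarrow> ext ^ 8" where
  "Theta2 F = (\<chi> i. - pr_m (sigma 2 (hook_e i rho0) F))"

definition W :: "nat \<Rightarrow> (ext ^ 8) set" where
  "W i =
    (if i = 1 then Theta1 ` Lam3_8
     else if i = 2 then Theta1 ` Lam3_20
     else if i = 3 then Theta1 ` Lam3_27
     else if i = 4 then Theta2 ` star ` Lam4_8
     else if i = 5 then Theta2 ` star ` Lam4_27
     else if i = 6 then {B \<in> R8_m. Phi1 B = 0 \<and> Phi2 B = 0}
     else {0})"


section \<open>Oriented smooth 8-manifolds\<close>

primrec C_on :: "nat \<Rightarrow> 'a::euclidean_space set \<Rightarrow> ('a \<Rightarrow> 'b::real_normed_vector) \<Rightarrow> bool" where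
  "C_on 0 = (\<lambda>S f. continuous_on S f)"
| "C_on (Suc k) = (\<lambda>S f. (\<forall>x\<in>S. f differentiable (at x)) \<and>
     (\<forall>v. C_on k S (\<lambda>x. frechet_derivative f (at x) v)))"

definition C_infinity_on :: "'a::euclidean_space set \<Rightarrow> ('a \<Rightarrow> 'b::real_normed_vector) \<Rightarrow> bool" where
  "C_infinity_on S f \<longleftrightarrow> open S \<and> (\<forall>k. C_on k S f)"

text \<open>The manifold is the whole type \<open>'m\<close>. A chart is a pair \<open>(U, \<phi>)\<close> of its domain and its map.\<close>

type_synonym 'm atlas = "('m set \<times> ('m \<Rightarrow> real ^ 8)) set"

definition oriented_atlas ::
  "'m::{t2_space,second_countable_topology} atlas \<Rightarrow> bool" where
  "oriented_atlas A \<longleftrightarrow>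
    (\<Union>(U, \<phi>)\<in>A. U) = UNIV \<and>
    (\<forall>(U, \<phi>)\<in>A. open U \<and> open (\<phi> ` U) \<and> homeomorphism U (\<phi> ` U) \<phi> (inv_into U \<phi>)) \<and>
    (\<forall>(U, \<phi>)\<in>A. \<forall>(V, \<psi>)\<in>A.
       C_infinity_on (\<phi> ` (U \<inter> V)) (\<psi> \<circ> inv_into U \<phi>) \<and>
       (\<forall>x\<in>\<phi> ` (U \<inter> V).
          det (matrix (frechet_derivative (\<psi> \<circ> inv_into U \<phi>) (at x))) > 0))"

definition smooth_fun :: "'m::topological_space atlas \<Rightarrow> 'm set \<Rightarrow> ('m \<Rightarrow> real) \<Rightarrow> bool" where
  "smooth_fun A U f \<longleftrightarrow>
    open U \<and> (\<forall>(V, \<phi>)\<in>A. C_infinity_on (\<phi> ` (U \<inter> V)) (f \<circ> inv_into V \<phi>))"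

definition smooth_near :: "'m::topological_space atlas \<Rightarrow> 'm \<Rightarrow> ('m \<Rightarrow> real) \<Rightarrow> bool" where
  "smooth_near A p f \<longleftrightarrow> (\<exists>U. p \<in> U \<and> smooth_fun A U f)"

text \<open>
  Tangent vectors at \<open>p\<close> are derivations on the functions that are smooth near \<open>p\<close>, normalised to
  be 0 elsewhere. Such functions may be arbitrary away from \<open>p\<close>, and the Leibniz rule with the
  indicator function of the complement of a neighbourhood of \<open>p\<close> shows that a derivation only
  depends on germs at \<open>p\<close>.
\<close>

type_synonym 'm tvec = "('m \<Rightarrow> real) \<Rightarrow> real"

definition tangent_space :: "'m::topological_space atlas \<Rightarrow> 'm \<Rightarrow> 'm tvec set" where
  "tangent_space A p =
    {v. (\<forall>f h. smooth_near A p f \<and> smooth_near A p h \<longrightarrow>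
           v (\<lambda>q. f q + h q) = v f + v h \<and>
           v (\<lambda>q. f q * h q) = f p * v h + h p * v f) \<and>
        (\<forall>c f. smooth_near A p f \<longrightarrow> v (\<lambda>q. c * f q) = c * v f) \<and>
        (\<forall>f. \<not> smooth_near A p f \<longrightarrow> v f = 0)}"

definition vector_field ::
  "'m::topological_space atlas \<Rightarrow> 'm set \<Rightarrow> ('m \<Rightarrow> 'm tvec) \<Rightarrow> bool" where
  "vector_field A U X \<longleftrightarrow>
    open U \<and> (\<forall>p\<in>U. X p \<in> tangent_space A p) \<and>
    (\<forall>V f. V \<subseteq> U \<and> smooth_fun A V f \<longrightarrow> smooth_fun A V (\<lambda>p. X p f))"

definition lie_bracket ::
  "'m::topological_space atlas \<Rightarrow> ('m \<Rightarrow> 'm tvec) \<Rightarrow> ('m \<Rightarrow> 'm tvec) \<Rightarrow> 'm \<Rightarrow> 'm tvec" where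
  "lie_bracket A X Y p f =
    (if smooth_near A p f then X p (\<lambda>q. Y q f) - Y p (\<lambda>q. X q f) else 0)"

text \<open>A differential \<open>k\<close>-form takes a list of \<open>k\<close> tangent vectors at the given point.\<close>

definition alternating_form :: "nat \<Rightarrow> 'm tvec set \<Rightarrow> ('m tvec list \<Rightarrow> real) \<Rightarrow> bool" where
  "alternating_form k S \<omega> \<longleftrightarrow>
    (\<forall>vs. length vs = k \<and> set vs \<subseteq> S \<longrightarrow>
      (\<forall>j<k. \<forall>v\<in>S. \<forall>w\<in>S. \<forall>a b.
         \<omega> (vs[j := (\<lambda>f. a * v f + b * w f)]) = a * \<omega> (vs[j := v]) + b * \<omega> (vs[j := w])) \<and>
      (\<not> distinct vs \<longrightarrow> \<omega> vs = 0))"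

definition differential_form ::
  "'m::topological_space atlas \<Rightarrow> nat \<Rightarrow> ('m \<Rightarrow> 'm tvec list \<Rightarrow> real) \<Rightarrow> bool" where
  "differential_form A k \<omega> \<longleftrightarrow>
    (\<forall>p. alternating_form k (tangent_space A p) (\<omega> p)) \<and>
    (\<forall>U Xs. open U \<and> length Xs = k \<and> (\<forall>X\<in>set Xs. vector_field A U X) \<longrightarrow>
       smooth_fun A U (\<lambda>p. \<omega> p (map (\<lambda>X. X p) Xs)))"

definition riemannian_metric ::
  "'m::topological_space atlas \<Rightarrow> ('m \<Rightarrow> 'm tvec \<Rightarrow> 'm tvec \<Rightarrow> real) \<Rightarrow> bool" where
  "riemannian_metric A g \<longleftrightarrow>
    (\<forall>p. \<forall>u\<in>tangent_space A p. \<forall>v\<in>tangent_space A p.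
       g p u v = g p v u \<and>
       (\<forall>w\<in>tangent_space A p. \<forall>a b.
          g p (\<lambda>f. a * u f + b * v f) w = a * g p u w + b * g p v w) \<and>
       (u \<noteq> (\<lambda>f. 0) \<longrightarrow> g p u u > 0)) \<and>
    (\<forall>U X Y. vector_field A U X \<and> vector_field A U Y \<longrightarrow>
       smooth_fun A U (\<lambda>p. g p (X p) (Y p)))"


section \<open>Connections\<close>

text \<open>
  \<open>D p v Y\<close> is the covariant derivative at \<open>p\<close> of \<open>Y\<close> in the direction \<open>v\<close>; it is meaningful if
  \<open>v\<close> is tangent at \<open>p\<close> and \<open>Y\<close> is a smooth vector field on some neighbourhood of \<open>p\<close>.
\<close>

type_synonym 'm conn = "'m \<Rightarrow> 'm tvec \<Rightarrow> ('m \<Rightarrow> 'm tvec) \<Rightarrow> 'm tvec"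

definition affine_connection :: "'m::topological_space atlas \<Rightarrow> 'm conn \<Rightarrow> bool" where
  "affine_connection A D \<longleftrightarrow>
    (\<forall>U Y. vector_field A U Y \<longrightarrow>
      (\<forall>p\<in>U. \<forall>v\<in>tangent_space A p.
         D p v Y \<in> tangent_space A p \<and>
         (\<forall>w\<in>tangent_space A p. \<forall>a b.
            D p (\<lambda>f. a * v f + b * w f) Y = (\<lambda>f. a * D p v Y f + b * D p w Y f)) \<and>
         (\<forall>Z. vector_field A U Z \<longrightarrow>
            D p v (\<lambda>q f. Y q f + Z q f) = (\<lambda>f. D p v Y f + D p v Z f)) \<and>
         (\<forall>h. smooth_fun A U h \<longrightarrow>
            D p v (\<lambda>q f. h q * Y q f) = (\<lambda>f. v h * Y p f + h p * D p v Y f))) \<and>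
      (\<forall>X. vector_field A U X \<longrightarrow> vector_field A U (\<lambda>p. D p (X p) Y)))"

definition levi_civita ::
  "'m::topological_space atlas \<Rightarrow> ('m \<Rightarrow> 'm tvec \<Rightarrow> 'm tvec \<Rightarrow> real) \<Rightarrow> 'm conn \<Rightarrow> bool" where
  "levi_civita A g D \<longleftrightarrow>
    affine_connection A D \<and>
    (\<forall>U X Y. vector_field A U X \<and> vector_field A U Y \<longrightarrow>
      (\<forall>p\<in>U. (\<lambda>f. D p (X p) Y f - D p (Y p) X f) = lie_bracket A X Y p) \<and>
      (\<forall>Z. vector_field A U Z \<longrightarrow>
        (\<forall>p\<in>U. X p (\<lambda>q. g q (Y q) (Z q)) =
           g p (D p (X p) Y) (Z p) + g p (Y p) (D p (X p) Z))))"

text \<open>The \<open>k\<close>-form \<open>\<omega>\<close> is parallel with respect to \<open>D\<close>.\<close>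

definition parallel_form ::
  "'m::topological_space atlas \<Rightarrow> 'm conn \<Rightarrow> nat \<Rightarrow> ('m \<Rightarrow> 'm tvec list \<Rightarrow> real) \<Rightarrow> bool" where
  "parallel_form A D k \<omega> \<longleftrightarrow>
    (\<forall>U X Ys. vector_field A U X \<and> length Ys = k \<and> (\<forall>Y\<in>set Ys. vector_field A U Y) \<longrightarrow>
      (\<forall>p\<in>U. X p (\<lambda>q. \<omega> q (map (\<lambda>Y. Y q) Ys)) =
         (\<Sum>j<k. \<omega> p ((map (\<lambda>Y. Y p) Ys)[j := D p (X p) (Ys ! j)]))))"

definition curvature ::
  "'m::topological_space atlas \<Rightarrow> ('m \<Rightarrow> 'm tvec \<Rightarrow> 'm tvec \<Rightarrow> real) \<Rightarrow> 'm conn \<Rightarrow> 'm \<Rightarrow>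
   ('m \<Rightarrow> 'm tvec) \<Rightarrow> ('m \<Rightarrow> 'm tvec) \<Rightarrow> ('m \<Rightarrow> 'm tvec) \<Rightarrow> ('m \<Rightarrow> 'm tvec) \<Rightarrow> real" where
  "curvature A g D p X Y Z V =
    g p (\<lambda>f. D p (X p) (\<lambda>q. D q (Y q) Z) f - D p (Y p) (\<lambda>q. D q (X q) Z) f
             - D p (lie_bracket A X Y p) Z f) (V p)"


section \<open>PSU(3)-structures\<close>

text \<open>Both charts and frames are indexed by the type \<open>8\<close>, so the sign of the determinant does not
  depend on how that type is ordered.\<close>

definition oriented_orthonormal_frame ::
  "'m::topological_space atlas \<Rightarrow> ('m \<Rightarrow> 'm tvec \<Rightarrow> 'm tvec \<Rightarrow> real) \<Rightarrow> 'm \<Rightarrow>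
   (8 \<Rightarrow> 'm tvec) \<Rightarrow> bool" where
  "oriented_orthonormal_frame A g p e \<longleftrightarrow>
    (\<forall>i. e i \<in> tangent_space A p) \<and>
    (\<forall>i j. g p (e i) (e j) = (if i = j then 1 else 0)) \<and>
    (\<forall>v\<in>tangent_space A p. \<exists>c. v = (\<lambda>f. \<Sum>i\<in>UNIV. c i * e i f)) \<and>
    (\<forall>(U, \<phi>)\<in>A. p \<in> U \<longrightarrow> det (\<chi> i j. e i (\<lambda>q. \<phi> q $ j)) > 0)"

text \<open>Expression of a \<open>k\<close>-form and of a tangent vector at a point in a frame.\<close>

definition form_in :: "nat \<Rightarrow> (8 \<Rightarrow> 'm tvec) \<Rightarrow> ('m tvec list \<Rightarrow> real) \<Rightarrow> ext" where
  "form_in k e \<omega> = (\<chi> I. if card I = k then \<omega> (map e (incr I)) else 0)"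

definition vec_in :: "('m tvec \<Rightarrow> 'm tvec \<Rightarrow> real) \<Rightarrow> (8 \<Rightarrow> 'm tvec) \<Rightarrow> 'm tvec \<Rightarrow> real ^ 8" where
  "vec_in gp e v = (\<chi> i. gp v (e i))"

definition adapted_frame ::
  "'m::topological_space atlas \<Rightarrow> ('m \<Rightarrow> 'm tvec \<Rightarrow> 'm tvec \<Rightarrow> real) \<Rightarrow>
   ('m \<Rightarrow> 'm tvec list \<Rightarrow> real) \<Rightarrow> 'm \<Rightarrow> (8 \<Rightarrow> 'm tvec) \<Rightarrow> bool" where
  "adapted_frame A g \<rho> p e \<longleftrightarrow>
    oriented_orthonormal_frame A g p e \<and> form_in 3 e (\<rho> p) = rho0"

definition psu3_structure ::
  "'m::{t2_space,second_countable_topology} atlas \<Rightarrow> ('m \<Rightarrow> 'm tvec \<Rightarrow> 'm tvec \<Rightarrow> real) \<Rightarrow>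
   ('m \<Rightarrow> 'm tvec list \<Rightarrow> real) \<Rightarrow> bool" where
  "psu3_structure A g \<rho> \<longleftrightarrow>
    oriented_atlas A \<and> riemannian_metric A g \<and> differential_form A 3 \<rho> \<and>
    (\<forall>p. \<exists>e. adapted_frame A g \<rho> p e)"

definition adapted_frame_field ::
  "'m::topological_space atlas \<Rightarrow> ('m \<Rightarrow> 'm tvec \<Rightarrow> 'm tvec \<Rightarrow> real) \<Rightarrow>
   ('m \<Rightarrow> 'm tvec list \<Rightarrow> real) \<Rightarrow> 'm set \<Rightarrow> (8 \<Rightarrow> 'm \<Rightarrow> 'm tvec) \<Rightarrow> bool" where
  "adapted_frame_field A g \<rho> U E \<longleftrightarrow>
    (\<forall>i. vector_field A U (E i)) \<and> (\<forall>p\<in>U. adapted_frame A g \<rho> p (\<lambda>i. E i p))"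

text \<open>
  The connection form at \<open>p\<close> in the frame field \<open>E\<close>: a skew-symmetric matrix \<open>\<omega>_ij\<close> is identified
  with the 2-form \<open>\<Sum>i<j. \<omega>_ij e_ij\<close>.
\<close>

definition connection_form ::
  "('m \<Rightarrow> 'm tvec \<Rightarrow> 'm tvec \<Rightarrow> real) \<Rightarrow> 'm conn \<Rightarrow> (8 \<Rightarrow> 'm \<Rightarrow> 'm tvec) \<Rightarrow> 'm \<Rightarrow> ext ^ 8" where
  "connection_form g D E p =
    (\<chi> k. \<Sum>(i, j) | prec i j. g p (D p (E k p) (E i)) (E j p) *\<^sub>R eb {i, j})"

definition intrinsic_torsion ::
  "('m \<Rightarrow> 'm tvec \<Rightarrow> 'm tvec \<Rightarrow> real) \<Rightarrow> 'm conn \<Rightarrow> (8 \<Rightarrow> 'm \<Rightarrow> 'm tvec) \<Rightarrow> 'm \<Rightarrow> ext ^ 8" where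
  "intrinsic_torsion g D E p = (\<chi> k. pr_m (connection_form g D E p $ k))"

text \<open>
  The structure is of type \<open>\<Oplus>i\<in>S. W i\<close> and has the characteristic forms \<open>T\<close> and \<open>F\<close>. Here \<open>G i\<close>
  is the \<open>W i\<close>-component of the intrinsic torsion at \<open>p\<close>. The condition on \<open>E\<close> is invariant under
  the change of adapted frame fields, which exist around every point since the orbit of \<open>rho0\<close>
  under the compact group SO(8) admits smooth local sections.
\<close>

definition type_with_characteristic_forms ::
  "'m::topological_space atlas \<Rightarrow> ('m \<Rightarrow> 'm tvec \<Rightarrow> 'm tvec \<Rightarrow> real) \<Rightarrow>
   ('m \<Rightarrow> 'm tvec list \<Rightarrow> real) \<Rightarrow> 'm conn \<Rightarrow> nat set \<Rightarrow>
   ('m \<Rightarrow> 'm tvec list \<Rightarrow> real) \<Rightarrow> ('m \<Rightarrow> 'm tvec list \<Rightarrow> real) \<Rightarrow> bool" where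
  "type_with_characteristic_forms A g \<rho> D S T F \<longleftrightarrow>
    differential_form A 3 T \<and> differential_form A 4 F \<and>
    (\<forall>p. \<exists>U E G. p \<in> U \<and> adapted_frame_field A g \<rho> U E \<and>
       intrinsic_torsion g D E p = (\<Sum>i\<in>{1..6}. G i) \<and>
       (\<forall>i\<in>{1..6}. G i \<in> W i) \<and>
       (\<forall>i\<in>{1..6} - S. G i = 0) \<and>
       form_in 3 (\<lambda>i. E i p) (T p) \<in> Lam3_8 + Lam3_20 + Lam3_27 \<and>
       Theta1 (form_in 3 (\<lambda>i. E i p) (T p)) = G 1 + G 2 + G 3 \<and>
       form_in 4 (\<lambda>i. E i p) (F p) \<in> star ` Lam4_8 + star ` Lam4_27 \<and>
       Theta2 (form_in 4 (\<lambda>i. E i p) (F p)) = G 4 + G 5)"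

text \<open>The term \<open>(x hook \<rho>) hook F\<close> is computed in adapted frames.\<close>

definition characteristic_connection ::
  "'m::topological_space atlas \<Rightarrow> ('m \<Rightarrow> 'm tvec \<Rightarrow> 'm tvec \<Rightarrow> real) \<Rightarrow>
   ('m \<Rightarrow> 'm tvec list \<Rightarrow> real) \<Rightarrow> 'm conn \<Rightarrow>
   ('m \<Rightarrow> 'm tvec list \<Rightarrow> real) \<Rightarrow> ('m \<Rightarrow> 'm tvec list \<Rightarrow> real) \<Rightarrow> 'm conn \<Rightarrow> bool" where
  "characteristic_connection A g \<rho> Dg T F Dc \<longleftrightarrow>
    (\<forall>U Y. vector_field A U Y \<longrightarrow>
      (\<forall>p\<in>U. \<forall>x\<in>tangent_space A p.
         Dc p x Y \<in> tangent_space A p \<and>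
         (\<forall>e. adapted_frame A g \<rho> p e \<longrightarrow>
           (\<forall>z\<in>tangent_space A p.
              g p (Dc p x Y) z =
                g p (Dg p x Y) z + 1/2 * T p [x, Y p, z]
                + form_eval
                    (sigma 2 (hook (vec_in (g p) e x) (form_in 3 e (\<rho> p))) (form_in 4 e (F p)))
                    [vec_in (g p) e (Y p), vec_in (g p) e z]))))"

text \<open>The right-hand side of the Bianchi identity, for the values \<open>\<rho>\<close>, \<open>T\<close>, \<open>F\<close> and \<open>v\<close> in an
  adapted frame.\<close>

definition bianchi_form :: "ext \<Rightarrow> ext \<Rightarrow> ext \<Rightarrow> real ^ 8 \<Rightarrow> ext" where
  "bianchi_form \<rho> T F v =
    (\<Sum>i\<in>UNIV. wedge (hook_e i T - sigma 2 (hook_e i \<rho>) F)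
                 (hook_e i (hook v T) - hook_e i (sigma 2 (hook v \<rho>) F)))"

end

theory Submission
  imports Defs
begin

text \<open>
  Write \<open>P(x; y, z)\<close> for the value of \<open>(x hook \<rho>) hook F\<close> on \<open>y\<close>, \<open>z\<close>, and
  \<open>B(v; x, y) = T(v, x, y) - P(v; x, y)\<close>. The 3-form \<open>rho0\<close> satisfies the Jacobi identity, and this
  is used twice. First, \<open>sigma_plus\<close> is the Chevalley--Eilenberg differential of su(3) up to a factor,
  so it squares to 0; as \<open>F = * sigma_plus(\<tau>)\<close> for some 3-form \<open>\<tau>\<close>, the cyclic sum of \<open>P\<close> is up to
  sign \<open>* sigma_plus(sigma_plus(\<tau>)) = 0\<close>, and hence the torsion \<open>S\<close> of \<open>Dc\<close> is
  \<open>g(S(x, y), v) = B(v; x, y)\<close>. Second, the connection form of \<open>Dc\<close> has no component in \<open>Lam2_20\<close>, so it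
  takes values in the span of the \<open>e_i hook rho0\<close>, which act trivially on \<open>rho0\<close>; hence \<open>\<rho>\<close> is
  parallel, and so is \<open>S\<close>. The first Bianchi identity with parallel torsion then equates the cyclic
  sum of the curvature with that of \<open>S(S(x, y), z)\<close>, and expanding \<open>S(x, y)\<close> in a frame gives the claim.
\<close>

section \<open>Exterior algebra\<close>

text \<open>The hypotheses fix \<open>Dc\<close> only through inner products with tangent vectors,
  and the contraction term only through components in adapted frames. Smoothness of
  \<open>Dc\<close> and independence of the contraction from the frame must therefore be derived.
  For the latter, the formula for \<open>Dc\<close> holds in every adapted frame and all its other
  terms are frame free. The Jacobi identity of \<open>rho0\<close> is checked as a polynomial
  identity, with a symbol of square 3 in place of \<open>sqrt 3\<close>. The connection form loses
  its \<open>Lam2_20\<close> part because the factors -1/2 and -1 in \<open>Theta1\<close> and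
  \<open>Theta2\<close> are exactly opposite to the terms T/2 and P added to \<open>Dg\<close>. The
  coefficients of \<omega> \<and> *\<open>rho0\<close> are, up to sign, the inner products of
  \<omega> with the e_k hook \<open>rho0\<close>; so a 2-form orthogonal to \<open>Lam2_20\<close>
  is some c hook \<open>rho0\<close>. This is the matrix of ad(c), and invariance of
  \<open>rho0\<close> under ad(c) is the Jacobi identity with c as one argument. P is a sum over an
  orthonormal frame that is not itself parallel. Its derivative under a metric connection is a skew
  matrix, so the extra terms cancel separately in each contracted index.\<close>

text \<open>\<open>Rep_bit0\<close> picks the representative in 0, ..., 7. Subtracting 1 beforehand
  puts the literal 8, which equals 0 in the type, last, and comparisons of literals become decidable
  integer comparisons.\<close>

definition rank8 :: "8 \<Rightarrow> int" where
  "rank8 i = Rep_bit0 (i - 1)"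

lemma prec_rank8: "prec i j \<longleftrightarrow> rank8 i < rank8 j"
  by (simp add: prec_def rank8_def less_bit0_def)

lemma rank8_eq_iff: "rank8 i = rank8 j \<longleftrightarrow> i = j"
  by (simp add: rank8_def Rep_bit0_inject)

lemma rank8_numeral:
  "rank8 1 = 0" "rank8 2 = 1" "rank8 3 = 2" "rank8 4 = 3"
  "rank8 5 = 4" "rank8 6 = 5" "rank8 7 = 6" "rank8 8 = 7"
  by (simp_all add: rank8_def bit0.Rep_numeral bit0.Rep_0 bit0.Rep_1)

lemma UNIV_8: "(UNIV :: 8 set) = {1, 2, 3, 4, 5, 6, 7, 8}"
proof (rule sym, rule card_subset_eq)
  have "distinct (map rank8 [1, 2, 3, 4, 5, 6, 7, 8])"
    by (simp add: rank8_numeral)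
  then have "distinct [1, 2, 3, 4, 5, 6, 7, 8 :: 8]"
    by (simp add: distinct_map)
  then show "card {1, 2, 3, 4, 5, 6, 7, 8 :: 8} = card (UNIV :: 8 set)"
    using distinct_card[of "[1, 2, 3, 4, 5, 6, 7, 8 :: 8]"] by simp
qed auto

lemma prec_irrefl: "\<not> prec i i"
  and prec_trans: "prec i j \<Longrightarrow> prec j k \<Longrightarrow> prec i k"
  and prec_antisym: "prec i j \<Longrightarrow> \<not> prec j i"
  and prec_total: "i \<noteq> j \<Longrightarrow> prec i j \<or> prec j i"
  using rank8_eq_iff[of i j] by (auto simp: prec_rank8)

lemma sorted_incr: "sorted_wrt prec (incr I)"
  unfolding incr_def by (rule sorted_wrt_filter) (simp add: prec_rank8 rank8_numeral)

lemma set_incr [simp]: "set (incr I) = I"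
proof -
  have "set [1, 2, 3, 4, 5, 6, 7, 8] = (UNIV :: 8 set)" by (simp add: UNIV_8)
  then show ?thesis unfolding incr_def set_filter by simp
qed

lemma distinct_sorted_prec: "sorted_wrt prec xs \<Longrightarrow> distinct xs"
  by (induction xs) (auto simp: prec_irrefl)

lemma length_incr [simp]: "length (incr I) = card I"
  using distinct_card[OF distinct_sorted_prec[OF sorted_incr], of I] by simp

lemma sorted_prec_unique:
  "sorted_wrt prec xs \<Longrightarrow> sorted_wrt prec ys \<Longrightarrow> set xs = set ys \<Longrightarrow> xs = ys"
proof (induction xs arbitrary: ys)
  case (Cons x xs)
  then obtain y ys' where ys: "ys = y # ys'" by (cases ys) auto
  have "x = y"
    using Cons.prems unfolding ys by (auto dest: prec_antisym) (metis insert_iff prec_antisym)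
  moreover have "set xs = set ys'"
    using Cons.prems unfolding ys \<open>x = y\<close> by (auto simp: prec_irrefl insert_eq_iff set_eq_iff)
      (metis prec_irrefl)+
  ultimately show ?case
    using Cons.IH[of ys'] Cons.prems unfolding ys by simp
qed auto

lemma incr_pair: "prec i j \<Longrightarrow> incr {i, j} = [i, j]"
  by (rule sorted_prec_unique) (simp_all add: sorted_incr)

lemma incr_singleton: "incr {i} = [i]"
  by (rule sorted_prec_unique) (simp_all add: sorted_incr)

section \<open>Calculus of shuffle signs\<close>

lemma shuffle_sign_empty [simp]: "shuffle_sign {} J = 1" "shuffle_sign I {} = 1"
  by (simp_all add: shuffle_sign_def)

lemma shuffle_sign_square [simp]: "shuffle_sign I J * shuffle_sign I J = 1"
  by (simp add: shuffle_sign_def flip: power_add)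

lemma shuffle_sign_Un_left:
  assumes "I \<inter> I' = {}"
  shows "shuffle_sign (I \<union> I') J = shuffle_sign I J * shuffle_sign I' J"
proof -
  have "{(i, j). i \<in> I \<union> I' \<and> j \<in> J \<and> prec j i} =
      {(i, j). i \<in> I \<and> j \<in> J \<and> prec j i} \<union> {(i, j). i \<in> I' \<and> j \<in> J \<and> prec j i}" by auto
  then show ?thesis
    using assms by (simp add: shuffle_sign_def card_Un_disjoint disjoint_iff flip: power_add)
qed

lemma shuffle_sign_Un_right:
  assumes "J \<inter> J' = {}"
  shows "shuffle_sign I (J \<union> J') = shuffle_sign I J * shuffle_sign I J'"
proof -
  have "{(i, j). i \<in> I \<and> j \<in> J \<union> J' \<and> prec j i} =
      {(i, j). i \<in> I \<and> j \<in> J \<and> prec j i} \<union> {(i, j). i \<in> I \<and> j \<in> J' \<and> prec j i}" by auto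
  then show ?thesis
    using assms by (simp add: shuffle_sign_def card_Un_disjoint disjoint_iff flip: power_add)
qed

lemma shuffle_sign_insert_left:
  "i \<notin> I \<Longrightarrow> shuffle_sign (insert i I) J = shuffle_sign {i} J * shuffle_sign I J"
  using shuffle_sign_Un_left[of "{i}" I J] by simp

lemma shuffle_sign_insert_right:
  "j \<notin> J \<Longrightarrow> shuffle_sign I (insert j J) = shuffle_sign I {j} * shuffle_sign I J"
  using shuffle_sign_Un_right[of "{j}" J I] by simp

text \<open>Each pair in \<open>I \<times> J\<close> is an inversion for exactly one of the two
  orders of concatenation, so the two exponents add up to the number of all pairs.\<close>

lemma shuffle_sign_swap:
  assumes "I \<inter> J = {}"
  shows "shuffle_sign I J * shuffle_sign J I = (-1) ^ (card I * card J)"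
proof -
  let ?P = "{(i, j). i \<in> I \<and> j \<in> J \<and> prec j i}" and ?Q = "{(i, j). i \<in> J \<and> j \<in> I \<and> prec j i}"
  have swap: "prod.swap ` ?Q = {(i, j). i \<in> I \<and> j \<in> J \<and> prec i j}"
    by (auto simp: image_iff)
  have 1: "card ?Q = card (prod.swap ` ?Q)" by (simp add: card_image)
  have 2: "?P \<inter> prod.swap ` ?Q = {}" unfolding swap by (auto dest: prec_antisym)
  have "prec i j \<or> prec j i" if "i \<in> I" "j \<in> J" for i j
    using that assms prec_total[of i j] by blast
  then have 3: "?P \<union> prod.swap ` ?Q = I \<times> J" unfolding swap by auto
  have "card ?P + card ?Q = card (?P \<union> prod.swap ` ?Q)"
    unfolding 1 by (rule card_Un_disjoint[symmetric, OF finite finite 2])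
  also have "\<dots> = card I * card J" unfolding 3 by (rule card_cartesian_product)
  finally have "card ?P + card ?Q = card I * card J" .
  then show ?thesis unfolding shuffle_sign_def by (simp flip: power_add)
qed

lemma shuffle_sign_swap':
  "I \<inter> J = {} \<Longrightarrow> shuffle_sign I J = (-1) ^ (card I * card J) * shuffle_sign J I"
  using shuffle_sign_swap[of I J] by (metis mult.assoc mult.right_neutral shuffle_sign_square)

section \<open>Interior products\<close>

lemma hook_e_nth:
  "hook_e i \<alpha> $ I = (if i \<in> I then 0 else shuffle_sign {i} I * \<alpha> $ insert i I)"
  by (simp add: hook_e_def hook_def axis_def if_distrib[of "\<lambda>x. x * _"] sum.delta cong: if_cong)

lemma hook_sum: "hook x \<alpha> = (\<Sum>i\<in>UNIV. x $ i *\<^sub>R hook_e i \<alpha>)"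
proof (rule vec_eq_iff[THEN iffD2], rule allI)
  fix I
  have "(\<Sum>i\<in>UNIV. x $ i *\<^sub>R hook_e i \<alpha>) $ I =
      (\<Sum>i\<in>UNIV. if i \<in> - I then x $ i * shuffle_sign {i} I * \<alpha> $ insert i I else 0)"
    by (auto simp: hook_e_nth intro!: sum.cong)
  then show "hook x \<alpha> $ I = (\<Sum>i\<in>UNIV. x $ i *\<^sub>R hook_e i \<alpha>) $ I"
    by (simp add: hook_def sum.If_cases flip: Compl_eq)
qed

lemma linear_hook: "linear (hook x)"
  by (rule linearI)
    (simp_all add: vec_eq_iff hook_def algebra_simps sum.distrib sum_distrib_left)

lemma linear_hook_left: "linear (\<lambda>x. hook x \<alpha>)"
  by (rule linearI)
    (simp_all add: hook_sum algebra_simps sum.distrib scaleR_sum_right)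

lemma linear_hook_e: "linear (hook_e i)"
  unfolding hook_e_def by (rule linear_hook)

lemmas hook_simps = linear_add[OF linear_hook] linear_diff[OF linear_hook] linear_0[OF linear_hook]
  linear_cmul[OF linear_hook] linear_neg[OF linear_hook] linear_sum[OF linear_hook]

lemmas hook_left_simps = linear_add[OF linear_hook_left] linear_diff[OF linear_hook_left]
  linear_0[OF linear_hook_left] linear_cmul[OF linear_hook_left] linear_neg[OF linear_hook_left]
  linear_sum[OF linear_hook_left]

lemmas hook_e_simps = linear_add[OF linear_hook_e] linear_diff[OF linear_hook_e]
  linear_0[OF linear_hook_e] linear_cmul[OF linear_hook_e] linear_neg[OF linear_hook_e]
  linear_sum[OF linear_hook_e]

text \<open>Both orders read the same coefficient of \<open>\<alpha>\<close>, and the signs relative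
  to \<open>I\<close> agree; what differs is the sign of \<open>i\<close> against
  \<open>j\<close>.\<close>

lemma hook_e_anticommute: "hook_e i (hook_e j \<alpha>) = - hook_e j (hook_e i \<alpha>)"
proof (rule vec_eq_iff[THEN iffD2], rule allI)
  fix I
  show "hook_e i (hook_e j \<alpha>) $ I = (- hook_e j (hook_e i \<alpha>)) $ I"
  proof (cases "i = j \<or> i \<in> I \<or> j \<in> I")
    case True
    then show ?thesis by (auto simp: hook_e_nth)
  next
    case False
    then have "shuffle_sign {i} {j} = - shuffle_sign {j} {i}"
      using shuffle_sign_swap'[of "{i}" "{j}"] by simp
    then have "shuffle_sign {i} I * shuffle_sign {j} (insert i I) =
        - (shuffle_sign {j} I * shuffle_sign {i} (insert j I))"
      using False shuffle_sign_insert_right[of i I "{j}"] shuffle_sign_insert_right[of j I "{i}"] by simp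
    moreover have "hook_e i (hook_e j \<alpha>) $ I =
        shuffle_sign {i} I * shuffle_sign {j} (insert i I) * \<alpha> $ insert i (insert j I)"
      using False by (auto simp: hook_e_nth insert_commute[of j i I])
    moreover have "hook_e j (hook_e i \<alpha>) $ I =
        shuffle_sign {j} I * shuffle_sign {i} (insert j I) * \<alpha> $ insert i (insert j I)"
      using False by (auto simp: hook_e_nth insert_commute)
    ultimately show ?thesis by simp
  qed
qed

lemma hook_anticommute: "hook x (hook y \<alpha>) = - hook y (hook x \<alpha>)"
proof -
  have "hook x (hook y \<alpha>) = (\<Sum>i\<in>UNIV. \<Sum>j\<in>UNIV. (x $ i * y $ j) *\<^sub>R hook_e i (hook_e j \<alpha>))"
    by (simp add: hook_sum hook_e_simps scaleR_sum_right)
  also have "\<dots> = (\<Sum>j\<in>UNIV. \<Sum>i\<in>UNIV. (x $ i * y $ j) *\<^sub>R (- hook_e j (hook_e i \<alpha>)))"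
    by (subst sum.swap) (simp flip: hook_e_anticommute)
  also have "\<dots> = - hook y (hook x \<alpha>)"
    by (simp add: hook_sum hook_e_simps scaleR_sum_right sum_negf mult.commute)
  finally show ?thesis .
qed

lemma hook_self: "hook x (hook x \<alpha>) = 0"
  using hook_anticommute[of x x \<alpha>] by (simp add: eq_neg_iff_add_eq_0 flip: scaleR_2)

lemma subspace_Lam: "subspace (Lam k)"
  by (auto simp: subspace_def Lam_def)

lemma Lam_hook_e: "\<alpha> \<in> Lam (Suc k) \<Longrightarrow> hook_e i \<alpha> \<in> Lam k"
  by (auto simp: Lam_def hook_e_nth)

lemma Lam_hook: "\<alpha> \<in> Lam (Suc k) \<Longrightarrow> hook x \<alpha> \<in> Lam k"
  by (simp add: hook_sum subspace_sum[OF subspace_Lam] subspace_scale[OF subspace_Lam] Lam_hook_e)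

lemma hook_e_Lam0: "\<alpha> \<in> Lam 0 \<Longrightarrow> hook_e i \<alpha> = 0"
  by (auto simp: Lam_def hook_e_nth vec_eq_iff)

section \<open>Exterior products\<close>

lemma linear_wedge_left: "linear (\<lambda>\<alpha>. wedge \<alpha> \<beta>)"
  by (rule linearI) (simp_all add: vec_eq_iff wedge_def algebra_simps sum.distrib sum_distrib_left)

lemma linear_wedge_right: "linear (wedge \<alpha>)"
  by (rule linearI) (simp_all add: vec_eq_iff wedge_def algebra_simps sum.distrib sum_distrib_left)

lemmas wedge_simps = linear_add[OF linear_wedge_left] linear_diff[OF linear_wedge_left]
  linear_0[OF linear_wedge_left] linear_cmul[OF linear_wedge_left] linear_neg[OF linear_wedge_left]
  linear_sum[OF linear_wedge_left]
  linear_add[OF linear_wedge_right] linear_diff[OF linear_wedge_right]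
  linear_0[OF linear_wedge_right] linear_cmul[OF linear_wedge_right]
  linear_neg[OF linear_wedge_right] linear_sum[OF linear_wedge_right]

lemma Lam_wedge:
  assumes "\<alpha> \<in> Lam k" "\<beta> \<in> Lam l" shows "wedge \<alpha> \<beta> \<in> Lam (k + l)"
proof -
  have "\<alpha> $ I = 0 \<or> \<beta> $ (K - I) = 0" if "card K \<noteq> k + l" "I \<subseteq> K" for I K
  proof -
    have "card K = card I + card (K - I)"
      using that(2) by (simp add: card_Diff_subset card_mono)
    then show ?thesis using assms that by (auto simp: Lam_def)
  qed
  then show ?thesis unfolding Lam_def wedge_def by (auto intro!: sum.neutral)
qed

lemma wedge_commute:
  assumes "\<alpha> \<in> Lam k" "\<beta> \<in> Lam l" shows "wedge \<alpha> \<beta> = (-1) ^ (k * l) *\<^sub>R wedge \<beta> \<alpha>"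
proof (rule vec_eq_iff[THEN iffD2], rule allI)
  fix K
  have "wedge \<alpha> \<beta> $ K = (\<Sum>J\<in>Pow K. shuffle_sign (K - J) J * \<alpha> $ (K - J) * \<beta> $ J)"
    unfolding wedge_def
    by (simp, rule sum.reindex_bij_witness[where i="\<lambda>J. K - J" and j="\<lambda>J. K - J"])
      (auto simp: double_diff)
  also have "\<dots> = (\<Sum>J\<in>Pow K. (-1) ^ (k * l) * (shuffle_sign J (K - J) * \<beta> $ J * \<alpha> $ (K - J)))"
  proof (rule sum.cong)
    fix J assume "J \<in> Pow K"
    have "\<alpha> $ (K - J) = 0 \<or> \<beta> $ J = 0 \<or> card (K - J) = k \<and> card J = l"
      using assms by (auto simp: Lam_def)
    then show "shuffle_sign (K - J) J * \<alpha> $ (K - J) * \<beta> $ J =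
        (-1) ^ (k * l) * (shuffle_sign J (K - J) * \<beta> $ J * \<alpha> $ (K - J))"
      using shuffle_sign_swap'[of "K - J" J] by auto
  qed simp
  also have "\<dots> = ((-1) ^ (k * l) *\<^sub>R wedge \<beta> \<alpha>) $ K"
    by (simp add: wedge_def sum_distrib_left)
  finally show "wedge \<alpha> \<beta> $ K = ((-1) ^ (k * l) *\<^sub>R wedge \<beta> \<alpha>) $ K" .
qed

text \<open>Both sides run over the ordered partitions of \<open>K\<close> into three blocks. As
  shuffle signs are multiplicative in disjoint unions, each side carries the product of the three
  pairwise signs.\<close>

lemma wedge_assoc: "wedge (wedge \<alpha> \<beta>) \<gamma> = wedge \<alpha> (wedge \<beta> \<gamma>)"
proof (rule vec_eq_iff[THEN iffD2], rule allI)
  fix K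
  have "wedge (wedge \<alpha> \<beta>) \<gamma> $ K = (\<Sum>L\<in>Pow K. \<Sum>I\<in>Pow L.
      shuffle_sign L (K - L) * shuffle_sign I (L - I) * \<alpha> $ I * \<beta> $ (L - I) * \<gamma> $ (K - L))"
    by (simp add: wedge_def sum_distrib_left sum_distrib_right mult.assoc)
  also have "\<dots> = (\<Sum>(L, I)\<in>Sigma (Pow K) Pow.
      shuffle_sign L (K - L) * shuffle_sign I (L - I) * \<alpha> $ I * \<beta> $ (L - I) * \<gamma> $ (K - L))"
    by (rule sum.Sigma) auto
  also have "\<dots> = (\<Sum>(I, J)\<in>Sigma (Pow K) (\<lambda>I. Pow (K - I)).
      shuffle_sign I (K - I) * shuffle_sign J (K - I - J) * \<alpha> $ I * \<beta> $ J * \<gamma> $ (K - I - J))"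
  proof (rule sum.reindex_bij_witness[where i="\<lambda>(I, J). (I \<union> J, I)" and j="\<lambda>(L, I). (I, L - I)"])
    fix a assume "a \<in> Sigma (Pow K) Pow"
    then obtain L I where a: "a = (L, I)" "I \<subseteq> L" "L \<subseteq> K" by auto
    have 1: "K - I - (L - I) = K - L" using a by auto
    have "shuffle_sign L (K - L) = shuffle_sign I (K - L) * shuffle_sign (L - I) (K - L)"
      using shuffle_sign_Un_left[of I "L - I" "K - L"] a by (simp add: Un_absorb1)
    moreover have "K - I = (L - I) \<union> (K - L)" using a by auto
    then have "shuffle_sign I (K - I) = shuffle_sign I (L - I) * shuffle_sign I (K - L)"
      using shuffle_sign_Un_right[of "L - I" "K - L" I] by auto
    ultimately show "(case case a of (L, I) \<Rightarrow> (I, L - I) of (I, J) \<Rightarrow>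
        shuffle_sign I (K - I) * shuffle_sign J (K - I - J) * \<alpha> $ I * \<beta> $ J * \<gamma> $ (K - I - J)) =
      (case a of (L, I) \<Rightarrow>
        shuffle_sign L (K - L) * shuffle_sign I (L - I) * \<alpha> $ I * \<beta> $ (L - I) * \<gamma> $ (K - L))"
      by (simp add: a(1) 1)
  qed auto
  also have "\<dots> = (\<Sum>I\<in>Pow K. \<Sum>J\<in>Pow (K - I).
      shuffle_sign I (K - I) * shuffle_sign J (K - I - J) * \<alpha> $ I * \<beta> $ J * \<gamma> $ (K - I - J))"
    by (rule sum.Sigma[symmetric]) auto
  also have "\<dots> = wedge \<alpha> (wedge \<beta> \<gamma>) $ K"
    by (simp add: wedge_def sum_distrib_left mult_ac)
  finally show "wedge (wedge \<alpha> \<beta>) \<gamma> $ K = wedge \<alpha> (wedge \<beta> \<gamma>) $ K" .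
qed

text \<open>Compare coefficients at \<open>K\<close>. If \<open>i\<close> lies in \<open>K\<close>,
  the left side vanishes and the two terms on the right cancel. Otherwise the subsets of
  \<open>insert i K\<close> are split by which of the two factors receives \<open>i\<close>.\<close>

lemma hook_e_wedge:
  assumes "\<alpha> \<in> Lam k"
  shows "hook_e i (wedge \<alpha> \<beta>) =
    wedge (hook_e i \<alpha>) \<beta> + (-1) ^ k *\<^sub>R wedge \<alpha> (hook_e i \<beta>)"
proof (rule vec_eq_iff[THEN iffD2], rule allI)
  fix K
  show "hook_e i (wedge \<alpha> \<beta>) $ K =
    (wedge (hook_e i \<alpha>) \<beta> + (-1) ^ k *\<^sub>R wedge \<alpha> (hook_e i \<beta>)) $ K"
  proof (cases "i \<in> K")
    case True
    define L where "L = K - {i}"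
    have L: "i \<notin> L" "K = insert i L" using True by (auto simp: L_def)
    have "wedge (hook_e i \<alpha>) \<beta> $ K =
        (\<Sum>I\<in>Pow L. shuffle_sign I (K - I) * hook_e i \<alpha> $ I * \<beta> $ (K - I))
      + (\<Sum>I\<in>insert i ` Pow L. shuffle_sign I (K - I) * hook_e i \<alpha> $ I * \<beta> $ (K - I))"
      using L(1) unfolding L(2) wedge_def vec_lambda_beta Pow_insert
      by (subst sum.union_disjoint) auto
    also have "(\<Sum>I\<in>insert i ` Pow L. shuffle_sign I (K - I) * hook_e i \<alpha> $ I * \<beta> $ (K - I)) = 0"
      by (rule sum.neutral) (auto simp: hook_e_nth)
    finally have 1: "wedge (hook_e i \<alpha>) \<beta> $ K =
        (\<Sum>I\<in>Pow L. shuffle_sign I (K - I) * hook_e i \<alpha> $ I * \<beta> $ (K - I))" by simp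
    have "wedge \<alpha> (hook_e i \<beta>) $ K =
        (\<Sum>I\<in>Pow L. shuffle_sign I (K - I) * \<alpha> $ I * hook_e i \<beta> $ (K - I))
      + (\<Sum>I\<in>insert i ` Pow L. shuffle_sign I (K - I) * \<alpha> $ I * hook_e i \<beta> $ (K - I))"
      using L(1) unfolding L(2) wedge_def vec_lambda_beta Pow_insert
      by (subst sum.union_disjoint) auto
    also have "(\<Sum>I\<in>Pow L. shuffle_sign I (K - I) * \<alpha> $ I * hook_e i \<beta> $ (K - I)) = 0"
      using True L by (intro sum.neutral) (auto simp: hook_e_nth)
    also have "(\<Sum>I\<in>insert i ` Pow L. shuffle_sign I (K - I) * \<alpha> $ I * hook_e i \<beta> $ (K - I)) =
        (\<Sum>I\<in>Pow L. - ((-1) ^ k * (shuffle_sign I (K - I) * hook_e i \<alpha> $ I * \<beta> $ (K - I))))"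
    proof (rule sum.reindex_cong[of "insert i"])
      show "inj_on (insert i) (Pow L)" using L by (auto simp: inj_on_def insert_ident)
      fix I assume I: "I \<in> Pow L"
      then have i: "i \<notin> I" "i \<notin> L - I" "K - insert i I = L - I" "K - I = insert i (L - I)"
        using L by auto
      \<comment> \<open>The coefficient sits on a set with one element more than \<open>I\<close>.
        Moving \<open>i\<close> past \<open>I\<close> gives the sign of \<open>card I\<close>, so
        against \<open>(-1) ^ k\<close> a minus sign remains, which makes the two terms
        cancel.\<close>
      have "\<alpha> $ insert i I \<noteq> 0 \<Longrightarrow> k = Suc (card I)"
        using assms i(1) by (cases "card (insert i I) = k") (auto simp: Lam_def)
      then show "shuffle_sign (insert i I) (K - insert i I) * \<alpha> $ insert i I *
          hook_e i \<beta> $ (K - insert i I) =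
        - ((-1) ^ k * (shuffle_sign I (K - I) * hook_e i \<alpha> $ I * \<beta> $ (K - I)))"
        using i shuffle_sign_swap'[of "{i}" I] shuffle_sign_insert_left[of i I "L - I"]
          shuffle_sign_insert_right[of i "L - I" I]
        by (cases "\<alpha> $ insert i I = 0") (auto simp: hook_e_nth mult_ac)
    qed simp
    finally have "wedge \<alpha> (hook_e i \<beta>) $ K = - ((-1) ^ k * wedge (hook_e i \<alpha>) \<beta> $ K)"
      by (simp add: 1 sum_negf sum_distrib_left)
    then show ?thesis using True by (simp add: hook_e_nth flip: mult.assoc power_add)
  next
    case False
    have *: "K - I \<subseteq> - {i}" for I using False by auto
    have "hook_e i (wedge \<alpha> \<beta>) $ K = shuffle_sign {i} K *
        (\<Sum>I\<in>Pow (insert i K). shuffle_sign I (insert i K - I) * \<alpha> $ I * \<beta> $ (insert i K - I))"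
      using False by (simp add: hook_e_nth wedge_def)
    also have "\<dots> =
        (\<Sum>I\<in>Pow K. shuffle_sign {i} K * shuffle_sign I (insert i K - I) * \<alpha> $ I * \<beta> $ (insert i K - I))
      + (\<Sum>I\<in>insert i ` Pow K. shuffle_sign {i} K * shuffle_sign I (insert i K - I) * \<alpha> $ I * \<beta> $ (insert i K - I))"
      using False unfolding Pow_insert
      by (subst sum.union_disjoint) (auto simp: distrib_left sum_distrib_left mult.assoc)
    also have "(\<Sum>I\<in>Pow K. shuffle_sign {i} K * shuffle_sign I (insert i K - I) * \<alpha> $ I * \<beta> $ (insert i K - I))
      = (\<Sum>I\<in>Pow K. (-1) ^ k * (shuffle_sign I (K - I) * \<alpha> $ I * hook_e i \<beta> $ (K - I)))"
    proof (rule sum.cong)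
      fix I assume I: "I \<in> Pow K"
      then have i: "i \<notin> I" "i \<notin> K - I" "insert i K - I = insert i (K - I)" "K = I \<union> (K - I)"
        using False by auto
      have 1: "shuffle_sign {i} K = shuffle_sign {i} I * shuffle_sign {i} (K - I)"
        using shuffle_sign_Un_right[of I "K - I" "{i}"] i(4) by auto
      have 2: "shuffle_sign I (insert i (K - I)) = shuffle_sign I {i} * shuffle_sign I (K - I)"
        using i(2) by (rule shuffle_sign_insert_right)
      have 3: "shuffle_sign {i} I * shuffle_sign I {i} = (-1) ^ k" if "\<alpha> $ I \<noteq> 0"
        using shuffle_sign_swap[of "{i}" I] i that assms by (auto simp: Lam_def)
      show "shuffle_sign {i} K * shuffle_sign I (insert i K - I) * \<alpha> $ I * \<beta> $ (insert i K - I)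
        = (-1) ^ k * (shuffle_sign I (K - I) * \<alpha> $ I * hook_e i \<beta> $ (K - I))"
        using 3 i by (cases "\<alpha> $ I = 0") (auto simp: hook_e_nth 1 2 mult_ac)
    qed simp
    also have "(\<Sum>I\<in>insert i ` Pow K. shuffle_sign {i} K * shuffle_sign I (insert i K - I) * \<alpha> $ I * \<beta> $ (insert i K - I))
      = (\<Sum>I\<in>Pow K. shuffle_sign I (K - I) * hook_e i \<alpha> $ I * \<beta> $ (K - I))"
    proof (rule sum.reindex_cong[of "insert i"])
      show "inj_on (insert i) (Pow K)" using False by (auto simp: inj_on_def insert_ident)
      fix I assume I: "I \<in> Pow K"
      then have i: "i \<notin> I" "insert i K - insert i I = K - I" "K = I \<union> (K - I)"
        using False by auto
      have 1: "shuffle_sign {i} K = shuffle_sign {i} I * shuffle_sign {i} (K - I)"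
        using shuffle_sign_Un_right[of I "K - I" "{i}"] i(3) by auto
      show "shuffle_sign {i} K * shuffle_sign (insert i I) (insert i K - insert i I) * \<alpha> $ insert i I *
        \<beta> $ (insert i K - insert i I) = shuffle_sign I (K - I) * hook_e i \<alpha> $ I * \<beta> $ (K - I)"
        using i shuffle_sign_insert_left[of i I "K - I"] by (simp add: hook_e_nth 1 mult_ac)
    qed simp
    finally show ?thesis by (simp add: wedge_def sum_distrib_left add.commute)
  qed
qed

lemma hook_wedge:
  assumes "\<alpha> \<in> Lam k"
  shows "hook x (wedge \<alpha> \<beta>) = wedge (hook x \<alpha>) \<beta> + (-1) ^ k *\<^sub>R wedge \<alpha> (hook x \<beta>)"
  by (simp add: hook_sum hook_e_wedge[OF assms] wedge_simps scaleR_add_right sum.distrib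
      scaleR_sum_right mult.commute)

lemma wedge_Lam0: 
  assumes "\<alpha> \<in> Lam 0" shows "wedge \<alpha> \<beta> = \<alpha> $ {} *\<^sub>R \<beta>"
proof (rule vec_eq_iff[THEN iffD2], rule allI)
  fix K
  have "wedge \<alpha> \<beta> $ K = (\<Sum>I\<in>Pow K. if I = {} then \<alpha> $ {} * \<beta> $ K else 0)"
    unfolding wedge_def vec_lambda_beta by (rule sum.cong) (use assms in \<open>auto simp: Lam_def\<close>)
  then show "wedge \<alpha> \<beta> $ K = (\<alpha> $ {} *\<^sub>R \<beta>) $ K" by simp
qed

section \<open>Values of forms on lists of vectors\<close>

lemma linear_fold_hook: "linear (fold hook xs)"
proof (induction xs)
  case Nil
  show ?case by (simp add: linear_iff)
next
  case (Cons x xs)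
  show ?case using linear_compose[OF linear_hook Cons.IH, of x] by (simp add: comp_def)
qed

lemma linear_form_eval: "linear (\<lambda>\<alpha>. form_eval \<alpha> xs)"
  using linear_fold_hook[of xs] by (auto simp: form_eval_def linear_iff)

lemmas form_eval_simps = linear_add[OF linear_form_eval] linear_diff[OF linear_form_eval]
  linear_0[OF linear_form_eval] linear_cmul[OF linear_form_eval] linear_neg[OF linear_form_eval]
  linear_sum[OF linear_form_eval]

lemma linear_form_eval_slot: "linear (\<lambda>x. form_eval \<alpha> (xs @ x # ys))"
proof -
  have "(\<lambda>x. form_eval \<alpha> (xs @ x # ys)) = (\<lambda>x. form_eval (hook x (fold hook xs \<alpha>)) ys)"
    by (simp add: form_eval_def)
  then show ?thesis
    using linear_compose[OF linear_hook_left linear_form_eval] by (simp add: comp_def)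
qed

lemma form_eval_Cons: "form_eval \<alpha> (x # xs) = form_eval (hook x \<alpha>) xs"
  by (simp add: form_eval_def)

lemma form_eval_swap: "form_eval \<alpha> (xs @ x # y # ys) = - form_eval \<alpha> (xs @ y # x # ys)"
  using hook_anticommute[of y x "fold hook xs \<alpha>"]
  by (simp add: form_eval_def linear_neg[OF linear_fold_hook])

definition unit8 :: "8 \<Rightarrow> real ^ 8" where
  "unit8 i = axis i 1"

lemma hook_unit8: "hook (unit8 i) = hook_e i"
  by (simp add: unit8_def hook_e_def)

lemma unit8_sum: "x = (\<Sum>i\<in>UNIV. x $ i *\<^sub>R unit8 i)"
  by (simp add: vec_eq_iff unit8_def axis_def if_distrib[of "\<lambda>y. _ * y"] cong: if_cong)

text \<open>The vector hooked last has the largest index of the list, and this index still precedes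
  all of \<open>I\<close>, so inserting it costs no sign. This is why the induction appends at the
  end of the list and enlarges \<open>I\<close>.\<close>

lemma fold_hook_sorted:
  "sorted_wrt prec is \<Longrightarrow> I \<inter> set is = {} \<Longrightarrow> (\<forall>i\<in>set is. \<forall>j\<in>I. prec i j) \<Longrightarrow>
    fold hook (map unit8 is) \<alpha> $ I = \<alpha> $ (set is \<union> I)"
proof (induction "is" arbitrary: I rule: rev_induct)
  case (snoc i "is")
  have s: "shuffle_sign {i} I = 1"
  proof -
    have "{(i', j). i' \<in> {i} \<and> j \<in> I \<and> prec j i'} = {}"
      using snoc.prems(3) by (auto dest: prec_antisym)
    then show ?thesis unfolding shuffle_sign_def by (simp only: card.empty power_0)
  qed
  have "fold hook (map unit8 is) \<alpha> $ insert i I = \<alpha> $ (set is \<union> insert i I)"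
    using snoc.prems distinct_sorted_prec[OF snoc.prems(1)]
    by (intro snoc.IH) (auto simp: sorted_wrt_append)
  then show ?case using snoc.prems by (auto simp: hook_unit8 hook_e_nth s)
qed simp

lemma form_eval_incr: "form_eval \<alpha> (map unit8 (incr I)) = \<alpha> $ I"
  using fold_hook_sorted[OF sorted_incr, of "{}" I \<alpha>] by (simp add: form_eval_def)

lemma form_eqI:
  assumes "\<alpha> \<in> Lam k" "\<beta> \<in> Lam k"
    and "\<And>is. length is = k \<Longrightarrow> form_eval \<alpha> (map unit8 is) = form_eval \<beta> (map unit8 is)"
  shows "\<alpha> = \<beta>"
proof (rule vec_eq_iff[THEN iffD2], rule allI)
  fix I
  show "\<alpha> $ I = \<beta> $ I"
  proof (cases "card I = k")
    case True
    then show ?thesis using assms(3)[of "incr I"] by (simp add: form_eval_incr)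
  next
    case False
    then show ?thesis using assms(1,2) by (simp add: Lam_def)
  qed
qed

lemma Lam_eb: "eb I \<in> Lam (card I)"
  by (auto simp: Lam_def eb_def axis_def)

lemma hook_eb_singleton: "hook x (eb {k}) = x $ k *\<^sub>R eb {}"
proof (rule vec_eq_iff[THEN iffD2], rule allI)
  fix I :: "8 set"
  have "hook_e i (eb {k}) = (if i = k then eb {} else 0)" for i
  proof (rule vec_eq_iff[THEN iffD2], rule allI)
    fix I
    have "insert i I = {k} \<longleftrightarrow> i = k \<and> I = {}" if "i \<notin> I" using that by auto
    then show "hook_e i (eb {k}) $ I = (if i = k then eb {} else 0) $ I"
      by (auto simp: hook_e_nth eb_def axis_def)
  qed
  then have "hook x (eb {k}) = (\<Sum>i\<in>UNIV. if i = k then x $ k *\<^sub>R eb {} else 0)"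
    unfolding hook_sum by (intro sum.cong) auto
  then show "hook x (eb {k}) $ I = (x $ k *\<^sub>R eb {}) $ I" by simp
qed

lemma wedge_eb_empty [simp]: "wedge (eb {}) \<beta> = \<beta>"
  using wedge_Lam0[of "eb {}" \<beta>] Lam_eb[of "{}"] by (simp add: eb_def axis_def)

lemma hook_wedge_eb: "hook x (wedge (eb {k}) \<beta>) = x $ k *\<^sub>R \<beta> - wedge (eb {k}) (hook x \<beta>)"
  using hook_wedge[of "eb {k}" 1 x \<beta>] Lam_eb[of "{k}"] by (simp add: hook_eb_singleton wedge_simps)

lemma hook_Lam0: "\<alpha> \<in> Lam 0 \<Longrightarrow> hook x \<alpha> = 0"
  by (simp add: hook_sum hook_e_Lam0)

lemma hook_eb_empty [simp]: "hook x (eb {}) = 0"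
  using hook_Lam0[OF Lam_eb[of "{}", simplified]] .

lemma form_eval_wedge_2_1:
  assumes "\<alpha> \<in> Lam 2" "\<beta> \<in> Lam 1"
  shows "form_eval (wedge \<alpha> \<beta>) [x, y, z] =
    form_eval \<alpha> [x, y] * form_eval \<beta> [z] + form_eval \<alpha> [y, z] * form_eval \<beta> [x]
    + form_eval \<alpha> [z, x] * form_eval \<beta> [y]"
proof -
  have a: "hook u \<alpha> \<in> Lam 1" "hook v (hook u \<alpha>) \<in> Lam 0" "hook w (hook v (hook u \<alpha>)) = 0"
     "hook u \<beta> \<in> Lam 0" "hook v (hook u \<beta>) = 0" for u v w
    using assms Lam_hook[of \<alpha> 1 u] Lam_hook[of "hook u \<alpha>" 0 v] Lam_hook[of \<beta> 0 u]
    by (auto simp: numeral_2_eq_2 hook_Lam0)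
  have "form_eval (wedge \<alpha> \<beta>) [x, y, z] =
    form_eval \<alpha> [x, y] * form_eval \<beta> [z] + form_eval \<alpha> [y, z] * form_eval \<beta> [x]
    - form_eval \<alpha> [x, z] * form_eval \<beta> [y]"
    by (simp add: form_eval_def hook_wedge[OF assms(1)] hook_wedge[OF a(1)] hook_wedge[OF a(2)]
       hook_simps a wedge_simps wedge_Lam0[OF a(2)] ) 
  also have "form_eval \<alpha> [x, z] = - form_eval \<alpha> [z, x]"
    using form_eval_swap[of \<alpha> "[]" x z "[]"] by simp
  finally show ?thesis by simp
qed

lemma form_eval_wedge_eb_2:
  assumes "\<beta> \<in> Lam 2"
  shows "form_eval (wedge (eb {k}) \<beta>) [x, y, z] =
    x $ k * form_eval \<beta> [y, z] + y $ k * form_eval \<beta> [z, x] + z $ k * form_eval \<beta> [x, y]"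
  using wedge_commute[OF _ assms, of "eb {k}" 1] Lam_eb[of "{k}"]
    form_eval_wedge_2_1[OF assms, of "eb {k}" x y z]
  by (simp add: form_eval_Cons hook_eb_singleton) (simp add: form_eval_def eb_def)

text \<open>The sum runs over ordered pairs, so every basis 2-form occurs twice; the factor 1/2
  corrects this.\<close>

lemma two_form_expansion:
  assumes "\<alpha> \<in> Lam 2"
  shows "\<alpha> = (1/2) *\<^sub>R (\<Sum>i\<in>UNIV. \<Sum>j\<in>UNIV.
    form_eval \<alpha> [unit8 i, unit8 j] *\<^sub>R wedge (eb {i}) (eb {j}))" (is "_ = ?S")
proof (rule form_eqI)
  show "\<alpha> \<in> Lam 2" by fact
  have "wedge (eb {i}) (eb {j}) \<in> Lam 2" for i j
    using Lam_wedge[OF Lam_eb Lam_eb, of "{i}" "{j}"] by (simp add: numeral_2_eq_2)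
  then show "?S \<in> Lam 2"
    by (intro subspace_scale subspace_sum subspace_Lam)
  fix ks :: "8 list" assume "length ks = 2"
  then obtain k l where ks: "ks = [k, l]"
    by (auto simp: numeral_2_eq_2 length_Suc_conv)
  have "form_eval (wedge (eb {i}) (eb {j})) [unit8 k, unit8 l] =
     (if j = l then if i = k then 1 else 0 else 0) - (if j = k then if i = l then 1 else 0 else 0)" for i j
    by (simp add: form_eval_def hook_wedge_eb hook_eb_singleton hook_simps wedge_simps)
      (simp add: unit8_def axis_def eb_def)
  then have "form_eval ?S (map unit8 ks) = 
     (form_eval \<alpha> [unit8 k, unit8 l] - form_eval \<alpha> [unit8 l, unit8 k]) / 2"
    by (simp add: ks form_eval_simps right_diff_distrib sum_subtractf
       if_distrib[of "\<lambda>x. _ * x"] sum.delta' cong: if_cong)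
  also have "\<dots> = form_eval \<alpha> (map unit8 ks)"
    using form_eval_swap[of \<alpha> "[]" "unit8 l" "unit8 k" "[]"] by (simp add: ks)
  finally show "form_eval \<alpha> (map unit8 ks) = form_eval ?S (map unit8 ks)" by simp
qed

text \<open>The definition sums over two-element sets. Both factors change sign when the indices are
  exchanged, so the summand is symmetric with zero diagonal, and the sum over all ordered pairs
  counts each set twice. The unrestricted sum is the form suited to linear algebra.\<close>

lemma sigma_2:
  assumes "\<alpha> \<in> Lam 2"
  shows "sigma 2 \<alpha> \<beta> = (1/2) *\<^sub>R (\<Sum>i\<in>UNIV. \<Sum>j\<in>UNIV.
    form_eval \<alpha> [unit8 i, unit8 j] *\<^sub>R hook_e j (hook_e i \<beta>))"
proof -
  define f where "f = (\<lambda>(i, j). form_eval \<alpha> [unit8 i, unit8 j] *\<^sub>R hook_e j (hook_e i \<beta>))"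
  have anti: "form_eval \<alpha> [unit8 j, unit8 i] = - form_eval \<alpha> [unit8 i, unit8 j]" for i j
    using form_eval_swap[of \<alpha> "[]" "unit8 j" "unit8 i" "[]"] by simp
  have f_sym: "f (j, i) = f (i, j)" for i j
    using anti[of i j] hook_e_anticommute[of i j \<beta>] by (simp add: f_def)
  have f_diag: "f (i, i) = 0" for i using anti[of i i] by (simp add: f_def)
  let ?P = "{(i, j). prec i j}" and ?Q = "{(i, j). prec j i}"
  have Q: "?Q = prod.swap ` ?P" by (auto simp: image_iff)
  have "(\<Sum>i\<in>UNIV. \<Sum>j\<in>UNIV. f (i, j)) = (\<Sum>p\<in>UNIV. f p)"
    by (simp add: sum.cartesian_product)
  also have "\<dots> = (\<Sum>p\<in>?P \<union> ?Q. f p)"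
  proof (rule sum.mono_neutral_right)
    show "\<forall>p\<in>UNIV - (?P \<union> ?Q). f p = 0"
    proof
      fix p assume "p \<in> UNIV - (?P \<union> ?Q)"
      then obtain i where "p = (i, i)" using prec_total by (cases p) blast
      then show "f p = 0" by (simp add: f_diag)
    qed
  qed auto
  also have "\<dots> = (\<Sum>p\<in>?P. f p) + (\<Sum>p\<in>?Q. f p)"
    by (rule sum.union_disjoint) (auto dest: prec_antisym)
  also have "(\<Sum>p\<in>?Q. f p) = (\<Sum>p\<in>?P. f p)"
    unfolding Q by (subst sum.reindex) (auto simp: f_sym intro!: sum.cong)
  also have "(\<Sum>p\<in>?P. f p) = sigma 2 \<alpha> \<beta>"
  proof -
    have "sigma 2 \<alpha> \<beta> = (\<Sum>(i, j)\<in>?P.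
        wedge (foldr hook_e (incr {i, j}) \<alpha>) (foldr hook_e (incr {i, j}) \<beta>))"
      unfolding sigma_def
    proof (rule sum.reindex_cong[of "\<lambda>(i, j). {i, j}"])
      show "inj_on (\<lambda>(i, j). {i, j}) ?P"
        by (auto simp: inj_on_def doubleton_eq_iff dest: prec_antisym)
      show "{I. card I = 2} = (\<lambda>(i, j). {i, j}) ` ?P"
      proof (intro set_eqI iffI)
        fix I :: "8 set" assume "I \<in> {I. card I = 2}"
        then obtain i j where "I = {i, j}" "i \<noteq> j" by (auto simp: card_2_iff)
        then show "I \<in> (\<lambda>(i, j). {i, j}) ` ?P"
          using prec_total[of i j] by (auto simp: image_iff)
      next
        fix I assume "I \<in> (\<lambda>(i, j). {i, j}) ` ?P"
        then obtain i j where "I = {i, j}" "prec i j" by auto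
        then show "I \<in> {I. card I = 2}" using prec_irrefl[of i] by (auto simp: card_2_iff)
      qed
    qed auto
    also have "\<dots> = (\<Sum>p\<in>?P. f p)"
    proof (rule sum.cong)
      fix p assume "p \<in> ?P"
      then obtain i j where p: "p = (i, j)" "prec i j" by auto
      have "hook_e i (hook_e j \<alpha>) \<in> Lam 0"
        using assms Lam_hook_e[of \<alpha> 1 j] Lam_hook_e[of "hook_e j \<alpha>" 0 i] by (simp add: numeral_2_eq_2)
      \<comment> \<open>\<open>foldr\<close> applies the last index first, whereas
        \<open>form_eval\<close> inserts the first vector first; hence \<open>f (j, i)\<close> and
        the appeal to symmetry afterwards.\<close>
      then have "wedge (hook_e i (hook_e j \<alpha>)) (hook_e i (hook_e j \<beta>)) = f (j, i)"
        by (simp add: f_def wedge_Lam0 form_eval_def hook_unit8)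
      then show "(case p of (i, j) \<Rightarrow> wedge (foldr hook_e (incr {i, j}) \<alpha>) (foldr hook_e (incr {i, j}) \<beta>)) = f p"
        using p(2) by (simp add: p(1) incr_pair f_sym)
    qed simp
    finally show ?thesis ..
  qed
  finally show ?thesis by (simp add: f_def flip: scaleR_2)
qed

lemma sigma_1: "sigma 1 \<alpha> \<beta> = (\<Sum>i\<in>UNIV. wedge (hook_e i \<alpha>) (hook_e i \<beta>))"
  unfolding sigma_def
  by (rule sum.reindex_cong[of "\<lambda>i. {i}"])
    (auto simp: incr_singleton card_1_singleton_iff image_iff)

section \<open>The Hodge operator exchanges exterior and interior multiplication\<close>

lemma wedge_eb_nth:
  "wedge (eb {k}) \<beta> $ K = (if k \<in> K then shuffle_sign {k} (K - {k}) * \<beta> $ (K - {k}) else 0)"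
proof -
  have "wedge (eb {k}) \<beta> $ K =
      (\<Sum>I\<in>Pow K. if I = {k} then shuffle_sign {k} (K - {k}) * \<beta> $ (K - {k}) else 0)"
    unfolding wedge_def vec_lambda_beta by (rule sum.cong) (auto simp: eb_def axis_def)
  then show ?thesis by simp
qed

text \<open>The sign comes from moving \<open>k\<close> past the complement of \<open>K\<close>,
  which has \<open>m\<close> elements wherever the coefficient is nonzero.\<close>

lemma wedge_eb_star:
  assumes "\<beta> \<in> Lam (Suc m)"
  shows "wedge (eb {k}) (star \<beta>) = (-1) ^ m *\<^sub>R star (hook_e k \<beta>)"
proof (rule vec_eq_iff[THEN iffD2], rule allI)
  fix K
  have "wedge (eb {k}) (star \<beta>) $ K =
      (if k \<in> K then shuffle_sign {k} (K - {k}) * star \<beta> $ (K - {k}) else 0)"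
    by (rule wedge_eb_nth)
  also have "\<dots> = ((-1) ^ m *\<^sub>R star (hook_e k \<beta>)) $ K"
  proof (cases "k \<in> K \<and> \<beta> $ insert k (- K) \<noteq> 0")
    case True
    then have m: "card (- K) = m"
      using assms by (cases "card (insert k (- K)) = Suc m") (auto simp: Lam_def)
    have "shuffle_sign (insert k (- K)) (K - {k}) =
        shuffle_sign {k} (K - {k}) * shuffle_sign (- K) (K - {k})"
      using True by (intro shuffle_sign_insert_left) simp
    moreover have "shuffle_sign (- K) K = shuffle_sign (- K) {k} * shuffle_sign (- K) (K - {k})"
      using shuffle_sign_insert_right[of k "K - {k}" "- K"] True by (simp add: insert_absorb)
    moreover have "shuffle_sign (- K) {k} = (-1) ^ m * shuffle_sign {k} (- K)"
      using shuffle_sign_swap'[of "- K" "{k}"] True m by simp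
    moreover have "- (K - {k}) = insert k (- K)" using True by auto
    ultimately show ?thesis
      using True by (simp add: star_def hook_e_nth mult_ac flip: power_add)
  next
    case False
    moreover have "- (K - {k}) = insert k (- K)" by auto
    ultimately show ?thesis by (auto simp: star_def hook_e_nth)
  qed
  finally show "wedge (eb {k}) (star \<beta>) $ K = ((-1) ^ m *\<^sub>R star (hook_e k \<beta>)) $ K" .
qed

text \<open>The sign comes from moving \<open>k\<close> past the index set of the coefficient of
  \<open>\<beta>\<close>, which has \<open>m\<close> elements.\<close>

lemma hook_e_star:
  assumes "\<beta> \<in> Lam m"
  shows "hook_e k (star \<beta>) = (-1) ^ m *\<^sub>R star (wedge (eb {k}) \<beta>)"
proof (rule vec_eq_iff[THEN iffD2], rule allI)
  fix I
  have C: "- I - {k} = - insert k I" by auto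
  show "hook_e k (star \<beta>) $ I = ((-1) ^ m *\<^sub>R star (wedge (eb {k}) \<beta>)) $ I"
  proof (cases "k \<notin> I \<and> \<beta> $ (- insert k I) \<noteq> 0")
    case True
    let ?J = "- insert k I"
    have m: "card ?J = m" using True assms by (auto simp: Lam_def)
    have "- I = insert k ?J" using True by auto
    then have "shuffle_sign (- I) I = shuffle_sign {k} I * shuffle_sign ?J I"
      using shuffle_sign_insert_left[of k ?J I] by simp
    moreover have "shuffle_sign ?J (insert k I) = shuffle_sign ?J {k} * shuffle_sign ?J I"
      using True by (intro shuffle_sign_insert_right) simp
    moreover have "shuffle_sign ?J {k} = (-1) ^ m * shuffle_sign {k} ?J"
      using shuffle_sign_swap'[of ?J "{k}"] m by simp
    ultimately show ?thesis
      using True by (simp add: star_def hook_e_nth wedge_eb_nth C mult_ac del: Compl_insert)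
  next
    case False
    then show ?thesis by (auto simp: star_def hook_e_nth wedge_eb_nth C simp del: Compl_insert)
  qed
qed

lemma linear_star: "linear star"
  by (rule linearI) (simp_all add: vec_eq_iff star_def algebra_simps)

lemma Lam_star:
  assumes "\<alpha> \<in> Lam k" "l = 8 - k" shows "star \<alpha> \<in> Lam l"
proof -
  have compl: "card J = 8 - card (- J)" for J :: "8 set"
  proof -
    have "card (UNIV :: 8 set) = card J + card (- J)"
      using card_Un_disjoint[of J "- J"] by (simp only: Compl_partition finite Compl_disjoint simp_thms)
    moreover have "card (UNIV :: 8 set) = 8" by simp
    ultimately show ?thesis by linarith
  qed
  have "\<alpha> $ (- J) = 0" if "card J \<noteq> l" for J
    using assms that compl[of J] by (cases "card (- J) = k") (auto simp: Lam_def)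
  then show ?thesis by (simp add: Lam_def star_def)
qed

section \<open>The 3-form of su(3)\<close>

lemma Lam_hook_numeral:
  "\<alpha> \<in> Lam 4 \<Longrightarrow> hook x \<alpha> \<in> Lam 3" "\<alpha> \<in> Lam 3 \<Longrightarrow> hook x \<alpha> \<in> Lam 2"
  "\<alpha> \<in> Lam 2 \<Longrightarrow> hook x \<alpha> \<in> Lam 1" "\<alpha> \<in> Lam 1 \<Longrightarrow> hook x \<alpha> \<in> Lam 0"
  using Lam_hook[of \<alpha> 3] Lam_hook[of \<alpha> 2] Lam_hook[of \<alpha> 1] Lam_hook[of \<alpha> 0]
  by (auto simp: numeral_eq_Suc)

lemmas Lam_hook_e_numeral =
  Lam_hook_numeral[of _ "axis i 1" for i, folded hook_e_def]

text \<open>Apply \<open>hook_e i\<close> to the Jacobi identity. The two terms of the Leibniz rule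
  agree because a 1-form and a 2-form commute, and exchanging the interior products gives the factor
  -2.\<close>

lemma hook_e_wedge_pairs_zero:
  assumes \<rho>: "\<rho> \<in> Lam 3"
    and jacobi: "(\<Sum>j\<in>UNIV. wedge (hook_e j \<rho>) (hook_e j \<rho>)) = 0"
  shows "(\<Sum>j\<in>UNIV. wedge (hook_e j \<rho>) (hook_e j (hook_e i \<rho>))) = 0"
proof -
  have L: "hook_e j \<rho> \<in> Lam 2" "hook_e k (hook_e j \<rho>) \<in> Lam 1" for j k
    using \<rho> by (simp_all add: Lam_hook_e_numeral del: One_nat_def)
  have "0 = hook_e i (\<Sum>j\<in>UNIV. wedge (hook_e j \<rho>) (hook_e j \<rho>))"
    by (simp add: jacobi hook_e_simps)
  also have "\<dots> = (\<Sum>j\<in>UNIV. wedge (hook_e i (hook_e j \<rho>)) (hook_e j \<rho>)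
      + wedge (hook_e j \<rho>) (hook_e i (hook_e j \<rho>)))"
    by (simp add: hook_e_simps hook_e_wedge[OF L(1)])
  also have "\<dots> = - 2 *\<^sub>R (\<Sum>j\<in>UNIV. wedge (hook_e j \<rho>) (hook_e j (hook_e i \<rho>)))"
  proof -
    have "wedge (hook_e i (hook_e j \<rho>)) (hook_e j \<rho>) + wedge (hook_e j \<rho>) (hook_e i (hook_e j \<rho>))
       = - 2 *\<^sub>R wedge (hook_e j \<rho>) (hook_e j (hook_e i \<rho>))" for j
      using wedge_commute[OF L(2,1), of i j j]
      by (simp add: hook_e_anticommute[of i j] wedge_simps flip: scaleR_2)
    then show ?thesis by (simp add: scaleR_sum_right)
  qed
  finally show ?thesis by simp
qed

text \<open>If \<open>\<rho>\<close> is the 3-form of a metric Lie algebra, then \<open>sigma 1 \<rho>\<close> is, up to a factor, its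
  Chevalley--Eilenberg differential.\<close>

lemma sigma_1_square:
  assumes \<rho>: "\<rho> \<in> Lam 3"
    and jacobi: "(\<Sum>j\<in>UNIV. wedge (hook_e j \<rho>) (hook_e j \<rho>)) = 0"
  shows "sigma 1 \<rho> (sigma 1 \<rho> \<tau>) = 0"
proof -
  have L: "hook_e j \<rho> \<in> Lam 2" for j
    using \<rho> by (rule Lam_hook_e_numeral)
  \<comment> \<open>The second-order terms of the Leibniz rule. The 2-forms commute while the two
    interior products of \<open>\<tau>\<close> anticommute, so renaming the indices yields
    \<open>B = - B\<close>.\<close>
  define B where "B = (\<Sum>j\<in>UNIV. \<Sum>i\<in>UNIV. wedge (hook_e j \<rho>)
    (wedge (hook_e i \<rho>) (hook_e j (hook_e i \<tau>))))"
  have "B = (\<Sum>i\<in>UNIV. \<Sum>j\<in>UNIV. wedge (hook_e j \<rho>)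
    (wedge (hook_e i \<rho>) (hook_e j (hook_e i \<tau>))))"
    unfolding B_def by (rule sum.swap)
  also have "\<dots> = (\<Sum>i\<in>UNIV. \<Sum>j\<in>UNIV. - wedge (hook_e i \<rho>)
    (wedge (hook_e j \<rho>) (hook_e i (hook_e j \<tau>))))"
  proof (intro sum.cong refl)
    fix i j
    show "wedge (hook_e j \<rho>) (wedge (hook_e i \<rho>) (hook_e j (hook_e i \<tau>))) =
       - wedge (hook_e i \<rho>) (wedge (hook_e j \<rho>) (hook_e i (hook_e j \<tau>)))"
      using wedge_commute[OF L L, of j i]
      by (simp add: wedge_simps hook_e_anticommute[of j i] flip: wedge_assoc)
  qed
  also have "\<dots> = - B" by (simp add: B_def sum_negf)
  finally have B: "B = 0" by (simp add: vec_eq_iff)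
  \<comment> \<open>The remaining terms contain, for each \<open>i\<close>, the Jacobi expression
    contracted with the i-th basis vector.\<close>
  have "(\<Sum>j\<in>UNIV. \<Sum>i\<in>UNIV. wedge (hook_e j \<rho>) (wedge (hook_e j (hook_e i \<rho>)) (hook_e i \<tau>)))
     = (\<Sum>i\<in>UNIV. wedge (\<Sum>j\<in>UNIV. wedge (hook_e j \<rho>) (hook_e j (hook_e i \<rho>))) (hook_e i \<tau>))"
    by (subst sum.swap) (simp add: wedge_assoc wedge_simps)
  also have "\<dots> = 0" by (simp add: hook_e_wedge_pairs_zero[OF assms] wedge_simps)
  finally have A: "(\<Sum>j\<in>UNIV. \<Sum>i\<in>UNIV.
    wedge (hook_e j \<rho>) (wedge (hook_e j (hook_e i \<rho>)) (hook_e i \<tau>))) = 0" .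
  have "sigma 1 \<rho> (sigma 1 \<rho> \<tau>) = (\<Sum>j\<in>UNIV. \<Sum>i\<in>UNIV. wedge (hook_e j \<rho>)
      (wedge (hook_e j (hook_e i \<rho>)) (hook_e i \<tau>) + wedge (hook_e i \<rho>) (hook_e j (hook_e i \<tau>))))"
    unfolding sigma_1 by (simp add: hook_e_simps hook_e_wedge[OF L] wedge_simps)
  also have "\<dots> = 0" using A B by (simp add: B_def wedge_simps sum.distrib)
  finally show ?thesis .
qed

text \<open>Two uses of \<open>hook_e_star\<close> turn the interior products into exterior ones.
  Their signs multiply to -1, since the degree has grown by one in between, and this is absorbed by
  exchanging the two 1-forms.\<close>

lemma sigma_2_star:
  assumes \<alpha>: "\<alpha> \<in> Lam 2" and \<beta>: "\<beta> \<in> Lam m"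
  shows "sigma 2 \<alpha> (star \<beta>) = star (wedge \<alpha> \<beta>)"
proof -
  have hh: "hook_e j (hook_e i (star \<beta>)) = star (wedge (wedge (eb {i}) (eb {j})) \<beta>)" for i j
  proof -
    have "wedge (eb {i}) \<beta> \<in> Lam (Suc m)" using Lam_wedge[OF Lam_eb \<beta>, of "{i}"] by simp
    then have "hook_e j (hook_e i (star \<beta>)) =
        ((-1) ^ m * (-1) ^ Suc m) *\<^sub>R star (wedge (eb {j}) (wedge (eb {i}) \<beta>))"
      by (simp add: hook_e_star[OF \<beta>] hook_e_star hook_e_simps)
    also have "((-1) ^ m * (-1) ^ Suc m :: real) = - 1" by (simp flip: power_add)
    also have "- 1 *\<^sub>R star (wedge (eb {j}) (wedge (eb {i}) \<beta>)) =
        star (wedge (wedge (eb {i}) (eb {j})) \<beta>)"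
      using wedge_commute[OF Lam_eb Lam_eb, of "{j}" "{i}"]
      by (simp add: linear_neg[OF linear_star] wedge_simps flip: wedge_assoc)
    finally show ?thesis .
  qed
  have "star (wedge \<alpha> \<beta>) = star (wedge ((1/2) *\<^sub>R (\<Sum>i\<in>UNIV. \<Sum>j\<in>UNIV.
    form_eval \<alpha> [unit8 i, unit8 j] *\<^sub>R wedge (eb {i}) (eb {j}))) \<beta>)"
    using two_form_expansion[OF \<alpha>] by simp
  also have "\<dots> = sigma 2 \<alpha> (star \<beta>)"
    by (simp add: sigma_2[OF \<alpha>] hh wedge_simps linear_sum[OF linear_star] linear_cmul[OF linear_star])
  finally show ?thesis ..
qed

text \<open>The left side is the total alternation of P for the 4-form
  \<open>star (sigma 1 \<rho> \<tau>)\<close>. Duality rewrites each summand as an exterior product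
  under \<open>star\<close>, and together they form a second application of
  \<open>sigma 1 \<rho>\<close>.\<close>

lemma wedge_sigma_2_star_sigma_1:
  assumes \<rho>: "\<rho> \<in> Lam 3" and \<tau>: "\<tau> \<in> Lam 3"
    and jacobi: "(\<Sum>j\<in>UNIV. wedge (hook_e j \<rho>) (hook_e j \<rho>)) = 0"
  shows "(\<Sum>k\<in>UNIV. wedge (eb {k}) (sigma 2 (hook_e k \<rho>) (star (sigma 1 \<rho> \<tau>)))) = 0"
proof -
  define \<beta> where "\<beta> = sigma 1 \<rho> \<tau>"
  have L: "hook_e j \<rho> \<in> Lam 2" "hook_e j \<tau> \<in> Lam 2" for j
    using \<rho> \<tau> by (simp_all add: Lam_hook_e_numeral)
  have \<beta>: "\<beta> \<in> Lam 4"
    unfolding \<beta>_def sigma_1 using Lam_wedge[OF L] by (intro subspace_sum subspace_Lam) simp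
  have "wedge (eb {k}) (sigma 2 (hook_e k \<rho>) (star \<beta>)) =
      - star (wedge (hook_e k \<rho>) (hook_e k \<beta>))" for k
  proof -
    \<comment> \<open>Degree 2 + 4 is written as \<open>Suc 5\<close>; the odd exponent 5 in
      \<open>wedge_eb_star\<close> produces the minus sign.\<close>
    have 6: "wedge (hook_e k \<rho>) \<beta> \<in> Lam (Suc 5)" using Lam_wedge[OF L(1) \<beta>] by simp
    have "hook_e k (hook_e k \<rho>) = 0" by (simp add: hook_e_def hook_self)
    then show ?thesis
      unfolding sigma_2_star[OF L(1) \<beta>] wedge_eb_star[OF 6]
      by (simp add: hook_e_wedge[OF L(1)] wedge_simps)
  qed
  then have "(\<Sum>k\<in>UNIV. wedge (eb {k}) (sigma 2 (hook_e k \<rho>) (star \<beta>))) =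
      - star (sigma 1 \<rho> \<beta>)"
    unfolding sigma_1 by (simp add: sum_negf linear_sum[OF linear_star])
  then show ?thesis
    unfolding \<beta>_def sigma_1_square[OF \<rho> jacobi] by (simp add: linear_0[OF linear_star])
qed

section \<open>Coordinates of \<open>rho0\<close> and its Jacobi identity\<close>

lemma eb_insert:
  assumes "\<And>j. j \<in> J \<Longrightarrow> prec i j" shows "eb (insert i J) = wedge (eb {i}) (eb J)"
proof (rule vec_eq_iff[THEN iffD2], rule allI)
  fix K
  have "{(i', j). i' \<in> {i} \<and> j \<in> J \<and> prec j i'} = {}"
    using assms by (auto dest: prec_antisym)
  then have s: "shuffle_sign {i} J = 1" unfolding shuffle_sign_def by (simp only: card.empty power_0)
  have "i \<notin> J" using assms prec_irrefl by blast
  show "eb (insert i J) $ K = wedge (eb {i}) (eb J) $ K"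
  proof (cases "insert i J = K")
    case True
    then have "i \<in> K" "K - {i} = J" using \<open>i \<notin> J\<close> by auto
    then show ?thesis unfolding wedge_eb_nth by (simp add: s True[symmetric] eb_def)
  next
    case False
    then have "i \<in> K \<Longrightarrow> K - {i} \<noteq> J" by auto
    then show ?thesis using False unfolding wedge_eb_nth by (simp add: eb_def axis_def)
  qed
qed

text \<open>The 3 by 3 determinant of the coordinates i, j, k, expanded along
  \<open>x\<close>.\<close>

lemma form_eval_wedge_eb3:
  "form_eval (wedge (eb {i}) (wedge (eb {j}) (eb {k}))) [x, y, z] =
    x $ i * (y $ j * z $ k - y $ k * z $ j) - x $ j * (y $ i * z $ k - y $ k * z $ i)
    + x $ k * (y $ i * z $ j - y $ j * z $ i)"
  by (simp add: form_eval_def hook_wedge_eb hook_eb_singleton hook_simps wedge_simps)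
    (simp add: eb_def algebra_simps)

lemma rho0_wedges:
  "rho0 = wedge (eb {2}) (wedge (eb {4}) (eb {6})) - wedge (eb {2}) (wedge (eb {3}) (eb {5}))
    - wedge (eb {1}) (wedge (eb {4}) (eb {5})) - wedge (eb {1}) (wedge (eb {3}) (eb {6}))
    + wedge (eb {1}) (wedge (eb {2}) (eb {7})) + wedge (eb {3}) (wedge (eb {4}) (eb {7}))
    - 2 *\<^sub>R wedge (eb {5}) (wedge (eb {6}) (eb {7}))
    + sqrt 3 *\<^sub>R (wedge (eb {1}) (wedge (eb {2}) (eb {8})) - wedge (eb {3}) (wedge (eb {4}) (eb {8})))"
proof -
  have 2: "eb {i, j} = wedge (eb {i}) (eb {j})" if "prec i j" for i j
    by (rule eb_insert) (use that in auto)
  have 3: "eb {i, j, k} = wedge (eb {i}) (wedge (eb {j}) (eb {k}))"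
    if "prec i j" "prec j k" for i j k
    unfolding 2[OF that(2), symmetric]
    by (rule eb_insert) (use that prec_trans[OF that] in auto)
  show ?thesis
    by (simp add: rho0_def 2 3 prec_rank8 rank8_numeral wedge_simps wedge_assoc algebra_simps)
qed

lemma rho0_Lam: "rho0 \<in> Lam 3"
proof -
  have "wedge (eb {i}) (wedge (eb {j}) (eb {k})) \<in> Lam 3" for i j k
    using Lam_wedge[OF Lam_eb Lam_wedge[OF Lam_eb Lam_eb], of "{i}" "{j}" "{k}"]
    by (simp add: numeral_3_eq_3)
  then show ?thesis
    unfolding rho0_wedges
    by (intro subspace_add subspace_diff subspace_scale subspace_Lam)
qed

text \<open>Six ways of giving each factor two of the four arguments; exchanging the two equal
  factors pairs them off, which leaves three terms and the factor 2.\<close>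

lemma form_eval_wedge_2_2:
  assumes "\<alpha> \<in> Lam 2"
  shows "form_eval (wedge \<alpha> \<alpha>) [x, y, z, w] = 2 * (form_eval \<alpha> [x, y] * form_eval \<alpha> [z, w]
    - form_eval \<alpha> [x, z] * form_eval \<alpha> [y, w] + form_eval \<alpha> [x, w] * form_eval \<alpha> [y, z])"
proof -
  have a: "hook u \<alpha> \<in> Lam 1" "hook v (hook u \<alpha>) \<in> Lam 0" "hook w (hook v (hook u \<alpha>)) = 0" for u v w
    using assms by (simp_all add: Lam_hook_numeral hook_Lam0 del: One_nat_def)
  show ?thesis
    by (simp add: form_eval_def hook_wedge[OF assms(1)] hook_wedge[OF a(1)] hook_wedge[OF a(2)]
       hook_simps a wedge_simps wedge_Lam0[OF a(2)] algebra_simps)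
qed

text \<open>With [x, y] the vector whose j-th coordinate is the value of \<open>rho0\<close> on e_j,
  x, y, the eight products in \<open>q\<close> are those of the coordinates of [x, y] and [z, w]; so
  \<open>q\<close> is their inner product and the claim is the Jacobi identity. Here
  \<open>s\<close> stands for \<open>sqrt 3\<close>. After replacing \<open>s * s\<close> by 3,
  \<open>a\<close> is the part free of \<open>s\<close> and the symmetrised \<open>b\<close> is the
  coefficient of \<open>s\<close>; each satisfies the identity on its own, with rational
  coefficients.\<close>

lemma su3_jacobi_polynomial:
  fixes x y z w :: "8 \<Rightarrow> real" and s :: real
  assumes s: "s * s = 3"
  defines "p \<equiv> \<lambda>x y i j. x i * y j - x j * y i :: real"
  defines "q \<equiv> \<lambda>x y z w.
      (- p x y 4 5 - p x y 3 6 + p x y 2 7 + s * p x y 2 8) *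
      (- p z w 4 5 - p z w 3 6 + p z w 2 7 + s * p z w 2 8)
    + (p x y 4 6 - p x y 3 5 - p x y 1 7 - s * p x y 1 8) *
      (p z w 4 6 - p z w 3 5 - p z w 1 7 - s * p z w 1 8)
    + (p x y 2 5 + p x y 1 6 + p x y 4 7 - s * p x y 4 8) *
      (p z w 2 5 + p z w 1 6 + p z w 4 7 - s * p z w 4 8)
    + (- p x y 2 6 + p x y 1 5 - p x y 3 7 + s * p x y 3 8) *
      (- p z w 2 6 + p z w 1 5 - p z w 3 7 + s * p z w 3 8)
    + (- p x y 2 3 - p x y 1 4 - 2 * p x y 6 7) * (- p z w 2 3 - p z w 1 4 - 2 * p z w 6 7)
    + (p x y 2 4 - p x y 1 3 + 2 * p x y 5 7) * (p z w 2 4 - p z w 1 3 + 2 * p z w 5 7)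
    + (p x y 1 2 + p x y 3 4 - 2 * p x y 5 6) * (p z w 1 2 + p z w 3 4 - 2 * p z w 5 6)
    + (s * p x y 1 2 - s * p x y 3 4) * (s * p z w 1 2 - s * p z w 3 4)"
  shows "q x y z w - q x z y w + q x w y z = 0"
proof -
  define a where "a = (\<lambda>x y z w.
      (- p x y 4 5 - p x y 3 6 + p x y 2 7) * (- p z w 4 5 - p z w 3 6 + p z w 2 7)
    + (p x y 4 6 - p x y 3 5 - p x y 1 7) * (p z w 4 6 - p z w 3 5 - p z w 1 7)
    + (p x y 2 5 + p x y 1 6 + p x y 4 7) * (p z w 2 5 + p z w 1 6 + p z w 4 7)
    + (- p x y 2 6 + p x y 1 5 - p x y 3 7) * (- p z w 2 6 + p z w 1 5 - p z w 3 7)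
    + (- p x y 2 3 - p x y 1 4 - 2 * p x y 6 7) * (- p z w 2 3 - p z w 1 4 - 2 * p z w 6 7)
    + (p x y 2 4 - p x y 1 3 + 2 * p x y 5 7) * (p z w 2 4 - p z w 1 3 + 2 * p z w 5 7)
    + (p x y 1 2 + p x y 3 4 - 2 * p x y 5 6) * (p z w 1 2 + p z w 3 4 - 2 * p z w 5 6)
    + 3 * (p x y 2 8 * p z w 2 8 + p x y 1 8 * p z w 1 8 + p x y 4 8 * p z w 4 8
      + p x y 3 8 * p z w 3 8 + (p x y 1 2 - p x y 3 4) * (p z w 1 2 - p z w 3 4)))"
  define b where "b = (\<lambda>x y z w.
      (- p x y 4 5 - p x y 3 6 + p x y 2 7) * p z w 2 8
    - (p x y 4 6 - p x y 3 5 - p x y 1 7) * p z w 1 8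
    - (p x y 2 5 + p x y 1 6 + p x y 4 7) * p z w 4 8
    + (- p x y 2 6 + p x y 1 5 - p x y 3 7) * p z w 3 8)"
  have q: "q x y z w = a x y z w + s * (b x y z w + b z w x y)" for x y z w
    unfolding q_def a_def b_def s[symmetric] by algebra
  have "a x y z w - a x z y w + a x w y z = 0"
    unfolding a_def p_def by algebra
  moreover have "b x y z w + b z w x y - (b x z y w + b y w x z) + (b x w y z + b y z x w) = 0"
    unfolding b_def p_def by algebra
  ultimately show ?thesis unfolding q by algebra
qed

text \<open>Grouped by the first argument, so that inserting a basis vector there yields the
  corresponding factor of \<open>q\<close> in \<open>su3_jacobi_polynomial\<close>.\<close>

lemma form_eval_rho0:
  fixes x y z :: "real ^ 8"
  defines "p \<equiv> \<lambda>i j. y $ i * z $ j - y $ j * z $ i"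
  shows "form_eval rho0 [x, y, z] =
      x $ 1 * (- p 4 5 - p 3 6 + p 2 7 + sqrt 3 * p 2 8)
    + x $ 2 * (p 4 6 - p 3 5 - p 1 7 - sqrt 3 * p 1 8)
    + x $ 3 * (p 2 5 + p 1 6 + p 4 7 - sqrt 3 * p 4 8)
    + x $ 4 * (- p 2 6 + p 1 5 - p 3 7 + sqrt 3 * p 3 8)
    + x $ 5 * (- p 2 3 - p 1 4 - 2 * p 6 7)
    + x $ 6 * (p 2 4 - p 1 3 + 2 * p 5 7)
    + x $ 7 * (p 1 2 + p 3 4 - 2 * p 5 6)
    + x $ 8 * (sqrt 3 * p 1 2 - sqrt 3 * p 3 4)"
  unfolding rho0_wedges form_eval_simps form_eval_wedge_eb3 p_def real_scaleR_def by algebra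

text \<open>By \<open>form_eval_wedge_2_2\<close> the value on four vectors is twice the polynomial
  of \<open>su3_jacobi_polynomial\<close>.\<close>

lemma rho0_jacobi: "(\<Sum>j\<in>UNIV. wedge (hook_e j rho0) (hook_e j rho0)) = 0"
proof (rule form_eqI)
  have L: "hook_e j rho0 \<in> Lam 2" for j
    using rho0_Lam by (rule Lam_hook_e_numeral)
  have "wedge (hook_e j rho0) (hook_e j rho0) \<in> Lam 4" for j
    using Lam_wedge[OF L L, of j j] by simp
  then show "(\<Sum>j\<in>UNIV. wedge (hook_e j rho0) (hook_e j rho0)) \<in> Lam 4"
    by (intro subspace_sum subspace_Lam)
  show "0 \<in> Lam 4" by (intro subspace_0 subspace_Lam)
  fix ks :: "8 list" assume "length ks = 4"
  then obtain x y z w :: "real ^ 8" where ks: "map unit8 ks = [x, y, z, w]"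
    by (auto simp: numeral_eq_Suc length_Suc_conv)
  define r where "r = (\<lambda>j x y. form_eval (hook_e j rho0) [x, y])"
  have r: "r j x y = form_eval rho0 [unit8 j, x, y]" for j x y
    by (simp add: r_def form_eval_Cons[of rho0] hook_unit8)
  have sum_UNIV_8: "sum f (UNIV :: 8 set) = f 1 + f 2 + f 3 + f 4 + f 5 + f 6 + f 7 + f 8"
    for f :: "8 \<Rightarrow> real" unfolding UNIV_8 by simp
  have "(\<Sum>j\<in>UNIV. r j x y * r j z w) - (\<Sum>j\<in>UNIV. r j x z * r j y w)
      + (\<Sum>j\<in>UNIV. r j x w * r j y z) = 0"
    using su3_jacobi_polynomial[of "sqrt 3" "\<lambda>i. x $ i" "\<lambda>i. y $ i" "\<lambda>i. z $ i" "\<lambda>i. w $ i"]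
    unfolding sum_UNIV_8 r form_eval_rho0 by (simp add: unit8_def axis_def)
  then show "form_eval (\<Sum>j\<in>UNIV. wedge (hook_e j rho0) (hook_e j rho0)) (map unit8 ks) =
      form_eval 0 (map unit8 ks)"
    by (simp add: ks form_eval_simps form_eval_wedge_2_2[OF L] sum.distrib sum_subtractf
        r_def flip: sum_distrib_left)
qed

section \<open>The modules of forms and the stabiliser algebra of \<open>rho0\<close>\<close>

lemma Lam2_8_subset: "Lam2_8 \<subseteq> Lam 2"
proof -
  have "wedge (hook_e i rho0) (hook_e i \<alpha>) \<in> Lam 2" if "\<alpha> \<in> Lam 1" for i \<alpha>
    using Lam_wedge[OF Lam_hook_e_numeral(2)[OF rho0_Lam, of i] Lam_hook_e_numeral(4)[OF that, of i]]
    by simp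
  then show ?thesis
    by (auto simp: Lam2_8_def sigma_plus_def sigma_1 simp del: One_nat_def intro!: subspace_sum subspace_Lam)
qed

lemma Lam3_8_subset: "Lam3_8 \<subseteq> Lam 3"
proof
  fix \<tau> assume "\<tau> \<in> Lam3_8"
  then obtain \<omega> where "\<omega> \<in> Lam 2" "\<tau> = star (wedge \<omega> rho0)"
    using Lam2_8_subset by (auto simp: Lam3_8_def)
  then show "\<tau> \<in> Lam 3" using Lam_star[OF Lam_wedge[OF _ rho0_Lam], of \<omega> 2 3] by simp
qed

text \<open>Both summands arise from 3-forms by one and the same linear map, so the two preimages
  can be added.\<close>

lemma star_Lam4_8_27:
  assumes "\<phi> \<in> star ` Lam4_8 + star ` Lam4_27"
  obtains \<tau> where "\<tau> \<in> Lam 3" "\<phi> = star (sigma 1 rho0 \<tau>)"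
proof -
  obtain \<sigma> \<tau> where "\<sigma> \<in> Lam 3" "\<tau> \<in> Lam 3"
      "\<phi> = star (sigma 1 rho0 \<sigma>) + star (sigma 1 rho0 \<tau>)"
    using assms Lam3_8_subset
    by (auto simp: set_plus_def Lam4_8_def Lam4_27_def Lam3_27_def sigma_plus_def)
  moreover have "star (sigma 1 rho0 (\<sigma> + \<tau>)) = star (sigma 1 rho0 \<sigma>) + star (sigma 1 rho0 \<tau>)"
    unfolding sigma_1 by (simp add: hook_e_simps wedge_simps linear_add[OF linear_star] sum.distrib)
  ultimately show ?thesis using that[of "\<sigma> + \<tau>"] subspace_add[OF subspace_Lam] by metis
qed

text \<open>The value on x, y, z of a sum of exterior products of e_k with 2-forms is a cyclic sum,
  because the 1-form e_k picks the k-th coordinate of each argument in turn. Linearity in the first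
  argument of P then reduces the claim to \<open>wedge_sigma_2_star_sigma_1\<close>.\<close>

lemma sigma_2_hook_cyclic:
  assumes "\<phi> \<in> star ` Lam4_8 + star ` Lam4_27"
  shows "form_eval (sigma 2 (hook x rho0) \<phi>) [y, z] + form_eval (sigma 2 (hook y rho0) \<phi>) [z, x]
    + form_eval (sigma 2 (hook z rho0) \<phi>) [x, y] = 0"
proof -
  obtain \<tau> where \<tau>: "\<tau> \<in> Lam 3" "\<phi> = star (sigma 1 rho0 \<tau>)"
    using star_Lam4_8_27[OF assms] .
  have L: "hook u rho0 \<in> Lam 2" "hook_e j rho0 \<in> Lam 2" "hook_e j \<tau> \<in> Lam 2" for j u
    using rho0_Lam \<tau> by (simp_all add: Lam_hook_e_numeral Lam_hook_numeral del: One_nat_def)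
  define \<beta> where "\<beta> = sigma 1 rho0 \<tau>"
  have \<beta>: "\<beta> \<in> Lam 4"
    unfolding \<beta>_def sigma_1 using Lam_wedge[OF L(2,3)] by (intro subspace_sum subspace_Lam) simp
  have \<phi>: "\<phi> = star \<beta>" using \<tau>(2) by (simp only: \<beta>_def)
  have S: "sigma 2 (hook_e k rho0) \<phi> \<in> Lam 2" for k
    unfolding \<phi> sigma_2_star[OF L(2) \<beta>] using Lam_wedge[OF L(2) \<beta>] by (rule Lam_star) simp
  have *: "form_eval (sigma 2 (hook u rho0) \<phi>) [v, w] =
      (\<Sum>k\<in>UNIV. u $ k * form_eval (sigma 2 (hook_e k rho0) \<phi>) [v, w])" for u v w
  proof -
    have "sigma 2 (hook u rho0) \<phi> = star (wedge (\<Sum>k\<in>UNIV. u $ k *\<^sub>R hook_e k rho0) \<beta>)"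
      by (simp only: \<phi> sigma_2_star[OF L(1) \<beta>] hook_sum[of u, symmetric])
    then show ?thesis
      by (simp add: \<phi> sigma_2_star[OF L(2) \<beta>] wedge_simps linear_sum[OF linear_star]
          linear_cmul[OF linear_star] form_eval_simps)
  qed
  have "0 = form_eval (\<Sum>k\<in>UNIV. wedge (eb {k}) (sigma 2 (hook_e k rho0) \<phi>)) [x, y, z]"
    unfolding \<tau>(2) wedge_sigma_2_star_sigma_1[OF rho0_Lam \<tau>(1) rho0_jacobi] form_eval_simps ..
  also have "\<dots> = (\<Sum>k\<in>UNIV. x $ k * form_eval (sigma 2 (hook_e k rho0) \<phi>) [y, z]
      + y $ k * form_eval (sigma 2 (hook_e k rho0) \<phi>) [z, x]
      + z $ k * form_eval (sigma 2 (hook_e k rho0) \<phi>) [x, y])"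
    by (simp add: form_eval_simps form_eval_wedge_eb_2[OF S])
  finally show ?thesis by (simp add: * sum.distrib)
qed

text \<open>The product is a 7-form. Its coefficient on the complement of \<open>{k}\<close> is, up
  to sign, the inner product of \<open>\<omega>\<close> with \<open>hook_e k rho0\<close>.\<close>

lemma wedge_star_rho0:
  assumes \<omega>: "\<omega> \<in> Lam 2" and orth: "\<And>k. inner \<omega> (hook_e k rho0) = 0"
  shows "wedge \<omega> (star rho0) = 0"
proof (rule vec_eq_iff[THEN iffD2], rule allI)
  fix K
  show "wedge \<omega> (star rho0) $ K = 0 $ K"
  proof (cases "card K = 7")
    case False
    then show ?thesis using Lam_wedge[OF \<omega> Lam_star[OF rho0_Lam, of 5]] by (simp add: Lam_def)
  next
    case True
    have "card (UNIV :: 8 set) = card K + card (- K)"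
      using card_Un_disjoint[of K "- K"] by (simp only: Compl_partition finite Compl_disjoint simp_thms)
    moreover have "card (UNIV :: 8 set) = 8" by simp
    ultimately have "card (- K) = 1" using True by linarith
    then obtain k where k: "- K = {k}" by (rule card_1_singletonE)
    have "wedge \<omega> (star rho0) $ K =
        (\<Sum>I\<in>Pow K. shuffle_sign {k} K * (\<omega> $ I * hook_e k rho0 $ I))"
      unfolding wedge_def vec_lambda_beta
    proof (rule sum.cong)
      fix I assume "I \<in> Pow K"
      then have I: "I \<subseteq> K" "k \<notin> I" "- (K - I) = insert k I" using k by auto
      then have "shuffle_sign {k} K = shuffle_sign {k} I * shuffle_sign {k} (K - I)"
        using shuffle_sign_Un_right[of I "K - I" "{k}"] by (simp add: Un_absorb1)
      then show "shuffle_sign I (K - I) * \<omega> $ I * star rho0 $ (K - I) =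
          shuffle_sign {k} K * (\<omega> $ I * hook_e k rho0 $ I)"
        using I shuffle_sign_insert_left[of k I "K - I"]
        by (simp add: star_def hook_e_nth mult_ac del: Compl_Diff_eq)
    qed simp
    also have "\<dots> = (\<Sum>I\<in>UNIV. shuffle_sign {k} K * (\<omega> $ I * hook_e k rho0 $ I))"
      using k by (intro sum.mono_neutral_left) (auto simp: hook_e_nth)
    also have "\<dots> = shuffle_sign {k} K * inner \<omega> (hook_e k rho0)"
      by (simp add: inner_vec_def sum_distrib_left)
    finally show ?thesis using orth by simp
  qed
qed

lemma subspace_Lam2_20: "subspace Lam2_20"
  using subspace_Lam[of 2]
  by (auto simp: subspace_def Lam2_20_def wedge_simps)

text \<open>The definite description in \<open>pr_m\<close> needs existence, from an orthogonal
  decomposition, and uniqueness: the difference of two candidates lies in \<open>Lam2_20\<close> and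
  is orthogonal to itself.\<close>

lemma pr_m_orthogonal:
  assumes "\<zeta> \<in> Lam2_20" shows "orthogonal (\<omega> - pr_m \<omega>) \<zeta>"
proof -
  let ?P = "\<lambda>\<eta>. \<eta> \<in> Lam2_20 \<and> (\<forall>\<zeta>\<in>Lam2_20. orthogonal (\<omega> - \<eta>) \<zeta>)"
  obtain y z where "y \<in> span Lam2_20" "\<And>w. w \<in> span Lam2_20 \<Longrightarrow> orthogonal z w" "\<omega> = y + z"
    using orthogonal_subspace_decomp_exists[of Lam2_20 \<omega>] by metis
  then have y: "?P y" using span_eq_iff[THEN iffD2, OF subspace_Lam2_20] by auto
  have "?P (pr_m \<omega>)" unfolding pr_m_def
  proof (rule theI[of ?P, OF y])
    fix \<eta> assume \<eta>: "?P \<eta>"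
    then have d: "\<eta> - y \<in> Lam2_20" using y subspace_diff[OF subspace_Lam2_20] by blast
    have "orthogonal ((\<omega> - y) - (\<omega> - \<eta>)) (\<eta> - y)"
      using \<eta> y d by (simp add: orthogonal_def inner_diff_left)
    then show "\<eta> = y" by (simp add: orthogonal_def)
  qed
  then show ?thesis using assms by blast
qed

text \<open>Split \<open>\<omega>\<close> along the contractions of \<open>rho0\<close>. By
  \<open>wedge_star_rho0\<close> the remainder lies in \<open>Lam2_20\<close>, so it is orthogonal
  to \<open>\<omega>\<close> and hence to itself.\<close>

lemma orthogonal_Lam2_20:
  assumes \<omega>: "\<omega> \<in> Lam 2" and orth: "\<And>\<zeta>. \<zeta> \<in> Lam2_20 \<Longrightarrow> orthogonal \<omega> \<zeta>"
  obtains c where "\<omega> = hook c rho0"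
proof -
  let ?S = "range (\<lambda>c. hook c rho0)"
  have S: "subspace ?S"
    using linear_subspace_image[OF linear_hook_left subspace_UNIV] by simp
  obtain y z where yz: "y \<in> span ?S" "\<And>w. w \<in> span ?S \<Longrightarrow> orthogonal z w" "\<omega> = y + z"
    using orthogonal_subspace_decomp_exists[of ?S \<omega>] by metis
  have y: "y \<in> ?S" using yz(1) span_eq_iff[THEN iffD2, OF S] by simp
  then have "y \<in> Lam 2" using Lam_hook_numeral(2)[OF rho0_Lam] by auto
  then have "z \<in> Lam 2" using yz(3) \<omega> subspace_diff[OF subspace_Lam, of \<omega> 2 y] by simp
  moreover have "inner z (hook_e k rho0) = 0" for k
    using yz(2)[OF span_base, of "hook_e k rho0"] by (auto simp: orthogonal_def hook_e_def)
  ultimately have "z \<in> Lam2_20" using wedge_star_rho0[of z] by (simp add: Lam2_20_def)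
  then have "orthogonal \<omega> z" by (rule orth)
  moreover have "orthogonal y z" using yz(1,2) by (simp add: orthogonal_commute)
  ultimately have "z = 0" using yz(3) by (simp add: orthogonal_def inner_add_left)
  then show ?thesis using y yz(3) that by auto
qed

text \<open>\<open>L\<close> is ad(c), and the claim is the ad-invariance of the Cartan 3-form. It
  is \<open>rho0_jacobi\<close> evaluated with \<open>c\<close> as first argument.\<close>

lemma form_eval_rho0_derivation:
  fixes c :: "real ^ 8"
  defines "L \<equiv> \<lambda>x. \<Sum>d\<in>UNIV. form_eval (hook c rho0) [x, unit8 d] *\<^sub>R unit8 d"
  shows "form_eval rho0 [L x, y, z] + form_eval rho0 [x, L y, z] + form_eval rho0 [x, y, L z] = 0"
proof -
  define r where "r = (\<lambda>d x y. form_eval (hook_e d rho0) [x, y])"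
  have swap: "form_eval rho0 [x, y, z] = - form_eval rho0 [y, x, z]"
    "form_eval rho0 [x, y, z] = - form_eval rho0 [x, z, y]" for x y z
    using form_eval_swap[of rho0 "[]" x y "[z]"] form_eval_swap[of rho0 "[x]" y z "[]"] by simp_all
  have r: "form_eval rho0 [unit8 d, x, y] = r d x y" for d x y
    by (simp add: r_def form_eval_Cons[of rho0] hook_unit8)
  have L: "form_eval rho0 [L x, y, z] = (\<Sum>d\<in>UNIV. r d c x * r d y z)" for x y z
  proof -
    have "form_eval (hook c rho0) [x, unit8 d] = r d c x" for d
      unfolding form_eval_Cons[symmetric] r[symmetric] using swap by metis
    moreover have lin: "linear (\<lambda>u. form_eval rho0 [u, y, z])"
      using linear_form_eval_slot[of rho0 "[]" "[y, z]"] by simp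
    ultimately show ?thesis
      by (simp add: L_def linear_sum[OF lin] linear_cmul[OF lin] r)
  qed
  have "0 = form_eval (\<Sum>j\<in>UNIV. wedge (hook_e j rho0) (hook_e j rho0)) [c, x, y, z]"
    by (simp add: rho0_jacobi form_eval_simps)
  also have "\<dots> = 2 * ((\<Sum>d\<in>UNIV. r d c x * r d y z) - (\<Sum>d\<in>UNIV. r d c y * r d x z)
      + (\<Sum>d\<in>UNIV. r d c z * r d x y))"
    by (simp add: form_eval_simps form_eval_wedge_2_2[OF Lam_hook_e_numeral(2)[OF rho0_Lam]]
        r_def sum.distrib sum_subtractf flip: sum_distrib_left)
  also have "\<dots> = 2 * (form_eval rho0 [L x, y, z] - form_eval rho0 [L y, x, z] + form_eval rho0 [L z, x, y])"
    by (simp add: L)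
  finally show ?thesis
    using swap(1)[of x "L y" z] swap(1)[of x "L z" y] swap(2)[of x y "L z"] by simp
qed

section \<open>Alternating forms in a frame\<close>

text \<open>Only vanishing is tracked: a transposition of neighbours changes the sign, which
  vanishing does not see, so no sign of a permutation has to be computed.\<close>

lemma antisymmetric_move:
  fixes h :: "'a list \<Rightarrow> real"
  assumes "\<And>us a b vs. length (us @ a # b # vs) = k \<Longrightarrow> h (us @ a # b # vs) = - h (us @ b # a # vs)"
  shows "length (pre @ us @ x # vs) = k \<Longrightarrow> h (pre @ us @ x # vs) = 0 \<longleftrightarrow> h (pre @ x # us @ vs) = 0"
proof (induction us arbitrary: pre)
  case (Cons u us)
  have "h (pre @ (u # us) @ x # vs) = 0 \<longleftrightarrow> h (pre @ u # x # us @ vs) = 0"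
    using Cons.IH[of "pre @ [u]"] Cons.prems by simp
  then show ?case using assms[of pre u x "us @ vs"] Cons.prems by simp
qed simp

lemma antisymmetric_mset:
  fixes h :: "'a list \<Rightarrow> real"
  assumes anti: "\<And>us a b vs. length (us @ a # b # vs) = k \<Longrightarrow> h (us @ a # b # vs) = - h (us @ b # a # vs)"
  shows "mset xs = mset ys \<Longrightarrow> length (pre @ xs) = k \<Longrightarrow> h (pre @ xs) = 0 \<longleftrightarrow> h (pre @ ys) = 0"
proof (induction xs arbitrary: pre ys)
  case (Cons x xs)
  then have "x \<in> set ys" by (metis list.set_intros(1) set_mset_mset)
  then obtain us vs where ys: "ys = us @ x # vs" by (meson split_list)
  then have m: "mset xs = mset (us @ vs)" using Cons.prems(1) by simp
  then have l: "length xs = length (us @ vs)" by (rule mset_eq_length)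
  have "h (pre @ x # xs) = 0 \<longleftrightarrow> h (pre @ x # us @ vs) = 0"
    using Cons.IH[OF m, of "pre @ [x]"] Cons.prems(2) by simp
  also have "\<dots> \<longleftrightarrow> h (pre @ ys) = 0"
    unfolding ys using Cons.prems(2) l by (intro antisymmetric_move[where h=h and k=k, OF anti, symmetric]) auto
  finally show ?case .
qed simp

text \<open>A list without repetition is sorted. In a list with a repetition the two equal entries
  are moved to the front, where exchanging them gives \<open>h = - h\<close>. It is meant for the
  difference of two alternating functions that agree on increasing lists.\<close>

lemma antisymmetric_eq_zero:
  fixes h :: "8 list \<Rightarrow> real"
  assumes anti: "\<And>us a b vs. length (us @ a # b # vs) = k \<Longrightarrow> h (us @ a # b # vs) = - h (us @ b # a # vs)"
    and incr: "\<And>I. card I = k \<Longrightarrow> h (incr I) = 0" and l: "length xs = k"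
  shows "h xs = 0"
proof (cases "distinct xs")
  case True
  have m: "mset xs = mset (incr (set xs))"
    using True distinct_sorted_prec[OF sorted_incr] by (simp flip: set_eq_iff_mset_eq_distinct)
  have "h ([] @ xs) = 0 \<longleftrightarrow> h ([] @ incr (set xs)) = 0"
  proof (rule antisymmetric_mset[where h=h and k=k])
    show "h (us @ a # b # vs) = - h (us @ b # a # vs)" if "length (us @ a # b # vs) = k" for us a b vs
      using that by (rule anti)
  qed (use l m in auto)
  then show ?thesis using incr[of "set xs"] distinct_card[OF True] l by simp
next
  case False
  then obtain us y vs ws where xs: "xs = us @ [y] @ vs @ [y] @ ws" by (metis not_distinct_decomp)
  then have m: "mset xs = mset (y # y # us @ vs @ ws)" by simp
  have "h ([] @ xs) = 0 \<longleftrightarrow> h ([] @ y # y # us @ vs @ ws) = 0"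
  proof (rule antisymmetric_mset[where h=h and k=k])
    show "h (us @ a # b # vs) = - h (us @ b # a # vs)" if "length (us @ a # b # vs) = k" for us a b vs
      using that by (rule anti)
  qed (use l m in auto)
  moreover have "h (y # y # us @ vs @ ws) = - h (y # y # us @ vs @ ws)"
    using anti[of "[]" y y "us @ vs @ ws"] l unfolding xs by fastforce
  ultimately show ?thesis by simp
qed

section \<open>Multilinear expansion of an alternating form in a frame\<close>

definition frame_vec :: "(8 \<Rightarrow> 'm tvec) \<Rightarrow> real ^ 8 \<Rightarrow> 'm tvec" where
  "frame_vec e x = (\<lambda>f. \<Sum>i\<in>UNIV. x $ i * e i f)"

lemma alternating_form_linear:
  assumes "alternating_form k S \<omega>" "length us + length vs + 1 = k" "set us \<subseteq> S" "set vs \<subseteq> S"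
    "v \<in> S" "w \<in> S"
  shows "\<omega> (us @ (\<lambda>f. a * v f + b * w f) # vs) = a * \<omega> (us @ v # vs) + b * \<omega> (us @ w # vs)"
proof -
  have "length (us @ v # vs) = k \<and> set (us @ v # vs) \<subseteq> S" "length us < k" using assms by auto
  then have "\<omega> ((us @ v # vs)[length us := (\<lambda>f. a * v f + b * w f)]) =
     a * \<omega> ((us @ v # vs)[length us := v]) + b * \<omega> ((us @ v # vs)[length us := w])"
    using assms(1,5,6) unfolding alternating_form_def by blast
  then show ?thesis by simp
qed

lemma alternating_form_add:
  assumes "alternating_form k S \<omega>" "length us + length vs + 1 = k" "set us \<subseteq> S" "set vs \<subseteq> S"
    "v \<in> S" "w \<in> S"
  shows "\<omega> (us @ (\<lambda>f. v f + w f) # vs) = \<omega> (us @ v # vs) + \<omega> (us @ w # vs)"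
  using alternating_form_linear[OF assms, of 1 1] by simp

text \<open>Polarisation: the definition only demands vanishing on repeated arguments, so the sum of
  \<open>v\<close> and \<open>w\<close> is put into both slots.\<close>

lemma alternating_form_swap:
  assumes \<omega>: "alternating_form k S \<omega>" and l: "length (us @ v # w # vs) = k"
    and S: "set us \<subseteq> S" "set vs \<subseteq> S" "v \<in> S" "w \<in> S" "(\<lambda>f. v f + w f) \<in> S"
  shows "\<omega> (us @ v # w # vs) = - \<omega> (us @ w # v # vs)"
proof -
  let ?u = "\<lambda>f. v f + w f"
  have z: "\<omega> (us @ u # u # vs) = 0" if "u \<in> S" for u
  proof -
    have "length (us @ u # u # vs) = k" "set (us @ u # u # vs) \<subseteq> S" "\<not> distinct (us @ u # u # vs)"
      using l S that by auto
    then show ?thesis using \<omega> unfolding alternating_form_def by blast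
  qed
  have 1: "\<omega> (us @ ?u # ?u # vs) = \<omega> (us @ v # ?u # vs) + \<omega> (us @ w # ?u # vs)"
    by (rule alternating_form_add[OF \<omega>]) (use l S in auto)
  have 2: "\<omega> (us @ x # ?u # vs) = \<omega> (us @ x # v # vs) + \<omega> (us @ x # w # vs)" if "x \<in> S" for x
    using alternating_form_add[OF \<omega>, of "us @ [x]" vs v w] l S that by simp
  show ?thesis using 1 2[OF S(3)] 2[OF S(4)] z[OF S(3)] z[OF S(4)] z[OF S(5)] by simp
qed

text \<open>Tangent vectors are plain functions, not elements of a vector space type; a set
  \<open>S\<close> closed under binary combinations takes the place of linear algebra, and sums are
  reached by induction on the index set.\<close>

lemma
  assumes e: "\<And>i. e i \<in> S"
    and S2: "\<And>v w a b. v \<in> S \<Longrightarrow> w \<in> S \<Longrightarrow> (\<lambda>f. a * v f + b * w f) \<in> S"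
  shows frame_vec_in: "frame_vec e x \<in> S"
    and linear_frame_vec: "(\<And>v w a b. v \<in> S \<Longrightarrow> w \<in> S \<Longrightarrow>
      \<phi> (\<lambda>f. a * v f + b * w f) = a * \<phi> v + b * \<phi> w) \<Longrightarrow>
      \<phi> (frame_vec e x) = (\<Sum>i\<in>UNIV. x $ i * (\<phi> (e i) :: real))"
proof -
  have in_S: "(\<lambda>f. \<Sum>i\<in>I. x $ i * e i f) \<in> S" if "finite I" for I :: "8 set"
    using that
  proof (induction I)
    case empty
    \<comment> \<open>The zero function is a combination with both coefficients 0, so any two frame
      vectors serve.\<close>
    show ?case using S2[OF e e, of 0 undefined 0 undefined] by simp
  next
    case (insert i I)
    then show ?case using S2[OF e, of "\<lambda>f. \<Sum>i\<in>I. x $ i * e i f" "x $ i" i 1] by simp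
  qed
  then show "frame_vec e x \<in> S" by (simp add: frame_vec_def)
  assume \<phi>: "\<And>v w a b. v \<in> S \<Longrightarrow> w \<in> S \<Longrightarrow> \<phi> (\<lambda>f. a * v f + b * w f) = a * \<phi> v + b * \<phi> w"
  have "\<phi> (\<lambda>f. \<Sum>i\<in>I. x $ i * e i f) = (\<Sum>i\<in>I. x $ i * \<phi> (e i))" if "finite I" for I :: "8 set"
    using that
  proof (induction I)
    case empty
    show ?case using \<phi>[OF e e, of 0 undefined 0 undefined] by simp
  next
    case (insert i I)
    then show ?case using \<phi>[OF e in_S[OF insert(1)], of "x $ i" i 1] by simp
  qed
  from this[of UNIV] show "\<phi> (frame_vec e x) = (\<Sum>i\<in>UNIV. x $ i * \<phi> (e i))"
    by (simp add: frame_vec_def)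
qed

lemma alternating_form_frame_sum:
  assumes "alternating_form k S \<omega>" "length us + length vs + 1 = k" "set us \<subseteq> S" "set vs \<subseteq> S"
    and e: "\<And>i. e i \<in> S"
    and S2: "\<And>v w a b. v \<in> S \<Longrightarrow> w \<in> S \<Longrightarrow> (\<lambda>f. a * v f + b * w f) \<in> S"
  shows "\<omega> (us @ frame_vec e x # vs) = (\<Sum>i\<in>UNIV. x $ i * \<omega> (us @ e i # vs))"
  by (rule linear_frame_vec[where \<phi>="\<lambda>v. \<omega> (us @ v # vs)" and S=S])
    (use e S2 alternating_form_linear[OF assms(1-4)] in blast)+

text \<open>Both sides are multilinear, so they are compared on frame vectors, where they agree on
  increasing lists by definition and elsewhere by \<open>antisymmetric_eq_zero\<close>. The
  induction keeps the arguments already replaced by frame vectors in the list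
  \<open>is\<close>.\<close>

lemma form_eval_form_in:
  assumes \<omega>: "alternating_form k S \<omega>" and e: "\<And>i. e i \<in> S"
    and S2: "\<And>v w a b. v \<in> S \<Longrightarrow> w \<in> S \<Longrightarrow> (\<lambda>f. a * v f + b * w f) \<in> S"
    and l: "length xs = k"
  shows "\<omega> (map (frame_vec e) xs) = form_eval (form_in k e \<omega>) xs"
proof -
  let ?\<alpha> = "form_in k e \<omega>"
  have F: "frame_vec e x \<in> S" for x by (rule frame_vec_in) (fact e, fact S2)
  have "length is + length xs = k \<Longrightarrow>
    \<omega> (map e is @ map (frame_vec e) xs) = form_eval ?\<alpha> (map unit8 is @ xs)" for "is"
  proof (induction xs arbitrary: "is")
    case Nil
    have "\<omega> (map e is) - form_eval ?\<alpha> (map unit8 is) = 0"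
    proof (rule antisymmetric_eq_zero[where k=k and h="\<lambda>is. \<omega> (map e is) - form_eval ?\<alpha> (map unit8 is)"])
      fix us vs :: "8 list" and a b assume l: "length (us @ a # b # vs) = k"
      have "\<omega> (map e us @ e a # e b # map e vs) = - \<omega> (map e us @ e b # e a # map e vs)"
        by (rule alternating_form_swap[OF \<omega>]) (use l e S2[OF e e, of 1 a 1 b] in auto)
      moreover note form_eval_swap[of ?\<alpha> "map unit8 us" "unit8 a" "unit8 b" "map unit8 vs"]
      ultimately show "\<omega> (map e (us @ a # b # vs)) - form_eval ?\<alpha> (map unit8 (us @ a # b # vs)) =
          - (\<omega> (map e (us @ b # a # vs)) - form_eval ?\<alpha> (map unit8 (us @ b # a # vs)))"
        by simp
    next
      fix I :: "8 set" assume "card I = k"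
      then show "\<omega> (map e (incr I)) - form_eval ?\<alpha> (map unit8 (incr I)) = 0"
        by (simp add: form_eval_incr) (simp add: form_in_def)
    qed (use Nil in simp)
    then show ?case by simp
  next
    case (Cons x xs)
    have "\<omega> (map e is @ frame_vec e x # map (frame_vec e) xs) =
        (\<Sum>i\<in>UNIV. x $ i * \<omega> (map e is @ e i # map (frame_vec e) xs))"
    proof (rule alternating_form_frame_sum[OF \<omega> _ _ _ e S2])
      show "length (map e is) + length (map (frame_vec e) xs) + 1 = k" using Cons.prems by simp
      show "set (map e is) \<subseteq> S" using e by auto
      show "set (map (frame_vec e) xs) \<subseteq> S" using F by auto
    qed
    also have "\<dots> = (\<Sum>i\<in>UNIV. x $ i * form_eval ?\<alpha> (map unit8 is @ unit8 i # xs))"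
      using Cons.IH[of "is @ [i]" for i] Cons.prems by simp
    also have "\<dots> = form_eval ?\<alpha> (map unit8 is @ (\<Sum>i\<in>UNIV. x $ i *\<^sub>R unit8 i) # xs)"
      by (simp add: linear_sum[OF linear_form_eval_slot] linear_cmul[OF linear_form_eval_slot])
    also have "(\<Sum>i\<in>UNIV. x $ i *\<^sub>R unit8 i) = x" by (rule unit8_sum[symmetric])
    finally show ?case by simp
  qed
  from this[of "[]"] show ?thesis using l by simp
qed

lemma form_in_Lam: "form_in k e \<omega> \<in> Lam k"
  by (simp add: Lam_def form_in_def)

section \<open>Smooth functions and tangent vectors\<close>

text \<open>\<open>C_on\<close> uses derivatives in the ambient space. Agreement on an open set
  passes to these derivatives, again on the same set, which keeps the induction going.\<close>

lemma C_on_cong: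
  assumes "open S" "\<And>x. x \<in> S \<Longrightarrow> f x = h x" "C_on k S f"
  shows "C_on k S h"
  using assms(2,3)
proof (induction k arbitrary: f h)
  case 0
  then show ?case using continuous_on_cong[of S S f h] by simp
next
  case (Suc k)
  have d: "(h has_derivative D) (at x)" if "(f has_derivative D) (at x)" "x \<in> S" for D x
    using that Suc.prems(1) by (intro has_derivative_transform_within_open[OF that(1) assms(1)]) auto
  have eq: "frechet_derivative f (at x) v = frechet_derivative h (at x) v" if "x \<in> S" for x v
    using that Suc.prems(2) d[OF _ that, of "frechet_derivative f (at x)"]
    by (metis C_on.simps(2) frechet_derivative_at frechet_derivative_works)
  have "C_on k S (\<lambda>x. frechet_derivative h (at x) v)" for v
    using Suc.IH[of "\<lambda>x. frechet_derivative f (at x) v" "\<lambda>x. frechet_derivative h (at x) v"]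
      Suc.prems(2) eq by simp
  moreover have "h differentiable (at x)" if "x \<in> S" for x
    using Suc.prems(2) d[OF _ that] that unfolding differentiable_def C_on.simps by blast
  ultimately show ?case by simp
qed

lemma C_on_subset: "C_on k S f \<Longrightarrow> T \<subseteq> S \<Longrightarrow> C_on k T f"
  by (induction k arbitrary: f) (auto intro: continuous_on_subset)

lemma C_on_local:
  assumes "\<And>x. x \<in> S \<Longrightarrow> \<exists>T. open T \<and> x \<in> T \<and> C_on k T f"
  shows "C_on k S f"
  using assms
proof (induction k arbitrary: f)
  case 0
  have "continuous (at x) f" if "x \<in> S" for x
    using 0[OF that] by (auto simp: continuous_on_eq_continuous_at)
  then show ?case by (auto intro: continuous_at_imp_continuous_on)
next
  case (Suc k)
  have "f differentiable (at x)" if "x \<in> S" for x using Suc.prems[OF that] by auto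
  moreover have "C_on k S (\<lambda>x. frechet_derivative f (at x) v)" for v
    by (rule Suc.IH) (use Suc.prems in fastforce)
  ultimately show ?case by simp
qed

lemma C_on_Suc: "C_on (Suc k) S f \<Longrightarrow> C_on k S f"
proof (induction k arbitrary: f)
  case 0
  then show ?case
    by (auto intro!: continuous_at_imp_continuous_on differentiable_imp_continuous_within)
qed auto

lemma C_on_const: "C_on k S (\<lambda>x. c)"
  by (induction k arbitrary: c) auto

lemma C_on_add:
  assumes "open S" "C_on k S f" "C_on k S h"
  shows "C_on k S (\<lambda>x. f x + h x)"
  using assms(2,3)
proof (induction k arbitrary: f h)
  case (Suc k)
  have d: "((\<lambda>x. f x + h x) has_derivative
      (\<lambda>v. frechet_derivative f (at x) v + frechet_derivative h (at x) v)) (at x)"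
    if "x \<in> S" for x
    using Suc.prems that by (auto intro!: has_derivative_add simp flip: frechet_derivative_works)
  have eq: "frechet_derivative f (at x) v + frechet_derivative h (at x) v =
      frechet_derivative (\<lambda>x. f x + h x) (at x) v" if "x \<in> S" for x v
    using fun_cong[OF frechet_derivative_at[OF d[OF that]]] by simp
  have "C_on k S (\<lambda>x. frechet_derivative (\<lambda>x. f x + h x) (at x) v)" for v
    by (rule C_on_cong[OF assms(1) eq Suc.IH]) (use Suc.prems in auto)
  then show ?case using differentiableI[OF d] by simp
qed (auto intro: continuous_on_add)

text \<open>The product rule pairs each derivative with an undifferentiated factor;
  \<open>C_on_Suc\<close> lowers the class of that factor to the one in the induction
  hypothesis.\<close>

lemma C_on_mult:
  fixes f h :: "'a::euclidean_space \<Rightarrow> real"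
  assumes "open S" "C_on k S f" "C_on k S h"
  shows "C_on k S (\<lambda>x. f x * h x)"
  using assms(2,3)
proof (induction k arbitrary: f h)
  case (Suc k)
  have d: "((\<lambda>x. f x * h x) has_derivative
      (\<lambda>v. f x * frechet_derivative h (at x) v + frechet_derivative f (at x) v * h x)) (at x)"
    if "x \<in> S" for x
    using Suc.prems that by (auto intro!: has_derivative_mult simp flip: frechet_derivative_works)
  have eq: "f x * frechet_derivative h (at x) v + frechet_derivative f (at x) v * h x =
      frechet_derivative (\<lambda>x. f x * h x) (at x) v" if "x \<in> S" for x v
    using fun_cong[OF frechet_derivative_at[OF d[OF that]]] by simp
  have "C_on k S (\<lambda>x. frechet_derivative (\<lambda>x. f x * h x) (at x) v)" for v
    by (rule C_on_cong[OF assms(1) eq C_on_add[OF assms(1)]])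
      (use Suc.prems Suc.IH C_on_Suc[OF Suc.prems(1)] C_on_Suc[OF Suc.prems(2)] in auto)
  then show ?case using differentiableI[OF d] by simp
qed (auto intro: continuous_on_mult)

section \<open>Smooth functions, derivations and vector fields on a manifold\<close>

locale oriented_manifold =
  fixes A :: "'m::{t2_space,second_countable_topology} atlas"
  assumes atlas: "oriented_atlas A"
begin

lemma chart_inverse: "(V, \<phi>) \<in> A \<Longrightarrow> q \<in> V \<Longrightarrow> inv_into V \<phi> (\<phi> q) = q"
  using atlas by (fastforce simp: oriented_atlas_def homeomorphism_def)

lemma chart_image_open:
  assumes "(V, \<phi>) \<in> A" "open U" shows "open (\<phi> ` (U \<inter> V))"
proof -
  have "homeomorphism V (\<phi> ` V) \<phi> (inv_into V \<phi>)" "open (\<phi> ` V)"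
    using atlas assms(1) by (auto simp: oriented_atlas_def)
  moreover have "openin (top_of_set V) (U \<inter> V)"
    using assms(2) by (auto simp: openin_open)
  ultimately show ?thesis
    using homeomorphism_imp_open_map openin_open_trans by metis
qed

lemma smooth_fun_iff:
  "open U \<Longrightarrow> smooth_fun A U f \<longleftrightarrow>
    (\<forall>(V, \<phi>)\<in>A. \<forall>k. C_on k (\<phi> ` (U \<inter> V)) (f \<circ> inv_into V \<phi>))"
  using chart_image_open by (fastforce simp: smooth_fun_def C_infinity_on_def)

lemma smooth_funI:
  assumes "open U" "\<And>V \<phi> k. (V, \<phi>) \<in> A \<Longrightarrow> open (\<phi> ` (U \<inter> V)) \<Longrightarrow> C_on k (\<phi> ` (U \<inter> V)) (f \<circ> inv_into V \<phi>)"
  shows "smooth_fun A U f"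
  using assms chart_image_open by (auto simp: smooth_fun_iff)

lemma smooth_funD:
  "smooth_fun A U f \<Longrightarrow> (V, \<phi>) \<in> A \<Longrightarrow> C_on k (\<phi> ` (U \<inter> V)) (f \<circ> inv_into V \<phi>)"
  by (auto simp: smooth_fun_def C_infinity_on_def)

lemma smooth_fun_open: "smooth_fun A U f \<Longrightarrow> open U"
  by (simp add: smooth_fun_def)

lemma smooth_fun_cong:
  assumes "smooth_fun A U f" "\<And>q. q \<in> U \<Longrightarrow> f q = h q" shows "smooth_fun A U h"
proof (rule smooth_funI)
  fix V \<phi> k assume V: "(V, \<phi>) \<in> A" "open (\<phi> ` (U \<inter> V))"
  show "C_on k (\<phi> ` (U \<inter> V)) (h \<circ> inv_into V \<phi>)"
    by (rule C_on_cong[OF V(2) _ smooth_funD[OF assms(1) V(1)]])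
      (use assms(2) chart_inverse[OF V(1)] in auto)
qed (use assms(1) smooth_fun_open in blast)

lemma smooth_fun_subset:
  assumes "smooth_fun A U f" "open N" "N \<subseteq> U" shows "smooth_fun A N f"
  by (rule smooth_funI[OF assms(2)], rule C_on_subset[OF smooth_funD[OF assms(1)]])
    (use assms(3) in auto)

lemma smooth_fun_local:
  assumes U: "open U" and loc: "\<And>q. q \<in> U \<Longrightarrow> \<exists>N. q \<in> N \<and> smooth_fun A N f"
  shows "smooth_fun A U f"
proof (rule smooth_funI[OF U])
  fix V \<phi> k assume V: "(V, \<phi>) \<in> A"
  show "C_on k (\<phi> ` (U \<inter> V)) (f \<circ> inv_into V \<phi>)"
  proof (rule C_on_local)
    fix x assume "x \<in> \<phi> ` (U \<inter> V)"
    then obtain q where q: "x = \<phi> q" "q \<in> U" "q \<in> V" by auto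
    then obtain N where N: "q \<in> N" "smooth_fun A N f" using loc by blast
    have "open (\<phi> ` (N \<inter> V))" using chart_image_open[OF V] smooth_fun_open[OF N(2)] by blast
    then show "\<exists>T. open T \<and> x \<in> T \<and> C_on k T (f \<circ> inv_into V \<phi>)"
      using smooth_funD[OF N(2) V] q N(1) by blast
  qed
qed

lemma smooth_fun_const: "open U \<Longrightarrow> smooth_fun A U (\<lambda>q. c)"
  by (rule smooth_funI) (simp_all add: comp_def C_on_const)

lemma smooth_fun_add:
  assumes "smooth_fun A U f" "smooth_fun A U h" shows "smooth_fun A U (\<lambda>q. f q + h q)"
  using C_on_add smooth_funD[OF assms(1)] smooth_funD[OF assms(2)]
  by (intro smooth_funI smooth_fun_open[OF assms(1)]) (fastforce simp: comp_def)

lemma smooth_fun_mult: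
  assumes "smooth_fun A U f" "smooth_fun A U h" shows "smooth_fun A U (\<lambda>q. f q * h q)"
  using C_on_mult smooth_funD[OF assms(1)] smooth_funD[OF assms(2)]
  by (intro smooth_funI smooth_fun_open[OF assms(1)]) (fastforce simp: comp_def)

lemma smooth_fun_sum:
  assumes "open U" "\<And>i. i \<in> I \<Longrightarrow> smooth_fun A U (f i)"
  shows "smooth_fun A U (\<lambda>q. \<Sum>i\<in>I. f i q)"
  using assms(2)
  by (induction I rule: infinite_finite_induct)
    (auto intro: smooth_fun_add smooth_fun_const[OF assms(1)])

lemma smooth_near_cong:
  assumes "smooth_near A p f" "open N" "p \<in> N" "\<And>q. q \<in> N \<Longrightarrow> f q = h q"
  shows "smooth_near A p h"
proof -
  obtain U where U: "p \<in> U" "smooth_fun A U f" using assms(1) by (auto simp: smooth_near_def)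
  have "smooth_fun A (U \<inter> N) f"
    by (rule smooth_fun_subset[OF U(2)]) (use assms(2) smooth_fun_open[OF U(2)] in auto)
  then have "smooth_fun A (U \<inter> N) h" by (rule smooth_fun_cong) (use assms(4) in auto)
  then show ?thesis using U(1) assms(3) unfolding smooth_near_def by blast
qed

lemma tangent_add:
  "v \<in> tangent_space A p \<Longrightarrow> smooth_near A p f \<Longrightarrow> smooth_near A p h \<Longrightarrow>
    v (\<lambda>q. f q + h q) = v f + v h"
  by (simp add: tangent_space_def)

lemma tangent_mult:
  "v \<in> tangent_space A p \<Longrightarrow> smooth_near A p f \<Longrightarrow> smooth_near A p h \<Longrightarrow>
    v (\<lambda>q. f q * h q) = f p * v h + h p * v f"
  by (simp add: tangent_space_def)

lemma tangent_cmult: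
  "v \<in> tangent_space A p \<Longrightarrow> smooth_near A p f \<Longrightarrow> v (\<lambda>q. c * f q) = c * v f"
  by (simp add: tangent_space_def)

lemma tangent_not_smooth: "v \<in> tangent_space A p \<Longrightarrow> \<not> smooth_near A p f \<Longrightarrow> v f = 0"
  by (simp add: tangent_space_def)

lemma smooth_near_add: "smooth_near A p f \<Longrightarrow> smooth_near A p h \<Longrightarrow> smooth_near A p (\<lambda>q. f q + h q)"
  and smooth_near_mult: "smooth_near A p f \<Longrightarrow> smooth_near A p h \<Longrightarrow> smooth_near A p (\<lambda>q. f q * h q)"
proof -
  assume "smooth_near A p f" "smooth_near A p h"
  then obtain U N where fh: "p \<in> U" "p \<in> N" "smooth_fun A U f" "smooth_fun A N h"
    by (auto simp: smooth_near_def)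
  have f: "smooth_fun A (U \<inter> N) f"
    by (rule smooth_fun_subset[OF fh(3)]) (use smooth_fun_open fh in auto)
  have h: "smooth_fun A (U \<inter> N) h"
    by (rule smooth_fun_subset[OF fh(4)]) (use smooth_fun_open fh in auto)
  show "smooth_near A p (\<lambda>q. f q + h q)" "smooth_near A p (\<lambda>q. f q * h q)"
    unfolding smooth_near_def using fh(1,2) smooth_fun_add[OF f h] smooth_fun_mult[OF f h]
    by (intro exI[of _ "U \<inter> N"], simp)+
qed

lemma smooth_near_const: "smooth_near A p (\<lambda>q. c)"
  using smooth_fun_const[of UNIV] by (auto simp: smooth_near_def)

lemma smooth_near_sum:
  "(\<And>i. i \<in> I \<Longrightarrow> smooth_near A p (f i)) \<Longrightarrow> smooth_near A p (\<lambda>q. \<Sum>i\<in>I. f i q)"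
  by (induction I rule: infinite_finite_induct) (auto intro: smooth_near_add smooth_near_const)

text \<open>The Leibniz rule for 1 = 1 * 1 gives \<open>v 1 = 2 * v 1\<close>.\<close>

lemma tangent_const:
  assumes "v \<in> tangent_space A p" shows "v (\<lambda>q. c) = 0"
  using tangent_mult[OF assms smooth_near_const smooth_near_const, of 1 1]
    tangent_cmult[OF assms smooth_near_const, of c 1] by simp

lemma tangent_sum:
  assumes "v \<in> tangent_space A p" "\<And>i. i \<in> I \<Longrightarrow> smooth_near A p (f i)"
  shows "v (\<lambda>q. \<Sum>i\<in>I. f i q) = (\<Sum>i\<in>I. v (f i))"
  using assms(2)
proof (induction I rule: infinite_finite_induct)
  case (insert i I)
  have "smooth_near A p (\<lambda>q. \<Sum>i\<in>I. f i q)" by (rule smooth_near_sum) (use insert.prems in auto)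
  then have "v (\<lambda>q. f i q + (\<Sum>i\<in>I. f i q)) = v (f i) + v (\<lambda>q. \<Sum>i\<in>I. f i q)"
    using insert.prems by (intro tangent_add[OF assms(1)]) auto
  then show ?case using insert by simp
qed (simp_all add: tangent_const[OF assms(1)])

text \<open>Multiply \<open>f - h\<close> with the indicator function of the complement of the neighbourhood.\<close>

lemma tangent_cong:
  assumes v: "v \<in> tangent_space A p" and N: "open N" "p \<in> N" "\<And>q. q \<in> N \<Longrightarrow> f q = h q"
  shows "v f = v h"
proof (cases "smooth_near A p f")
  case False
  then have "\<not> smooth_near A p h" using smooth_near_cong[of p h N f] N by auto
  then show ?thesis using tangent_not_smooth[OF v] False by simp
next
  case True
  then have h: "smooth_near A p h" using smooth_near_cong N by blast
  have mh: "smooth_near A p (\<lambda>q. - 1 * h q)"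
    using smooth_near_mult[OF smooth_near_const h] .
  define ind where "ind = (\<lambda>q. if q \<in> N then 0 else 1 :: real)"
  have ind: "smooth_near A p ind"
    by (rule smooth_near_cong[OF smooth_near_const[of p 0] N(1,2)]) (simp add: ind_def)
  have "(\<lambda>q. f q + - 1 * h q) = (\<lambda>q. ind q * (f q + - 1 * h q))"
    using N(3) by (auto simp: ind_def)
  then have "v (\<lambda>q. f q + - 1 * h q) = v (\<lambda>q. ind q * (f q + - 1 * h q))" by metis
  also have "\<dots> = 0"
    using tangent_mult[OF v ind smooth_near_add[OF True mh]] N(2,3) by (simp add: ind_def)
  finally show ?thesis
    using tangent_add[OF v True mh] tangent_cmult[OF v h, of "- 1"] by simp
qed

lemma tangent_space_linear:
  assumes "u \<in> tangent_space A p" "v \<in> tangent_space A p"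
  shows "(\<lambda>f. a * u f + b * v f) \<in> tangent_space A p"
  using assms by (auto simp: tangent_space_def algebra_simps)

lemma vector_fieldD:
  assumes "vector_field A U X"
  shows "open U" "p \<in> U \<Longrightarrow> X p \<in> tangent_space A p"
    "smooth_fun A V f \<Longrightarrow> V \<subseteq> U \<Longrightarrow> smooth_fun A V (\<lambda>p. X p f)"
  using assms by (auto simp: vector_field_def)

lemma vector_field_subset:
  "vector_field A U X \<Longrightarrow> open N \<Longrightarrow> N \<subseteq> U \<Longrightarrow> vector_field A N X"
  unfolding vector_field_def by blast

lemma vector_field_add:
  assumes "vector_field A U X" "vector_field A U Y"
  shows "vector_field A U (\<lambda>p f. X p f + Y p f)"
  using assms tangent_space_linear[of "X p" p "Y p" 1 1 for p] smooth_fun_add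
  by (auto simp: vector_field_def)

lemma vector_field_mult:
  assumes "vector_field A U X" "smooth_fun A U h"
  shows "vector_field A U (\<lambda>p f. h p * X p f)"
proof -
  have "smooth_fun A V (\<lambda>p. h p * X p f)" if "V \<subseteq> U" "smooth_fun A V f" for V f
    using that assms smooth_fun_open by (intro smooth_fun_mult) (auto intro: smooth_fun_subset simp: vector_field_def)
  then show ?thesis
    using assms tangent_space_linear[of "X p" p "X p" "h p" 0 for p] by (auto simp: vector_field_def)
qed

lemma vector_field_local:
  assumes "open U" "\<And>p. p \<in> U \<Longrightarrow> \<exists>N. p \<in> N \<and> vector_field A N X"
  shows "vector_field A U X"
  unfolding vector_field_def
proof (intro conjI allI impI ballI assms(1))
  show "X p \<in> tangent_space A p" if "p \<in> U" for p
    using assms(2)[OF that] vector_fieldD(2) by blast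
  fix V f assume V: "V \<subseteq> U \<and> smooth_fun A V f"
  show "smooth_fun A V (\<lambda>p. X p f)"
  proof (rule smooth_fun_local)
    show "open V" using V smooth_fun_open by blast
    fix q assume "q \<in> V"
    then obtain N where N: "q \<in> N" "vector_field A N X" using assms(2) V by blast
    then have "open (V \<inter> N)" using V smooth_fun_open vector_fieldD(1) by blast
    then have "smooth_fun A (V \<inter> N) f" using V smooth_fun_subset by blast
    then have "smooth_fun A (V \<inter> N) (\<lambda>p. X p f)" using vector_fieldD(3)[OF N(2)] by blast
    then show "\<exists>N. q \<in> N \<and> smooth_fun A N (\<lambda>p. X p f)" using N(1) \<open>q \<in> V\<close> by blast
  qed
qed

lemma vector_field_cong:
  assumes "vector_field A U X" "\<And>p. p \<in> U \<Longrightarrow> X p = Y p"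
  shows "vector_field A U Y"
proof -
  have "smooth_fun A V (\<lambda>p. Y p f)" if "V \<subseteq> U" "smooth_fun A V f" for V f
    by (rule smooth_fun_cong[OF vector_fieldD(3)[OF assms(1) that(2,1)]]) (use assms(2) that in auto)
  then show ?thesis using assms by (auto simp: vector_field_def)
qed

lemma vector_field_zero: "open U \<Longrightarrow> vector_field A U (\<lambda>p f. 0)"
  by (auto simp: vector_field_def tangent_space_def smooth_fun_const smooth_fun_open)

lemma vector_field_sum:
  assumes "open U" "\<And>i. i \<in> I \<Longrightarrow> vector_field A U (X i)"
  shows "vector_field A U (\<lambda>p f. \<Sum>i\<in>I. X i p f)"
  using assms(2)
  by (induction I rule: infinite_finite_induct)
    (auto intro: vector_field_add vector_field_zero[OF assms(1)])

text \<open>Each double bracket expands into four third derivatives, and the twelve terms of the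
  cyclic sum cancel in pairs. All is done on an open set where \<open>f\<close> is smooth, since
  \<open>lie_bracket\<close> is set to 0 on other functions.\<close>

lemma lie_bracket_jacobi:
  assumes X: "vector_field A U X" and Y: "vector_field A U Y" and Z: "vector_field A U Z"
    and p: "p \<in> U"
  shows "lie_bracket A X (lie_bracket A Y Z) p f + lie_bracket A Y (lie_bracket A Z X) p f
    + lie_bracket A Z (lie_bracket A X Y) p f = 0"
proof (cases "smooth_near A p f")
  case True
  then obtain N where N: "p \<in> N" "smooth_fun A N f" by (auto simp: smooth_near_def)
  define V where "V = U \<inter> N"
  have V: "open V" "p \<in> V" "V \<subseteq> U" "smooth_fun A V f"
    using N p vector_fieldD(1)[OF X] smooth_fun_open[OF N(2)] smooth_fun_subset[OF N(2)]
    by (auto simp: V_def)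
  have near: "smooth_near A q h" if "smooth_fun A V h" "q \<in> V" for q h
    using that by (auto simp: smooth_near_def)
  have main: "lie_bracket A X (lie_bracket A Y Z) p f =
      X p (\<lambda>q. Y q (\<lambda>r. Z r f)) - X p (\<lambda>q. Z q (\<lambda>r. Y r f))
      - Y p (\<lambda>q. Z q (\<lambda>r. X r f)) + Z p (\<lambda>q. Y q (\<lambda>r. X r f))"
    if X: "vector_field A U X" and Y: "vector_field A U Y" and Z: "vector_field A U Z" for X Y Z
  proof -
    have s: "smooth_fun A V (\<lambda>q. Y q (\<lambda>r. Z r f))" "smooth_fun A V (\<lambda>q. Z q (\<lambda>r. Y r f))"
      "smooth_fun A V (\<lambda>r. X r f)"
      using V vector_fieldD(3)[OF X] vector_fieldD(3)[OF Y] vector_fieldD(3)[OF Z] by auto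
    have s2: "smooth_near A p (\<lambda>q. - 1 * Z q (\<lambda>r. Y r f))"
      using smooth_near_mult[OF smooth_near_const near[OF s(2) V(2)]] .
    have Xp: "X p \<in> tangent_space A p" using vector_fieldD(2)[OF X p] .
    have "X p (\<lambda>q. lie_bracket A Y Z q f) = X p (\<lambda>q. Y q (\<lambda>r. Z r f) + - 1 * Z q (\<lambda>r. Y r f))"
      by (rule tangent_cong[OF Xp V(1,2)]) (simp add: lie_bracket_def near[OF V(4)])
    also have "\<dots> = X p (\<lambda>q. Y q (\<lambda>r. Z r f)) - X p (\<lambda>q. Z q (\<lambda>r. Y r f))"
      using tangent_add[OF Xp near[OF s(1) V(2)] s2]
        tangent_cmult[OF Xp near[OF s(2) V(2)], of "- 1"] by simp
    moreover have "lie_bracket A Y Z p (\<lambda>r. X r f) =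
        Y p (\<lambda>q. Z q (\<lambda>r. X r f)) - Z p (\<lambda>q. Y q (\<lambda>r. X r f))"
      using near[OF s(3) V(2)] by (simp add: lie_bracket_def)
    ultimately show ?thesis using True by (simp add: lie_bracket_def[of A X])
  qed
  show ?thesis using main[OF X Y Z] main[OF Y Z X] main[OF Z X Y] by simp
qed (simp add: lie_bracket_def)

end

section \<open>The characteristic connection\<close>

lemma form_eval_sum_slot:
  "form_eval \<alpha> (us @ x # vs) = (\<Sum>i\<in>UNIV. x $ i * form_eval \<alpha> (us @ unit8 i # vs))"
proof -
  have "form_eval \<alpha> (us @ x # vs) = form_eval \<alpha> (us @ (\<Sum>i\<in>UNIV. x $ i *\<^sub>R unit8 i) # vs)"
    by (simp flip: unit8_sum)
  then show ?thesis
    by (simp add: linear_sum[OF linear_form_eval_slot] linear_cmul[OF linear_form_eval_slot])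
qed

lemma form_eval_3_sum:
  "form_eval \<alpha> [x, y, z] = (\<Sum>a\<in>UNIV. \<Sum>b\<in>UNIV. \<Sum>c\<in>UNIV.
    (x $ a * (y $ b * z $ c)) * form_eval \<alpha> [unit8 a, unit8 b, unit8 c])"
proof -
  have "form_eval \<alpha> [x, y, z] = (\<Sum>a\<in>UNIV. x $ a * form_eval \<alpha> [unit8 a, y, z])" for x
    using form_eval_sum_slot[of \<alpha> "[]" x "[y, z]"] by simp
  moreover have "form_eval \<alpha> [x, y, z] = (\<Sum>b\<in>UNIV. y $ b * form_eval \<alpha> [x, unit8 b, z])" for x y
    using form_eval_sum_slot[of \<alpha> "[x]" y "[z]"] by simp
  moreover have "form_eval \<alpha> [x, y, z] = (\<Sum>c\<in>UNIV. z $ c * form_eval \<alpha> [x, y, unit8 c])" for x y z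
    using form_eval_sum_slot[of \<alpha> "[x, y]" z "[]"] by simp
  ultimately have "form_eval \<alpha> [x, y, z] = (\<Sum>a\<in>UNIV. x $ a * (\<Sum>b\<in>UNIV. y $ b *
      (\<Sum>c\<in>UNIV. z $ c * form_eval \<alpha> [unit8 a, unit8 b, unit8 c])))" by (metis (no_types, lifting) sum.cong)
  then show ?thesis by (simp add: sum_distrib_left mult.assoc)
qed

lemma form_eval_sigma_2:
  assumes "\<alpha> \<in> Lam 2"
  shows "form_eval (sigma 2 \<alpha> \<beta>) xs = (1/2) * (\<Sum>i\<in>UNIV. \<Sum>j\<in>UNIV.
    form_eval \<alpha> [unit8 i, unit8 j] * form_eval \<beta> (unit8 i # unit8 j # xs))"
  by (simp add: sigma_2[OF assms] form_eval_simps form_eval_Cons[of \<beta>]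
      form_eval_Cons[of "hook_e _ \<beta>"] hook_unit8)

lemma Lam_sigma_2:
  assumes "\<alpha> \<in> Lam 2" "\<beta> \<in> Lam 4" shows "sigma 2 \<alpha> \<beta> \<in> Lam 2"
  unfolding sigma_2[OF assms(1)]
  by (intro subspace_scale subspace_sum subspace_Lam Lam_hook_e_numeral assms)

section \<open>The contraction term as a tensor, independent of the frame\<close>

locale psu3_manifold = oriented_manifold A
  for A :: "'m::{t2_space,second_countable_topology} atlas" +
  fixes g :: "'m \<Rightarrow> 'm tvec \<Rightarrow> 'm tvec \<Rightarrow> real"
    and \<rho> T F :: "'m \<Rightarrow> 'm tvec list \<Rightarrow> real"
    and Dg Dc :: "'m conn"
  assumes psu3: "psu3_structure A g \<rho>"
    and levi_civita: "levi_civita A g Dg"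
    and type: "type_with_characteristic_forms A g \<rho> Dg {1..5} T F"
    and characteristic: "characteristic_connection A g \<rho> Dg T F Dc"
begin

abbreviation "TS \<equiv> tangent_space A"

lemma metric: "riemannian_metric A g"
  and form_rho: "differential_form A 3 \<rho>"
  and form_T: "differential_form A 3 T"
  and form_F: "differential_form A 4 F"
  using psu3 type by (auto simp: psu3_structure_def type_with_characteristic_forms_def)

lemmas alternating_rho = form_rho[unfolded differential_form_def, THEN conjunct1, rule_format]
lemmas alternating_T = form_T[unfolded differential_form_def, THEN conjunct1, rule_format]
lemmas alternating_F = form_F[unfolded differential_form_def, THEN conjunct1, rule_format]

lemma g_commute: "u \<in> TS p \<Longrightarrow> v \<in> TS p \<Longrightarrow> g p u v = g p v u"
  and g_linear: "u \<in> TS p \<Longrightarrow> v \<in> TS p \<Longrightarrow> w \<in> TS p \<Longrightarrow>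
    g p (\<lambda>f. a * u f + b * v f) w = a * g p u w + b * g p v w"
  and g_smooth: "vector_field A U X \<Longrightarrow> vector_field A U Y \<Longrightarrow> smooth_fun A U (\<lambda>p. g p (X p) (Y p))"
  using metric unfolding riemannian_metric_def by blast+

lemma frame_in: "adapted_frame A g \<rho> p e \<Longrightarrow> e i \<in> TS p"
  and frame_orthonormal: "adapted_frame A g \<rho> p e \<Longrightarrow> g p (e i) (e j) = (if i = j then 1 else 0)"
  and frame_rho: "adapted_frame A g \<rho> p e \<Longrightarrow> form_in 3 e (\<rho> p) = rho0"
  by (auto simp: adapted_frame_def oriented_orthonormal_frame_def)

lemma g_frame_vec:
  assumes "adapted_frame A g \<rho> p e" "w \<in> TS p"
  shows "g p (frame_vec e x) w = (\<Sum>i\<in>UNIV. x $ i * g p (e i) w)"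
  by (rule linear_frame_vec[where S="TS p" and \<phi>="\<lambda>v. g p v w"])
    (use assms frame_in tangent_space_linear g_linear in blast)+

lemma frame_vec_vec_in:
  assumes e: "adapted_frame A g \<rho> p e" and v: "v \<in> TS p"
  shows "frame_vec e (vec_in (g p) e v) = v"
proof -
  obtain c where c: "v = (\<lambda>f. \<Sum>i\<in>UNIV. c i * e i f)"
    using e v unfolding adapted_frame_def oriented_orthonormal_frame_def by blast
  then have v': "v = frame_vec e (\<chi> i. c i)" by (simp add: frame_vec_def)
  have "g p v (e j) = c j" for j
    unfolding v' g_frame_vec[OF e frame_in[OF e]]
    by (simp add: frame_orthonormal[OF e] if_distrib[of "\<lambda>x. _ * x"] cong: if_cong)
  then have "vec_in (g p) e v = (\<chi> i. c i)" by (simp add: vec_in_def)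
  then show ?thesis using v' by simp
qed

lemma vec_in_frame: "adapted_frame A g \<rho> p e \<Longrightarrow> vec_in (g p) e (e i) = unit8 i"
  by (simp add: vec_in_def frame_orthonormal unit8_def axis_def vec_eq_iff)

lemma linear_expand:
  assumes e: "adapted_frame A g \<rho> p e" and v: "v \<in> TS p"
    and \<phi>: "\<And>v w a b. v \<in> TS p \<Longrightarrow> w \<in> TS p \<Longrightarrow> \<phi> (\<lambda>f. a * v f + b * w f) = a * \<phi> v + b * \<phi> w"
  shows "\<phi> v = (\<Sum>i\<in>UNIV. g p v (e i) * (\<phi> (e i) :: real))"
proof -
  have "\<phi> (frame_vec e (vec_in (g p) e v)) = (\<Sum>i\<in>UNIV. vec_in (g p) e v $ i * \<phi> (e i))"
    by (rule linear_frame_vec[where S="TS p"])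
      (fact frame_in[OF e], fact tangent_space_linear, fact \<phi>)
  then show ?thesis unfolding frame_vec_vec_in[OF e v] by (simp add: vec_in_def)
qed

lemma form_eval_vec_in:
  assumes \<omega>: "alternating_form k (TS p) \<omega>" and e: "adapted_frame A g \<rho> p e"
    and vs: "length vs = k" "set vs \<subseteq> TS p"
  shows "form_eval (form_in k e \<omega>) (map (vec_in (g p) e) vs) = \<omega> vs"
proof -
  have "form_eval (form_in k e \<omega>) (map (vec_in (g p) e) vs) =
      \<omega> (map (frame_vec e) (map (vec_in (g p) e) vs))"
    by (rule form_eval_form_in[symmetric, where S="TS p"])
      (use \<omega> frame_in[OF e] tangent_space_linear vs(1) in auto)
  also have "map (frame_vec e) (map (vec_in (g p) e) vs) = vs"
    using vs(2) by (auto intro!: map_idI frame_vec_vec_in[OF e])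
  finally show ?thesis .
qed

definition frame_contraction :: "'m \<Rightarrow> (8 \<Rightarrow> 'm tvec) \<Rightarrow> 'm tvec \<Rightarrow> 'm tvec \<Rightarrow> 'm tvec \<Rightarrow> real" where
  "frame_contraction p e x y z =
    form_eval (sigma 2 (hook (vec_in (g p) e x) (form_in 3 e (\<rho> p))) (form_in 4 e (F p)))
      [vec_in (g p) e y, vec_in (g p) e z]"

text \<open>Rewrites the coefficient formula as a sum of values of \<open>\<rho>\<close> and
  \<open>F\<close> on tangent vectors. In this form multilinearity, smoothness and covariant
  derivatives are accessible.\<close>

lemma frame_contraction_sum:
  assumes e: "adapted_frame A g \<rho> p e" and "x \<in> TS p" "y \<in> TS p" "z \<in> TS p"
  shows "frame_contraction p e x y z =
    (1/2) * (\<Sum>a\<in>UNIV. \<Sum>b\<in>UNIV. \<rho> p [x, e a, e b] * F p [e a, e b, y, z])"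
proof -
  let ?c = "vec_in (g p) e"
  have "form_eval (form_in 3 e (\<rho> p)) [?c x, unit8 a, unit8 b] = \<rho> p [x, e a, e b]" for a b
    using form_eval_vec_in[OF alternating_rho e, of "[x, e a, e b]"] assms frame_in[OF e]
    by (simp add: vec_in_frame[OF e])
  moreover have "form_eval (form_in 4 e (F p)) [unit8 a, unit8 b, ?c y, ?c z] =
      F p [e a, e b, y, z]" for a b
    using form_eval_vec_in[OF alternating_F e, of "[e a, e b, y, z]"] assms frame_in[OF e]
    by (simp add: vec_in_frame[OF e])
  ultimately show ?thesis
    unfolding frame_contraction_def form_eval_sigma_2[OF Lam_hook_numeral(2)[OF form_in_Lam]]
      form_eval_Cons[symmetric] by simp
qed

text \<open>An adapted frame is chosen arbitrarily at each point; \<open>contraction_frame\<close>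
  shows that the choice is immaterial.\<close>

definition contraction :: "'m \<Rightarrow> 'm tvec \<Rightarrow> 'm tvec \<Rightarrow> 'm tvec \<Rightarrow> real" where
  "contraction p = frame_contraction p (SOME e. adapted_frame A g \<rho> p e)"

lemma Dc_in: "vector_field A U Y \<Longrightarrow> p \<in> U \<Longrightarrow> x \<in> TS p \<Longrightarrow> Dc p x Y \<in> TS p"
  and Dc_frame: "vector_field A U Y \<Longrightarrow> p \<in> U \<Longrightarrow> x \<in> TS p \<Longrightarrow> z \<in> TS p \<Longrightarrow>
    adapted_frame A g \<rho> p e \<Longrightarrow>
    g p (Dc p x Y) z = g p (Dg p x Y) z + 1/2 * T p [x, Y p, z] + frame_contraction p e x (Y p) z"
  using characteristic unfolding characteristic_connection_def frame_contraction_def by blast+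

lemma frame_field:
  obtains U E where "p \<in> U" "open U" "\<And>i. vector_field A U (E i)"
    "\<And>q. q \<in> U \<Longrightarrow> adapted_frame A g \<rho> q (\<lambda>i. E i q)"
proof -
  obtain U E where "p \<in> U" "adapted_frame_field A g \<rho> U E"
    using type unfolding type_with_characteristic_forms_def by blast
  then show ?thesis using that[of U E] vector_fieldD(1)[of U "E undefined"]
    by (auto simp: adapted_frame_field_def)
qed

text \<open>The defining formula of the characteristic connection holds in every adapted frame, hence the
  contraction does not depend on the frame.\<close>

lemma contraction_frame:
  assumes e: "adapted_frame A g \<rho> p e" and x: "x \<in> TS p" "y \<in> TS p" "z \<in> TS p"
  shows "contraction p x y z = frame_contraction p e x y z"
proof -
  obtain U E where U: "p \<in> U" "open U" "\<And>i. vector_field A U (E i)"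
    and E: "\<And>q. q \<in> U \<Longrightarrow> adapted_frame A g \<rho> q (\<lambda>i. E i q)"
    using frame_field[of p] by metis
  \<comment> \<open>The formula for \<open>Dc\<close> speaks of vector fields, so \<open>y\<close>
    is extended near \<open>p\<close> with constant coefficients in the frame field.\<close>
  define Y where "Y = (\<lambda>q f. \<Sum>i\<in>UNIV. vec_in (g p) (\<lambda>i. E i p) y $ i * E i q f)"
  have Y: "vector_field A U Y"
    unfolding Y_def by (intro vector_field_sum vector_field_mult smooth_fun_const U(2,3))
  have "Y p = y"
    using frame_vec_vec_in[OF E[OF U(1)] x(2)] by (simp add: Y_def frame_vec_def)
  then have "frame_contraction p e' x y z = g p (Dc p x Y) z - g p (Dg p x Y) z - 1/2 * T p [x, y, z]"
    if "adapted_frame A g \<rho> p e'" for e'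
    using Dc_frame[OF Y U(1) x(1,3) that] by simp
  then show ?thesis
    unfolding contraction_def using e someI[of "adapted_frame A g \<rho> p" e] by metis
qed

lemma contraction_sum:
  assumes e: "adapted_frame A g \<rho> p e" and "x \<in> TS p" "y \<in> TS p" "z \<in> TS p"
  shows "contraction p x y z =
    (1/2) * (\<Sum>a\<in>UNIV. \<Sum>b\<in>UNIV. \<rho> p [x, e a, e b] * F p [e a, e b, y, z])"
  using contraction_frame[OF assms] frame_contraction_sum[OF assms] by simp

lemma frame_exists: obtains e where "adapted_frame A g \<rho> p e"
  using psu3 by (auto simp: psu3_structure_def)

lemma T_linear:
  assumes "u \<in> TS p" "v \<in> TS p" "x \<in> TS p" "y \<in> TS p"
  shows "T p [\<lambda>f. a * u f + b * v f, x, y] = a * T p [u, x, y] + b * T p [v, x, y]"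
    and "T p [x, \<lambda>f. a * u f + b * v f, y] = a * T p [x, u, y] + b * T p [x, v, y]"
  using alternating_form_linear[OF alternating_T, of "[]" "[x, y]" p u v a b]
    alternating_form_linear[OF alternating_T, of "[x]" "[y]" p u v a b] assms by simp_all

lemma T_swap:
  assumes "x \<in> TS p" "y \<in> TS p" "z \<in> TS p"
  shows "T p [x, y, z] = - T p [y, x, z]" "T p [x, y, z] = - T p [x, z, y]"
  using alternating_form_swap[OF alternating_T, of "[]" x y "[z]" p]
    alternating_form_swap[OF alternating_T, of "[x]" y z "[]" p]
    tangent_space_linear[of x p y 1 1] tangent_space_linear[of y p z 1 1] assms by simp_all

lemma contraction_linear_1:
  assumes "u \<in> TS p" "v \<in> TS p" "x \<in> TS p" "y \<in> TS p"
  shows "contraction p (\<lambda>f. a * u f + b * v f) x y = a * contraction p u x y + b * contraction p v x y"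
proof -
  obtain e where e: "adapted_frame A g \<rho> p e" using frame_exists .
  have "\<rho> p [\<lambda>f. a * u f + b * v f, e i, e j] = a * \<rho> p [u, e i, e j] + b * \<rho> p [v, e i, e j]" for i j
    using alternating_form_linear[OF alternating_rho, of "[]" "[e i, e j]" p u v a b]
      assms frame_in[OF e] by simp
  then show ?thesis
    using tangent_space_linear[OF assms(1,2)] assms
    by (simp add: contraction_sum[OF e] algebra_simps sum.distrib sum_distrib_left)
qed

lemma contraction_linear_2:
  assumes "u \<in> TS p" "v \<in> TS p" "x \<in> TS p" "y \<in> TS p"
  shows "contraction p x (\<lambda>f. a * u f + b * v f) y = a * contraction p x u y + b * contraction p x v y"
proof -
  obtain e where e: "adapted_frame A g \<rho> p e" using frame_exists .
  have "F p [e i, e j, \<lambda>f. a * u f + b * v f, y] = a * F p [e i, e j, u, y] + b * F p [e i, e j, v, y]" for i j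
    using alternating_form_linear[OF alternating_F, of "[e i, e j]" "[y]" p u v a b]
      assms frame_in[OF e] by simp
  then show ?thesis
    using tangent_space_linear[OF assms(1,2)] assms
    by (simp add: contraction_sum[OF e] algebra_simps sum.distrib sum_distrib_left)
qed

lemma contraction_swap:
  assumes "x \<in> TS p" "y \<in> TS p" "z \<in> TS p"
  shows "contraction p x y z = - contraction p x z y"
proof -
  obtain e where e: "adapted_frame A g \<rho> p e" using frame_exists .
  have "F p [e i, e j, y, z] = - F p [e i, e j, z, y]" for i j
    using alternating_form_swap[OF alternating_F, of "[e i, e j]" y z "[]" p]
      tangent_space_linear[of y p z 1 1] assms frame_in[OF e] by simp
  then show ?thesis using assms by (simp add: contraction_sum[OF e] sum_negf)
qed

text \<open>The component \<open>G 6\<close> vanishes because 6 is outside \<open>{1..5}\<close>;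
  the other five are recovered from \<open>T\<close> and \<open>F\<close>.\<close>

lemma type_at:
  obtains U E where "p \<in> U" "open U" "\<And>i. vector_field A U (E i)"
    "\<And>q. q \<in> U \<Longrightarrow> adapted_frame A g \<rho> q (\<lambda>i. E i q)"
    "form_in 4 (\<lambda>i. E i p) (F p) \<in> star ` Lam4_8 + star ` Lam4_27"
    "intrinsic_torsion g Dg E p =
      Theta1 (form_in 3 (\<lambda>i. E i p) (T p)) + Theta2 (form_in 4 (\<lambda>i. E i p) (F p))"
proof -
  obtain U E G where *: "p \<in> U" "adapted_frame_field A g \<rho> U E"
      "form_in 4 (\<lambda>i. E i p) (F p) \<in> star ` Lam4_8 + star ` Lam4_27"
      "intrinsic_torsion g Dg E p = (\<Sum>i\<in>{1..6}. G i)" "\<forall>i\<in>{1..6} - {1..5::nat}. G i = 0"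
      "Theta1 (form_in 3 (\<lambda>i. E i p) (T p)) = G 1 + G 2 + G 3"
      "Theta2 (form_in 4 (\<lambda>i. E i p) (F p)) = G 4 + G 5"
    using type unfolding type_with_characteristic_forms_def by blast
  have "{1..6} = {1, 2, 3, 4, 5, 6::nat}" by auto
  moreover have "G 6 = 0" using *(5) by auto
  ultimately have "intrinsic_torsion g Dg E p =
      Theta1 (form_in 3 (\<lambda>i. E i p) (T p)) + Theta2 (form_in 4 (\<lambda>i. E i p) (F p))"
    unfolding *(4,6,7) by (simp add: add.assoc)
  then show ?thesis using that[of U E] vector_fieldD(1)[of U "E undefined"] *
    by (auto simp: adapted_frame_field_def)
qed

text \<open>\<open>sigma_2_hook_cyclic\<close> applies in the frame supplied by the type condition,
  where the shape of \<open>F\<close> is known; by frame independence the result concerns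
  \<open>contraction\<close> itself.\<close>

lemma contraction_cyclic:
  assumes x: "x \<in> TS p" "y \<in> TS p" "z \<in> TS p"
  shows "contraction p x y z + contraction p y z x + contraction p z x y = 0"
proof -
  obtain U E where U: "p \<in> U" "\<And>q. q \<in> U \<Longrightarrow> adapted_frame A g \<rho> q (\<lambda>i. E i q)"
      and *: "form_in 4 (\<lambda>i. E i p) (F p) \<in> star ` Lam4_8 + star ` Lam4_27"
    using type_at[of p] by metis
  have e: "adapted_frame A g \<rho> p (\<lambda>i. E i p)" using U by blast
  show ?thesis
    using sigma_2_hook_cyclic[OF *] x
    by (simp add: contraction_frame[OF e] frame_contraction_def frame_rho[OF e])
qed

definition torsion_form :: "'m \<Rightarrow> 'm tvec \<Rightarrow> 'm tvec \<Rightarrow> 'm tvec \<Rightarrow> real" where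
  "torsion_form p v x y = T p [v, x, y] - contraction p v x y"

lemma torsion_form_linear:
  assumes "u \<in> TS p" "v \<in> TS p" "x \<in> TS p" "y \<in> TS p"
  shows "torsion_form p (\<lambda>f. a * u f + b * v f) x y = a * torsion_form p u x y + b * torsion_form p v x y"
    and "torsion_form p x (\<lambda>f. a * u f + b * v f) y = a * torsion_form p x u y + b * torsion_form p x v y"
  using assms by (simp_all add: torsion_form_def T_linear contraction_linear_1 contraction_linear_2 algebra_simps)

lemma torsion_form_swap:
  assumes "x \<in> TS p" "y \<in> TS p" "z \<in> TS p"
  shows "torsion_form p x y z = - torsion_form p x z y"
  using T_swap(2)[OF assms] contraction_swap[OF assms] by (simp add: torsion_form_def)

lemma Dc_formula:
  assumes "vector_field A U Y" "p \<in> U" "x \<in> TS p" "z \<in> TS p"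
  shows "g p (Dc p x Y) z = g p (Dg p x Y) z + 1/2 * T p [x, Y p, z] + contraction p x (Y p) z"
proof -
  obtain e where e: "adapted_frame A g \<rho> p e" using frame_exists .
  show ?thesis
    using Dc_frame[OF assms e] contraction_frame[OF e assms(3) _ assms(4)]
      vector_fieldD(2)[OF assms(1,2)] by simp
qed

section \<open>\<open>Dc\<close> is a metric connection with torsion
  \<open>torsion_form\<close>\<close>

lemma Dg_affine: "affine_connection A Dg"
  using levi_civita by (simp add: levi_civita_def)

lemma Dg_in: "vector_field A U Y \<Longrightarrow> p \<in> U \<Longrightarrow> x \<in> TS p \<Longrightarrow> Dg p x Y \<in> TS p"
  and Dg_linear: "vector_field A U Y \<Longrightarrow> p \<in> U \<Longrightarrow> x \<in> TS p \<Longrightarrow> w \<in> TS p \<Longrightarrow>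
    Dg p (\<lambda>f. a * x f + b * w f) Y = (\<lambda>f. a * Dg p x Y f + b * Dg p w Y f)"
  and Dg_add: "vector_field A U Y \<Longrightarrow> vector_field A U Z \<Longrightarrow> p \<in> U \<Longrightarrow> x \<in> TS p \<Longrightarrow>
    Dg p x (\<lambda>q f. Y q f + Z q f) = (\<lambda>f. Dg p x Y f + Dg p x Z f)"
  and Dg_mult: "vector_field A U Y \<Longrightarrow> smooth_fun A U h \<Longrightarrow> p \<in> U \<Longrightarrow> x \<in> TS p \<Longrightarrow>
    Dg p x (\<lambda>q f. h q * Y q f) = (\<lambda>f. x h * Y p f + h p * Dg p x Y f)"
  and Dg_smooth: "vector_field A U X \<Longrightarrow> vector_field A U Y \<Longrightarrow> vector_field A U (\<lambda>p. Dg p (X p) Y)"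
  using Dg_affine unfolding affine_connection_def by blast+

lemma Dg_bracket: "vector_field A U X \<Longrightarrow> vector_field A U Y \<Longrightarrow> p \<in> U \<Longrightarrow>
    lie_bracket A X Y p = (\<lambda>f. Dg p (X p) Y f - Dg p (Y p) X f)"
  and Dg_metric: "vector_field A U X \<Longrightarrow> vector_field A U Y \<Longrightarrow> vector_field A U Z \<Longrightarrow> p \<in> U \<Longrightarrow>
    X p (\<lambda>q. g q (Y q) (Z q)) = g p (Dg p (X p) Y) (Z p) + g p (Y p) (Dg p (X p) Z)"
  using levi_civita unfolding levi_civita_def by auto

text \<open>The Levi-Civita connection is torsion free, so the bracket is a difference of two
  covariant derivatives, which are smooth fields.\<close>

lemma bracket_field:
  assumes X: "vector_field A U X" and Y: "vector_field A U Y"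
  shows "vector_field A U (lie_bracket A X Y)"
proof (rule vector_field_cong)
  show "vector_field A U (\<lambda>p f. Dg p (X p) Y f + - 1 * Dg p (Y p) X f)"
    by (intro vector_field_add vector_field_mult smooth_fun_const Dg_smooth X Y vector_fieldD(1)[OF X])
  show "(\<lambda>f. Dg p (X p) Y f + - 1 * Dg p (Y p) X f) = lie_bracket A X Y p" if "p \<in> U" for p
    using Dg_bracket[OF X Y that] by simp
qed

text \<open>\<open>Dc\<close> is known through its inner products with tangent vectors, hence the
  statement is paired with \<open>z\<close>.\<close>

lemma Dc_linear:
  assumes Y: "vector_field A U Y" and p: "p \<in> U" and x: "x \<in> TS p" "w \<in> TS p" "z \<in> TS p"
  shows "g p (Dc p (\<lambda>f. a * x f + b * w f) Y) z = a * g p (Dc p x Y) z + b * g p (Dc p w Y) z"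
  using tangent_space_linear[OF x(1,2), of a b] vector_fieldD(2)[OF Y p] x Dg_in[OF Y p]
  by (simp add: Dc_formula[OF Y p] Dg_linear[OF Y p] g_linear T_linear contraction_linear_1 algebra_simps)

text \<open>The difference is written with the factor \<open>- 1\<close> so that it is built from
  sums and multiples of fields by smooth functions, as in the later definition of
  \<open>torsion\<close>.\<close>

lemma Dc_add_diff:
  assumes X: "vector_field A U X" "vector_field A U Y" and p: "p \<in> U" and x: "x \<in> TS p" "z \<in> TS p"
  shows "g p (Dc p x (\<lambda>q f. X q f + - 1 * Y q f)) z = g p (Dc p x X) z - g p (Dc p x Y) z"
proof -
  have c: "smooth_fun A U (\<lambda>q. - 1)" using smooth_fun_const vector_fieldD(1)[OF X(1)] .
  have Y': "vector_field A U (\<lambda>q f. - 1 * Y q f)"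
    by (rule vector_field_mult[OF X(2) c])
  have XY: "vector_field A U (\<lambda>q f. X q f + - 1 * Y q f)"
    by (rule vector_field_add[OF X(1) Y'])
  have "Dg p x (\<lambda>q f. X q f + - 1 * Y q f) = (\<lambda>f. 1 * Dg p x X f + - 1 * Dg p x Y f)"
    using Dg_add[OF X(1) Y' p x(1)] Dg_mult[OF X(2) c p x(1)] tangent_const[OF x(1)] by simp
  then have "g p (Dg p x (\<lambda>q f. X q f + - 1 * Y q f)) z = g p (Dg p x X) z - g p (Dg p x Y) z"
    using g_linear[OF Dg_in[OF X(1) p x(1)] Dg_in[OF X(2) p x(1)] x(2), of 1 "- 1"] by simp
  then show ?thesis
    unfolding Dc_formula[OF XY p x] Dc_formula[OF X(1) p x] Dc_formula[OF X(2) p x]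
    using T_linear(2)[of "X p" p "Y p" x z 1 "- 1"] contraction_linear_2[of "X p" p "Y p" x z 1 "- 1"]
      vector_fieldD(2)[OF X(1) p] vector_fieldD(2)[OF X(2) p] x by simp
qed

text \<open>The two terms added to \<open>Dg\<close> are skew in their last two arguments and
  cancel.\<close>

lemma Dc_metric:
  assumes X: "vector_field A U X" and Y: "vector_field A U Y" and Z: "vector_field A U Z" and p: "p \<in> U"
  shows "X p (\<lambda>q. g q (Y q) (Z q)) = g p (Dc p (X p) Y) (Z p) + g p (Dc p (X p) Z) (Y p)"
proof -
  note t = vector_fieldD(2)[OF X p] vector_fieldD(2)[OF Y p] vector_fieldD(2)[OF Z p]
  show ?thesis
    using Dg_metric[OF X Y Z p] T_swap(2)[OF t] contraction_swap[OF t]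
      g_commute[OF t(2) Dg_in[OF Z p t(1)]]
    by (simp add: Dc_formula[OF Y p t(1,3)] Dc_formula[OF Z p t(1,2)])
qed

text \<open>The \<open>Dg\<close> terms cancel against the bracket, and the two halves of
  \<open>T\<close> add up. For the contraction, P(x; y, v) - P(y; x, v) = P(x; y, v) + P(y; v, x),
  which is -P(v; x, y) by \<open>contraction_cyclic\<close>.\<close>

lemma Dc_torsion:
  assumes X: "vector_field A U X" and Y: "vector_field A U Y" and p: "p \<in> U" and v: "v \<in> TS p"
  shows "g p (Dc p (X p) Y) v - g p (Dc p (Y p) X) v - g p (lie_bracket A X Y p) v =
    torsion_form p v (X p) (Y p)"
proof -
  note t = vector_fieldD(2)[OF X p] vector_fieldD(2)[OF Y p]
  have "g p (lie_bracket A X Y p) v = g p (Dg p (X p) Y) v - g p (Dg p (Y p) X) v"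
    using g_linear[OF Dg_in[OF Y p t(1)] Dg_in[OF X p t(2)] v, of 1 "- 1"]
    by (simp add: Dg_bracket[OF X Y p])
  then show ?thesis
    using T_swap(1)[OF t v] T_swap(2)[OF t(1,2) v] T_swap(1)[OF t(1) v t(2)]
      contraction_cyclic[OF t v] contraction_swap[OF t(2,1) v]
    by (simp add: Dc_formula[OF Y p t(1) v] Dc_formula[OF X p t(2) v] torsion_form_def)
qed

end

section \<open>Smoothness of \<open>Dc\<close> and parallelism of \<open>\<rho>\<close>\<close>

context psu3_manifold
begin

lemma form_smooth:
  assumes "differential_form A k \<omega>" "open U" "length Xs = k" "\<And>X. X \<in> set Xs \<Longrightarrow> vector_field A U X"
  shows "smooth_fun A U (\<lambda>p. \<omega> p (map (\<lambda>X. X p) Xs))"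
  using assms unfolding differential_form_def by blast

lemma contraction_smooth:
  assumes U: "open U" and E: "\<And>i. vector_field A U (E i)"
    "\<And>q. q \<in> U \<Longrightarrow> adapted_frame A g \<rho> q (\<lambda>i. E i q)"
    and X: "vector_field A U X" and Y: "vector_field A U Y" and Z: "vector_field A U Z"
  shows "smooth_fun A U (\<lambda>q. contraction q (X q) (Y q) (Z q))"
proof (rule smooth_fun_cong)
  have "smooth_fun A U (\<lambda>q. \<rho> q [X q, E a q, E b q])" for a b
    using form_smooth[OF form_rho U, of "[X, E a, E b]"] X E(1) by auto
  moreover have "smooth_fun A U (\<lambda>q. F q [E a q, E b q, Y q, Z q])" for a b
    using form_smooth[OF form_F U, of "[E a, E b, Y, Z]"] Y Z E(1) by auto
  ultimately show "smooth_fun A U (\<lambda>q. (1/2) * (\<Sum>a\<in>UNIV. \<Sum>b\<in>UNIV.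
      \<rho> q [X q, E a q, E b q] * F q [E a q, E b q, Y q, Z q]))"
    by (intro smooth_fun_mult smooth_fun_sum smooth_fun_const U)
  show "(1/2) * (\<Sum>a\<in>UNIV. \<Sum>b\<in>UNIV. \<rho> q [X q, E a q, E b q] * F q [E a q, E b q, Y q, Z q]) =
      contraction q (X q) (Y q) (Z q)" if "q \<in> U" for q
    using contraction_sum[OF E(2)[OF that] vector_fieldD(2)[OF X that]
      vector_fieldD(2)[OF Y that] vector_fieldD(2)[OF Z that]] by simp
qed

text \<open>Smoothness is local, so the field is rebuilt from its components in an adapted frame
  field; these are smooth by \<open>Dc_formula\<close>.\<close>

lemma Dc_smooth:
  assumes X: "vector_field A U X" and Y: "vector_field A U Y"
  shows "vector_field A U (\<lambda>q. Dc q (X q) Y)"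
proof (rule vector_field_local)
  show "open U" using vector_fieldD(1)[OF X] .
  fix p assume p: "p \<in> U"
  obtain U' E where U': "p \<in> U'" "open U'" "\<And>i. vector_field A U' (E i)"
    and E': "\<And>q. q \<in> U' \<Longrightarrow> adapted_frame A g \<rho> q (\<lambda>i. E i q)"
    using frame_field[of p] by metis
  define N where "N = U \<inter> U'"
  have N: "open N" "p \<in> N" "N \<subseteq> U" "N \<subseteq> U'"
    using U' p \<open>open U\<close> by (auto simp: N_def)
  have EN: "vector_field A N (E i)" for i using vector_field_subset[OF U'(3) N(1,4)] .
  have XN: "vector_field A N X" "vector_field A N Y"
    using vector_field_subset[OF X N(1,3)] vector_field_subset[OF Y N(1,3)] .
  have fr: "adapted_frame A g \<rho> q (\<lambda>i. E i q)" if "q \<in> N" for q using E' that N(4) by blast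
  have s: "smooth_fun A N (\<lambda>q. g q (Dc q (X q) Y) (E i q))" for i
  proof (rule smooth_fun_cong)
    show "smooth_fun A N (\<lambda>q. g q (Dg q (X q) Y) (E i q) + 1/2 * T q [X q, Y q, E i q]
        + contraction q (X q) (Y q) (E i q))"
      using form_smooth[OF form_T N(1), of "[X, Y, E i]"] XN EN
      by (intro smooth_fun_add smooth_fun_mult smooth_fun_const g_smooth Dg_smooth
          contraction_smooth[OF N(1) EN fr] N(1)) auto
  qed (simp add: Dc_formula[OF XN(2) _ vector_fieldD(2)[OF XN(1)] vector_fieldD(2)[OF EN]])
  have "vector_field A N (\<lambda>q f. \<Sum>i\<in>UNIV. g q (Dc q (X q) Y) (E i q) * E i q f)"
    by (intro vector_field_sum vector_field_mult s EN N(1))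
  then have "vector_field A N (\<lambda>q. Dc q (X q) Y)"
  proof (rule vector_field_cong)
    fix q assume q: "q \<in> N"
    have "Dc q (X q) Y \<in> TS q" using Dc_in[OF XN(2) q vector_fieldD(2)[OF XN(1) q]] .
    from frame_vec_vec_in[OF fr[OF q] this]
    show "(\<lambda>f. \<Sum>i\<in>UNIV. g q (Dc q (X q) Y) (E i q) * E i q f) = Dc q (X q) Y"
      by (simp add: frame_vec_def vec_in_def)
  qed
  then show "\<exists>N. p \<in> N \<and> vector_field A N (\<lambda>q. Dc q (X q) Y)" using N(2) by blast
qed

text \<open>The connection form of \<open>Dc\<close> is orthogonal to \<open>Lam2_20\<close>, so it takes values in the stabiliser
  algebra of \<open>rho0\<close>.\<close>

lemma Dc_connection_form:
  assumes U: "p \<in> U" "open U" "\<And>i. vector_field A U (E i)"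
    and E: "\<And>q. q \<in> U \<Longrightarrow> adapted_frame A g \<rho> q (\<lambda>i. E i q)"
    and torsion: "intrinsic_torsion g Dg E p =
      Theta1 (form_in 3 (\<lambda>i. E i p) (T p)) + Theta2 (form_in 4 (\<lambda>i. E i p) (F p))"
    and x: "x \<in> TS p"
  obtains c where "\<And>i j. g p (Dc p x (E i)) (E j p) = form_eval (hook c rho0) [unit8 i, unit8 j]"
proof -
  let ?e = "\<lambda>i. E i p"
  let ?t = "form_in 3 ?e (T p)" and ?\<phi> = "form_in 4 ?e (F p)"
  have e: "adapted_frame A g \<rho> p ?e" using E U(1) by blast
  have eT: "E i p \<in> TS p" for i using frame_in[OF e] .
  have swap: "form_eval \<alpha> [u, v] = - form_eval \<alpha> [v, u]" for \<alpha> u v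
    using form_eval_swap[of \<alpha> "[]" u v "[]"] by simp
  have "\<exists>c. \<forall>i j. g p (Dc p (E k p) (E i)) (E j p) = form_eval (hook c rho0) [unit8 i, unit8 j]" for k
  proof -
    define \<omega> where "\<omega> = connection_form g Dg E p $ k"
    define h where "h = sigma 2 (hook_e k rho0) ?\<phi>"
    have entry: "form_eval \<omega> [unit8 i, unit8 j] = g p (Dg p (E k p) (E i)) (E j p)" if "prec i j" for i j
    proof -
      have "\<omega> $ {i, j} = (\<Sum>r\<in>{(i, j). prec i j}.
          if r = (i, j) then g p (Dg p (E k p) (E i)) (E j p) else 0)"
        unfolding \<omega>_def connection_form_def vec_lambda_beta sum_component
      proof (rule sum.cong)
        fix r assume "r \<in> {(i, j). prec i j}"
        moreover have "{i, j} = {i', j'} \<longleftrightarrow> (i', j') = (i, j)" if "prec i' j'" for i' j'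
          using that \<open>prec i j\<close> prec_antisym by (auto simp: doubleton_eq_iff)
        ultimately show "(case r of (i, j) \<Rightarrow> g p (Dg p (E k p) (E i)) (E j p) *\<^sub>R eb {i, j}) $ {i, j} =
          (if r = (i, j) then g p (Dg p (E k p) (E i)) (E j p) else 0)"
          by (auto simp: eb_def axis_def split: prod.split)
      qed simp
      also have "\<dots> = g p (Dg p (E k p) (E i)) (E j p)"
        using that by simp
      finally show ?thesis using form_eval_incr[of \<omega> "{i, j}"] that by (simp add: incr_pair)
    qed
    \<comment> \<open>Differentiate the constant functions g(E_i, E_j). This extends the
      coefficients of \<open>\<omega>\<close>, defined for increasing pairs only, to all pairs of
      indices.\<close>
    have skew: "g p (Dg p (E k p) (E i)) (E j p) = - g p (Dg p (E k p) (E j)) (E i p)" for i j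
    proof -
      have "E k p (\<lambda>q. g q (E i q) (E j q)) = E k p (\<lambda>q. if i = j then 1 else 0)"
        by (rule tangent_cong[OF eT U(2,1)]) (simp add: frame_orthonormal[OF E])
      then have "E k p (\<lambda>q. g q (E i q) (E j q)) = 0" using tangent_const[OF eT] by simp
      then show ?thesis
        using Dg_metric[OF U(3) U(3) U(3) U(1), of k i j] g_commute[OF eT Dg_in[OF U(3) U(1) eT], of i k j]
        by simp
    qed
    have \<omega>: "form_eval \<omega> [unit8 i, unit8 j] = g p (Dg p (E k p) (E i)) (E j p)" for i j
    proof (cases "i = j")
      case True
      then show ?thesis using skew[of i i] swap[of \<omega> "unit8 i" "unit8 i"] by simp
    next
      case False
      then show ?thesis
        using entry prec_total[OF False] skew[of i j] swap[of \<omega> "unit8 i" "unit8 j"] by auto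
    qed
    have "eb {i, j} \<in> Lam 2" if "prec i j" for i j
      using Lam_eb[of "{i, j}"] that prec_irrefl[of i] by (auto simp: numeral_2_eq_2 card_insert_if split: if_splits)
    then have "\<omega> \<in> Lam 2"
      unfolding \<omega>_def connection_form_def vec_lambda_beta
      by (intro subspace_sum subspace_Lam) (auto intro!: subspace_scale subspace_Lam)
    moreover have "hook_e k ?t \<in> Lam 2" "h \<in> Lam 2"
      unfolding h_def
      by (intro Lam_sigma_2 Lam_hook_e_numeral form_in_Lam rho0_Lam)+
    ultimately have L: "\<omega> + (1/2) *\<^sub>R hook_e k ?t + h \<in> Lam 2"
      by (intro subspace_add subspace_scale subspace_Lam)
    \<comment> \<open>The sum of these three 2-forms is the connection form of \<open>Dc\<close> in
      the direction \<open>E k\<close>; its projection vanishes by the signs in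
      \<open>Theta1\<close> and \<open>Theta2\<close>.\<close>
    have pr: "pr_m \<omega> + (1/2) *\<^sub>R pr_m (hook_e k ?t) + pr_m h = 0"
      using arg_cong[OF torsion, of "\<lambda>B. B $ k"]
      by (simp add: intrinsic_torsion_def Theta1_def Theta2_def \<omega>_def h_def)
    have "orthogonal (\<omega> + (1/2) *\<^sub>R hook_e k ?t + h) \<zeta>" if "\<zeta> \<in> Lam2_20" for \<zeta>
    proof -
      have "inner (\<omega> + (1/2) *\<^sub>R hook_e k ?t + h) \<zeta> =
          inner (pr_m \<omega> + (1/2) *\<^sub>R pr_m (hook_e k ?t) + pr_m h) \<zeta>"
        using pr_m_orthogonal[OF that, of \<omega>] pr_m_orthogonal[OF that, of "hook_e k ?t"]
          pr_m_orthogonal[OF that, of h]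
        by (simp add: orthogonal_def inner_diff_left inner_add_left)
      then show ?thesis unfolding pr by (simp add: orthogonal_def)
    qed
    then obtain c where c: "\<omega> + (1/2) *\<^sub>R hook_e k ?t + h = hook c rho0"
      using orthogonal_Lam2_20[OF L] by blast
    have "g p (Dc p (E k p) (E i)) (E j p) = form_eval (hook c rho0) [unit8 i, unit8 j]" for i j
    proof -
      have "contraction p (E k p) (E i p) (E j p) = form_eval h [unit8 i, unit8 j]"
        unfolding contraction_frame[OF e eT eT eT] frame_contraction_def h_def
        by (simp add: vec_in_frame[OF e] frame_rho[OF e] hook_unit8)
      moreover have "T p [E k p, E i p, E j p] = form_eval (hook_e k ?t) [unit8 i, unit8 j]"
        using form_eval_vec_in[OF alternating_T e, of "[E k p, E i p, E j p]"] eT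
        by (simp add: vec_in_frame[OF e] form_eval_Cons[of ?t] hook_unit8)
      ultimately show ?thesis
        by (simp add: Dc_formula[OF U(3) U(1) eT eT] \<omega> c[symmetric] form_eval_simps)
    qed
    then show ?thesis by blast
  qed
  then obtain C where C: "g p (Dc p (E k p) (E i)) (E j p) =
      form_eval (hook (C k) rho0) [unit8 i, unit8 j]" for k i j by metis
  \<comment> \<open>An arbitrary direction is expanded in the frame, and the vectors
    \<open>C k\<close> combine with the same coefficients.\<close>
  have "g p (Dc p x (E i)) (E j p) =
      form_eval (hook (\<Sum>k\<in>UNIV. g p x (E k p) *\<^sub>R C k) rho0) [unit8 i, unit8 j]" for i j
    using linear_expand[OF e x, of "\<lambda>x. g p (Dc p x (E i)) (E j p)"] Dc_linear[OF U(3) U(1)] eT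
    by (simp add: C hook_left_simps form_eval_simps)
  then show ?thesis by (rule that)
qed

lemma tangent_product3:
  assumes x: "x \<in> TS p" and "smooth_near A p u" "smooth_near A p v" "smooth_near A p w"
  shows "x (\<lambda>q. (u q * (v q * w q)) * c) =
    (x u * (v p * w p)) * c + (u p * (x v * w p)) * c + (u p * (v p * x w)) * c"
proof -
  have vw: "smooth_near A p (\<lambda>q. v q * w q)" by (rule smooth_near_mult[OF assms(3,4)])
  show ?thesis
    using tangent_mult[OF x smooth_near_mult[OF assms(2) vw] smooth_near_const, of c]
      tangent_mult[OF x assms(2) vw] tangent_mult[OF x assms(3,4)] tangent_const[OF x]
    by (simp add: algebra_simps)
qed

text \<open>In an adapted frame field \<open>\<rho>\<close> has the constant coefficients of
  \<open>rho0\<close>, so only the coordinates of the arguments are differentiated. The derivative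
  of the coordinates of a field consists of the coordinates of its covariant derivative minus an
  \<open>L\<close> term from the motion of the frame. By \<open>form_eval_rho0_derivation\<close>
  the three \<open>L\<close> terms add up to 0.\<close>

lemma Dc_rho:
  assumes X: "vector_field A U X" and Y: "vector_field A U Y1" "vector_field A U Y2" "vector_field A U Y3"
    and p: "p \<in> U"
  shows "X p (\<lambda>q. \<rho> q [Y1 q, Y2 q, Y3 q]) = \<rho> p [Dc p (X p) Y1, Y2 p, Y3 p]
    + \<rho> p [Y1 p, Dc p (X p) Y2, Y3 p] + \<rho> p [Y1 p, Y2 p, Dc p (X p) Y3]"
proof -
  have x: "X p \<in> TS p" using vector_fieldD(2)[OF X p] .
  obtain U' E where U': "p \<in> U'" "open U'" "\<And>i. vector_field A U' (E i)"
    and E': "\<And>q. q \<in> U' \<Longrightarrow> adapted_frame A g \<rho> q (\<lambda>i. E i q)"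
    and tors: "intrinsic_torsion g Dg E p =
      Theta1 (form_in 3 (\<lambda>i. E i p) (T p)) + Theta2 (form_in 4 (\<lambda>i. E i p) (F p))"
    using type_at[of p] by metis
  obtain c where c: "\<And>i j. g p (Dc p (X p) (E i)) (E j p) = form_eval (hook c rho0) [unit8 i, unit8 j]"
    using Dc_connection_form[OF U' E' tors x] by metis
  define N where "N = U \<inter> U'"
  have N: "open N" "p \<in> N" "N \<subseteq> U" "N \<subseteq> U'"
    using U' p vector_fieldD(1)[OF X] by (auto simp: N_def)
  have EN: "vector_field A N (E i)" for i using vector_field_subset[OF U'(3) N(1,4)] .
  have YN: "vector_field A N Y1" "vector_field A N Y2" "vector_field A N Y3" "vector_field A N X"
    using vector_field_subset[OF Y(1) N(1,3)] vector_field_subset[OF Y(2) N(1,3)]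
      vector_field_subset[OF Y(3) N(1,3)] vector_field_subset[OF X N(1,3)] .
  have fr: "adapted_frame A g \<rho> q (\<lambda>i. E i q)" if "q \<in> N" for q using E' that N(4) by blast
  let ?e = "\<lambda>i. E i p"
  have e: "adapted_frame A g \<rho> p ?e" using fr N(2) by blast
  let ?v = "\<lambda>q. vec_in (g q) (\<lambda>i. E i q)"
  have \<rho>: "\<rho> q [y, z, w] = form_eval rho0 [?v q y, ?v q z, ?v q w]"
    if "q \<in> N" "y \<in> TS q" "z \<in> TS q" "w \<in> TS q" for q y z w
    using form_eval_vec_in[OF alternating_rho fr[OF that(1)], of "[y, z, w]"] that
    by (simp add: frame_rho[OF fr[OF that(1)]])
  define L where "L = (\<lambda>y. \<Sum>d\<in>UNIV. form_eval (hook c rho0) [y, unit8 d] *\<^sub>R unit8 d)"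
  have near: "smooth_near A p (\<lambda>q. ?v q (Y q) $ a)"
    and der: "X p (\<lambda>q. ?v q (Y q) $ a) = (?v p (Dc p (X p) Y) - L (?v p (Y p))) $ a"
    if Y: "vector_field A N Y" for Y a
  proof -
    show "smooth_near A p (\<lambda>q. ?v q (Y q) $ a)"
      using g_smooth[OF Y EN] N(2) unfolding smooth_near_def vec_in_def by auto
    have y: "Y p \<in> TS p" using vector_fieldD(2)[OF Y N(2)] .
    have De: "Dc p (X p) (E a) \<in> TS p" using Dc_in[OF EN N(2) x] .
    have "X p (\<lambda>q. ?v q (Y q) $ a) = g p (Dc p (X p) Y) (E a p) + g p (Dc p (X p) (E a)) (Y p)"
      using Dc_metric[OF YN(4) Y EN N(2), of a] by (simp add: vec_in_def)
    \<comment> \<open>The derivative of \<open>E a\<close> is read off from \<open>c\<close>;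
      exchanging the arguments of the 2-form gives the minus sign.\<close>
    moreover have "g p (Dc p (X p) (E a)) (Y p) = - L (?v p (Y p)) $ a"
    proof -
      have "g p (Dc p (X p) (E a)) (Y p) = g p (Y p) (Dc p (X p) (E a))"
        by (rule g_commute[OF De y])
      also have "\<dots> = (\<Sum>i\<in>UNIV. g p (Y p) (E i p) * g p (E i p) (Dc p (X p) (E a)))"
        using linear_expand[OF e y, of "\<lambda>u. g p u (Dc p (X p) (E a))"] g_linear De by blast
      also have "\<dots> = (\<Sum>i\<in>UNIV. ?v p (Y p) $ i * form_eval (hook c rho0) [unit8 a, unit8 i])"
        using g_commute[OF frame_in[OF e] De] by (simp add: c vec_in_def)
      also have "\<dots> = form_eval (hook c rho0) [unit8 a, ?v p (Y p)]"
        using form_eval_sum_slot[of "hook c rho0" "[unit8 a]" "?v p (Y p)" "[]"] by simp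
      also have "\<dots> = - form_eval (hook c rho0) [?v p (Y p), unit8 a]"
        using form_eval_swap[of "hook c rho0" "[]" "unit8 a" "?v p (Y p)" "[]"] by simp
      also have "\<dots> = - L (?v p (Y p)) $ a"
        by (simp add: L_def unit8_def axis_def if_distrib[of "\<lambda>x. _ * x"] cong: if_cong)
      finally show ?thesis .
    qed
    ultimately show "X p (\<lambda>q. ?v q (Y q) $ a) = (?v p (Dc p (X p) Y) - L (?v p (Y p))) $ a"
      by (simp add: vec_in_def)
  qed
  have deriv: "form_eval rho0 [L y, z, w] + form_eval rho0 [y, L z, w] + form_eval rho0 [y, z, L w] = 0"
    for y z w unfolding L_def by (rule form_eval_rho0_derivation)
  note near = near[OF YN(1)] near[OF YN(2)] near[OF YN(3)]
  note der = der[OF YN(1)] der[OF YN(2)] der[OF YN(3)]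
  let ?r = "\<lambda>a b c. form_eval rho0 [unit8 a, unit8 b, unit8 c]"
  have "X p (\<lambda>q. \<rho> q [Y1 q, Y2 q, Y3 q]) = X p (\<lambda>q. \<Sum>a\<in>UNIV. \<Sum>b\<in>UNIV. \<Sum>c\<in>UNIV.
      (?v q (Y1 q) $ a * (?v q (Y2 q) $ b * ?v q (Y3 q) $ c)) * ?r a b c)"
    by (rule tangent_cong[OF x N(1,2)])
      (simp only: \<rho> vector_fieldD(2)[OF YN(1)] vector_fieldD(2)[OF YN(2)] vector_fieldD(2)[OF YN(3)]
        form_eval_3_sum[of _ "?v _ _"])
  also have "\<dots> = (\<Sum>a\<in>UNIV. \<Sum>b\<in>UNIV. \<Sum>c\<in>UNIV. X p (\<lambda>q.
      (?v q (Y1 q) $ a * (?v q (Y2 q) $ b * ?v q (Y3 q) $ c)) * ?r a b c))"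
    by (simp only: tangent_sum[OF x] smooth_near_sum smooth_near_mult smooth_near_const near)
  also have "\<dots> = form_eval rho0 [?v p (Dc p (X p) Y1) - L (?v p (Y1 p)), ?v p (Y2 p), ?v p (Y3 p)]
      + form_eval rho0 [?v p (Y1 p), ?v p (Dc p (X p) Y2) - L (?v p (Y2 p)), ?v p (Y3 p)]
      + form_eval rho0 [?v p (Y1 p), ?v p (Y2 p), ?v p (Dc p (X p) Y3) - L (?v p (Y3 p))]"
    by (simp only: tangent_product3[OF x near(1) near(2) near(3)] der sum.distrib
        form_eval_3_sum[of _ _ "?v p (Y2 p)"] form_eval_3_sum[of _ _ "_ - _"])
  also have "\<dots> = form_eval rho0 [?v p (Dc p (X p) Y1), ?v p (Y2 p), ?v p (Y3 p)]
      + form_eval rho0 [?v p (Y1 p), ?v p (Dc p (X p) Y2), ?v p (Y3 p)]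
      + form_eval rho0 [?v p (Y1 p), ?v p (Y2 p), ?v p (Dc p (X p) Y3)]"
    using deriv[of "?v p (Y1 p)" "?v p (Y2 p)" "?v p (Y3 p)"]
      linear_diff[OF linear_form_eval_slot, of rho0 "[]"]
      linear_diff[OF linear_form_eval_slot, of rho0 "[?v p (Y1 p)]"]
      linear_diff[OF linear_form_eval_slot, of rho0 "[?v p (Y1 p), ?v p (Y2 p)]"]
    by simp
  finally show ?thesis
    using N(2) x Dc_in[OF YN(1) N(2) x] Dc_in[OF YN(2) N(2) x] Dc_in[OF YN(3) N(2) x]
      vector_fieldD(2)[OF YN(1) N(2)] vector_fieldD(2)[OF YN(2) N(2)] vector_fieldD(2)[OF YN(3) N(2)]
    by (simp add: \<rho>)
qed

end

section \<open>Parallel characteristic torsion\<close>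

text \<open>Contraction over an orthonormal frame commutes with a metric connection: with
  \<open>w\<close> the skew matrix of the derivative of the frame, the contributions of the two
  copies of a contracted index cancel.\<close>

lemma skew_sum_zero:
  fixes w :: "'i::finite \<Rightarrow> 'i \<Rightarrow> real"
  assumes "\<And>a c. w a c = - w c a"
  shows "(\<Sum>a\<in>UNIV. (\<Sum>c\<in>UNIV. w a c * h c) * k a) + (\<Sum>a\<in>UNIV. h a * (\<Sum>c\<in>UNIV. w a c * k c)) = 0"
proof -
  have "(\<Sum>a\<in>UNIV. (\<Sum>c\<in>UNIV. w a c * h c) * k a) = (\<Sum>a\<in>UNIV. \<Sum>c\<in>UNIV. w a c * h c * k a)"
    by (simp add: sum_distrib_right)
  also have "\<dots> = (\<Sum>a\<in>UNIV. \<Sum>c\<in>UNIV. w c a * h a * k c)" by (rule sum.swap)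
  also have "\<dots> = (\<Sum>a\<in>UNIV. \<Sum>c\<in>UNIV. - (h a * (w a c * k c)))"
    by (intro sum.cong refl) (subst assms, simp)
  also have "\<dots> = - (\<Sum>a\<in>UNIV. h a * (\<Sum>c\<in>UNIV. w a c * k c))"
    by (simp add: sum_negf sum_distrib_left)
  finally show ?thesis by simp
qed

locale psu3_parallel = psu3_manifold A g \<rho> T F Dg Dc
  for A :: "'m::{t2_space,second_countable_topology} atlas" and g \<rho> T F Dg Dc +
  assumes parallel_T: "parallel_form A Dc 3 T"
    and parallel_F: "parallel_form A Dc 4 F"
begin

lemma Dc_T:
  assumes "vector_field A U X" "vector_field A U Y1" "vector_field A U Y2" "vector_field A U Y3" "p \<in> U"
  shows "X p (\<lambda>q. T q [Y1 q, Y2 q, Y3 q]) = T p [Dc p (X p) Y1, Y2 p, Y3 p]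
    + T p [Y1 p, Dc p (X p) Y2, Y3 p] + T p [Y1 p, Y2 p, Dc p (X p) Y3]"
proof -
  have "X p (\<lambda>q. T q (map (\<lambda>Y. Y q) [Y1, Y2, Y3])) = (\<Sum>j<3. T p ((map (\<lambda>Y. Y p) [Y1, Y2, Y3])
      [j := Dc p (X p) ([Y1, Y2, Y3] ! j)]))"
    using parallel_T[unfolded parallel_form_def, rule_format, of U X "[Y1, Y2, Y3]" p] assms by auto
  then show ?thesis by (simp add: eval_nat_numeral)
qed

lemma Dc_F:
  assumes "vector_field A U X" "vector_field A U Y1" "vector_field A U Y2" "vector_field A U Y3"
    "vector_field A U Y4" "p \<in> U"
  shows "X p (\<lambda>q. F q [Y1 q, Y2 q, Y3 q, Y4 q]) = F p [Dc p (X p) Y1, Y2 p, Y3 p, Y4 p]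
    + F p [Y1 p, Dc p (X p) Y2, Y3 p, Y4 p] + F p [Y1 p, Y2 p, Dc p (X p) Y3, Y4 p]
    + F p [Y1 p, Y2 p, Y3 p, Dc p (X p) Y4]"
proof -
  have "X p (\<lambda>q. F q (map (\<lambda>Y. Y q) [Y1, Y2, Y3, Y4])) =
      (\<Sum>j<4. F p ((map (\<lambda>Y. Y p) [Y1, Y2, Y3, Y4])[j := Dc p (X p) ([Y1, Y2, Y3, Y4] ! j)]))"
    using parallel_F[unfolded parallel_form_def, rule_format, of U X "[Y1, Y2, Y3, Y4]" p] assms
    by auto
  then show ?thesis by (simp add: eval_nat_numeral)
qed

text \<open>Differentiate the frame sum by the Leibniz rule, using that \<open>\<rho>\<close> and
  \<open>F\<close> are parallel. Besides the three wanted terms there are four with derivatives of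
  frame vectors; they cancel in pairs, one pair for each of the two contracted indices
  (\<open>Z1\<close> and \<open>Z2\<close>).\<close>

lemma Dc_contraction:
  assumes X: "vector_field A U X" and V: "vector_field A U V" and Y: "vector_field A U Y"
    and Z: "vector_field A U Z" and p: "p \<in> U"
  shows "X p (\<lambda>q. contraction q (V q) (Y q) (Z q)) = contraction p (Dc p (X p) V) (Y p) (Z p)
    + contraction p (V p) (Dc p (X p) Y) (Z p) + contraction p (V p) (Y p) (Dc p (X p) Z)"
proof -
  have x: "X p \<in> TS p" using vector_fieldD(2)[OF X p] .
  obtain U' E where U': "p \<in> U'" "open U'" "\<And>i. vector_field A U' (E i)"
    and E': "\<And>q. q \<in> U' \<Longrightarrow> adapted_frame A g \<rho> q (\<lambda>i. E i q)"
    using frame_field[of p] by metis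
  define N where "N = U \<inter> U'"
  have N: "open N" "p \<in> N" "N \<subseteq> U" "N \<subseteq> U'"
    using U' p vector_fieldD(1)[OF X] by (auto simp: N_def)
  have EN: "vector_field A N (E i)" for i using vector_field_subset[OF U'(3) N(1,4)] .
  have YN: "vector_field A N V" "vector_field A N Y" "vector_field A N Z" "vector_field A N X"
    using vector_field_subset[OF V N(1,3)] vector_field_subset[OF Y N(1,3)]
      vector_field_subset[OF Z N(1,3)] vector_field_subset[OF X N(1,3)] .
  have fr: "adapted_frame A g \<rho> q (\<lambda>i. E i q)" if "q \<in> N" for q using E' that N(4) by blast
  let ?e = "\<lambda>i. E i p" and ?D = "Dc p (X p)"
  have e: "adapted_frame A g \<rho> p ?e" using fr N(2) by blast
  have t: "V p \<in> TS p" "Y p \<in> TS p" "Z p \<in> TS p" "E i p \<in> TS p" for i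
    using vector_fieldD(2)[OF YN(1) N(2)] vector_fieldD(2)[OF YN(2) N(2)]
      vector_fieldD(2)[OF YN(3) N(2)] vector_fieldD(2)[OF EN N(2)] .
  have D: "?D V \<in> TS p" "?D Y \<in> TS p" "?D Z \<in> TS p" "?D (E i) \<in> TS p" for i
    using Dc_in[OF YN(1) N(2) x] Dc_in[OF YN(2) N(2) x] Dc_in[OF YN(3) N(2) x] Dc_in[OF EN N(2) x] .
  define w where "w = (\<lambda>a c. g p (?D (E a)) (E c p))"
  have skew: "w a c = - w c a" for a c
  proof -
    have "X p (\<lambda>q. g q (E a q) (E c q)) = X p (\<lambda>q. if a = c then 1 else 0)"
      by (rule tangent_cong[OF x N(1,2)]) (simp add: frame_orthonormal[OF fr])
    then show ?thesis
      using Dc_metric[OF YN(4) EN EN N(2), of a c] tangent_const[OF x] by (simp add: w_def)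
  qed
  let ?R = "\<lambda>q a b. \<rho> q [V q, E a q, E b q]" and ?F = "\<lambda>q a b. F q [E a q, E b q, Y q, Z q]"
  have near: "smooth_near A p (\<lambda>q. ?R q a b)" "smooth_near A p (\<lambda>q. ?F q a b)" for a b
    using form_smooth[OF form_rho N(1), of "[V, E a, E b]"] form_smooth[OF form_F N(1), of "[E a, E b, Y, Z]"]
      YN EN N(2) by (auto simp: smooth_near_def)
  have exp_rho: "\<rho> p [V p, ?D (E a), E b p] = (\<Sum>c\<in>UNIV. w a c * ?R p c b)"
    "\<rho> p [V p, E b p, ?D (E a)] = (\<Sum>c\<in>UNIV. w a c * ?R p b c)" for a b
    using linear_expand[OF e D(4), of "\<lambda>u. \<rho> p [V p, u, E b p]" a]
      linear_expand[OF e D(4), of "\<lambda>u. \<rho> p [V p, E b p, u]" a]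
      alternating_form_linear[OF alternating_rho, of "[V p]" "[E b p]" p]
      alternating_form_linear[OF alternating_rho, of "[V p, E b p]" "[]" p] t
    by (simp_all add: w_def)
  have exp_F: "F p [?D (E a), E b p, Y p, Z p] = (\<Sum>c\<in>UNIV. w a c * ?F p c b)"
    "F p [E b p, ?D (E a), Y p, Z p] = (\<Sum>c\<in>UNIV. w a c * ?F p b c)" for a b
    using linear_expand[OF e D(4), of "\<lambda>u. F p [u, E b p, Y p, Z p]" a]
      linear_expand[OF e D(4), of "\<lambda>u. F p [E b p, u, Y p, Z p]" a]
      alternating_form_linear[OF alternating_F, of "[]" "[E b p, Y p, Z p]" p]
      alternating_form_linear[OF alternating_F, of "[E b p]" "[Y p, Z p]" p] t
    by (simp_all add: w_def)
  have z1: "(\<Sum>a\<in>UNIV. \<rho> p [V p, ?D (E a), E b p] * ?F p a b)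
      + (\<Sum>a\<in>UNIV. ?R p a b * F p [?D (E a), E b p, Y p, Z p]) = 0" for b
    unfolding exp_rho exp_F by (rule skew_sum_zero[OF skew])
  have z2: "(\<Sum>b\<in>UNIV. \<rho> p [V p, E a p, ?D (E b)] * ?F p a b)
      + (\<Sum>b\<in>UNIV. ?R p a b * F p [E a p, ?D (E b), Y p, Z p]) = 0" for a
    unfolding exp_rho exp_F by (rule skew_sum_zero[OF skew])
  have "(\<Sum>a\<in>UNIV. \<Sum>b\<in>UNIV. \<rho> p [V p, ?D (E a), E b p] * ?F p a b)
      + (\<Sum>a\<in>UNIV. \<Sum>b\<in>UNIV. ?R p a b * F p [?D (E a), E b p, Y p, Z p])
      = (\<Sum>b\<in>UNIV. (\<Sum>a\<in>UNIV. \<rho> p [V p, ?D (E a), E b p] * ?F p a b)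
      + (\<Sum>a\<in>UNIV. ?R p a b * F p [?D (E a), E b p, Y p, Z p]))"
    by (subst (1 2) sum.swap) (simp add: sum.distrib)
  also have "\<dots> = 0" by (simp add: z1)
  finally have Z1: "(\<Sum>a\<in>UNIV. \<Sum>b\<in>UNIV. \<rho> p [V p, ?D (E a), E b p] * ?F p a b)
      + (\<Sum>a\<in>UNIV. \<Sum>b\<in>UNIV. ?R p a b * F p [?D (E a), E b p, Y p, Z p]) = 0" .
  have "(\<Sum>a\<in>UNIV. \<Sum>b\<in>UNIV. \<rho> p [V p, E a p, ?D (E b)] * ?F p a b)
      + (\<Sum>a\<in>UNIV. \<Sum>b\<in>UNIV. ?R p a b * F p [E a p, ?D (E b), Y p, Z p])
      = (\<Sum>a\<in>UNIV. (\<Sum>b\<in>UNIV. \<rho> p [V p, E a p, ?D (E b)] * ?F p a b)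
      + (\<Sum>b\<in>UNIV. ?R p a b * F p [E a p, ?D (E b), Y p, Z p]))"
    by (simp add: sum.distrib)
  also have "\<dots> = 0" by (simp add: z2)
  finally have Z2: "(\<Sum>a\<in>UNIV. \<Sum>b\<in>UNIV. \<rho> p [V p, E a p, ?D (E b)] * ?F p a b)
      + (\<Sum>a\<in>UNIV. \<Sum>b\<in>UNIV. ?R p a b * F p [E a p, ?D (E b), Y p, Z p]) = 0" .
  have "X p (\<lambda>q. contraction q (V q) (Y q) (Z q)) =
      X p (\<lambda>q. (1/2) * (\<Sum>a\<in>UNIV. \<Sum>b\<in>UNIV. ?R q a b * ?F q a b))"
    by (rule tangent_cong[OF x N(1,2)])
      (rule contraction_sum[OF fr vector_fieldD(2)[OF YN(1)] vector_fieldD(2)[OF YN(2)]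
          vector_fieldD(2)[OF YN(3)]])
  also have "\<dots> = (1/2) * (\<Sum>a\<in>UNIV. \<Sum>b\<in>UNIV. X p (\<lambda>q. ?R q a b * ?F q a b))"
    by (simp only: tangent_cmult[OF x] tangent_sum[OF x] smooth_near_sum smooth_near_mult near)
  also have "\<dots> = (1/2) * (\<Sum>a\<in>UNIV. \<Sum>b\<in>UNIV.
      \<rho> p [?D V, E a p, E b p] * ?F p a b
      + ?R p a b * F p [E a p, E b p, ?D Y, Z p] + ?R p a b * F p [E a p, E b p, Y p, ?D Z]
      + \<rho> p [V p, ?D (E a), E b p] * ?F p a b + ?R p a b * F p [?D (E a), E b p, Y p, Z p]
      + \<rho> p [V p, E a p, ?D (E b)] * ?F p a b + ?R p a b * F p [E a p, ?D (E b), Y p, Z p])"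
    by (simp only: tangent_mult[OF x near(1) near(2)] Dc_rho[OF YN(4,1) EN EN N(2)]
        Dc_F[OF YN(4) EN EN YN(2,3) N(2)])
      (simp add: algebra_simps)
  also have "\<dots> = contraction p (?D V) (Y p) (Z p)
    + contraction p (V p) (?D Y) (Z p) + contraction p (V p) (Y p) (?D Z)"
    using Z1 Z2
    by (simp only: contraction_sum[OF e] D t sum.distrib) (simp add: algebra_simps)
  finally show ?thesis .
qed

lemma Dc_torsion_form:
  assumes X: "vector_field A U X" and V: "vector_field A U V" and Y: "vector_field A U Y"
    and Z: "vector_field A U Z" and p: "p \<in> U"
  shows "X p (\<lambda>q. torsion_form q (V q) (Y q) (Z q)) = torsion_form p (Dc p (X p) V) (Y p) (Z p)
    + torsion_form p (V p) (Dc p (X p) Y) (Z p) + torsion_form p (V p) (Y p) (Dc p (X p) Z)"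
proof -
  have x: "X p \<in> TS p" using vector_fieldD(2)[OF X p] .
  obtain U' E where U': "p \<in> U'" "open U'" "\<And>i. vector_field A U' (E i)"
    and E': "\<And>q. q \<in> U' \<Longrightarrow> adapted_frame A g \<rho> q (\<lambda>i. E i q)"
    using frame_field[of p] by metis
  have N: "open (U \<inter> U')" "U \<inter> U' \<subseteq> U" "U \<inter> U' \<subseteq> U'"
    using U' vector_fieldD(1)[OF X] by auto
  have "smooth_fun A (U \<inter> U') (\<lambda>q. contraction q (V q) (Y q) (Z q))"
    by (rule contraction_smooth[OF N(1) vector_field_subset[OF U'(3) N(1,3)] E'])
      (use vector_field_subset N V Y Z in auto)
  then have P: "smooth_near A p (\<lambda>q. contraction q (V q) (Y q) (Z q))"
    using p U'(1) by (auto simp: smooth_near_def)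
  have T: "smooth_near A p (\<lambda>q. T q [V q, Y q, Z q])"
    using form_smooth[OF form_T vector_fieldD(1)[OF X], of "[V, Y, Z]"] V Y Z p
    by (auto simp: smooth_near_def)
  have "X p (\<lambda>q. torsion_form q (V q) (Y q) (Z q)) =
      X p (\<lambda>q. T q [V q, Y q, Z q] + - 1 * contraction q (V q) (Y q) (Z q))"
    by (simp add: torsion_form_def)
  also have "\<dots> = X p (\<lambda>q. T q [V q, Y q, Z q]) - X p (\<lambda>q. contraction q (V q) (Y q) (Z q))"
    using tangent_add[OF x T smooth_near_mult[OF smooth_near_const P], of "- 1"]
      tangent_cmult[OF x P, of "- 1"] by simp
  finally show ?thesis
    by (simp add: Dc_T[OF X V Y Z p] Dc_contraction[OF X V Y Z p] torsion_form_def)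
qed

text \<open>The torsion tensor of \<open>Dc\<close>, applied to two fields and kept as a field so
  that it can be differentiated again.\<close>

definition torsion :: "('m \<Rightarrow> 'm tvec) \<Rightarrow> ('m \<Rightarrow> 'm tvec) \<Rightarrow> 'm \<Rightarrow> 'm tvec" where
  "torsion X Y = (\<lambda>q f. (Dc q (X q) Y f + - 1 * Dc q (Y q) X f) + - 1 * lie_bracket A X Y q f)"

lemma
  assumes X: "vector_field A U X" and Y: "vector_field A U Y"
  shows torsion_field: "vector_field A U (torsion X Y)"
    and g_torsion: "p \<in> U \<Longrightarrow> v \<in> TS p \<Longrightarrow> g p (torsion X Y p) v = torsion_form p v (X p) (Y p)"
proof -
  have c: "smooth_fun A U (\<lambda>q. - 1)" using smooth_fun_const vector_fieldD(1)[OF X] .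
  show "vector_field A U (torsion X Y)"
    unfolding torsion_def
    by (intro vector_field_add vector_field_mult c Dc_smooth bracket_field X Y)
  assume p: "p \<in> U" and v: "v \<in> TS p"
  note t = Dc_in[OF Y p vector_fieldD(2)[OF X p]] Dc_in[OF X p vector_fieldD(2)[OF Y p]]
    vector_fieldD(2)[OF bracket_field[OF X Y] p]
  show "g p (torsion X Y p) v = torsion_form p v (X p) (Y p)"
    using g_linear[OF t(1,2) v, of 1 "- 1"] Dc_torsion[OF X Y p v]
      g_linear[OF tangent_space_linear[OF t(1,2), of 1 "- 1"] t(3) v, of 1 "- 1"]
    by (simp add: torsion_def)
qed

text \<open>Differentiate the inner product of the torsion with \<open>V\<close> in two ways, as a
  metric product and as a parallel form; the terms with the derivative of \<open>V\<close>
  cancel.\<close>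

lemma Dc_torsion_field:
  assumes X: "vector_field A U X" and Y: "vector_field A U Y" and Z: "vector_field A U Z"
    and V: "vector_field A U V" and p: "p \<in> U"
  shows "g p (Dc p (X p) (torsion Y Z)) (V p) =
    torsion_form p (V p) (Dc p (X p) Y) (Z p) + torsion_form p (V p) (Y p) (Dc p (X p) Z)"
proof -
  have x: "X p \<in> TS p" using vector_fieldD(2)[OF X p] .
  have "X p (\<lambda>q. g q (torsion Y Z q) (V q)) = X p (\<lambda>q. torsion_form q (V q) (Y q) (Z q))"
    by (rule tangent_cong[OF x vector_fieldD(1)[OF X] p])
      (rule g_torsion[OF Y Z _ vector_fieldD(2)[OF V]])
  then show ?thesis
    using Dc_metric[OF X torsion_field[OF Y Z] V p] Dc_torsion_form[OF X V Y Z p]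
      g_commute[OF Dc_in[OF V p x] vector_fieldD(2)[OF torsion_field[OF Y Z] p]]
      g_torsion[OF Y Z p Dc_in[OF V p x]]
    by simp
qed

section \<open>Curvature and the first Bianchi identity\<close>

lemma curvature_eq:
  assumes X: "vector_field A U X" and Y: "vector_field A U Y" and Z: "vector_field A U Z"
    and V: "vector_field A U V" and p: "p \<in> U"
  shows "curvature A g Dc p X Y Z V = g p (Dc p (X p) (\<lambda>q. Dc q (Y q) Z)) (V p)
    - g p (Dc p (Y p) (\<lambda>q. Dc q (X q) Z)) (V p) - g p (Dc p (lie_bracket A X Y p) Z) (V p)"
proof -
  note v = vector_fieldD(2)[OF V p]
  note t = Dc_in[OF Dc_smooth[OF Y Z] p vector_fieldD(2)[OF X p]]
    Dc_in[OF Dc_smooth[OF X Z] p vector_fieldD(2)[OF Y p]]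
    Dc_in[OF Z p vector_fieldD(2)[OF bracket_field[OF X Y] p]]
  show ?thesis
    using g_linear[OF t(1,2) v, of 1 "- 1"]
      g_linear[OF tangent_space_linear[OF t(1,2), of 1 "- 1"] t(3) v, of 1 "- 1"]
    by (simp add: curvature_def)
qed

text \<open>The nine curvature terms are regrouped by the direction of the outer derivative, and
  \<open>step\<close> treats one group. In the cyclic sum of \<open>step\<close> the torsion terms
  with a single covariant derivative cancel, and the nested brackets vanish by the Jacobi
  identity.\<close>

lemma bianchi_torsion:
  assumes X: "vector_field A U X" and Y: "vector_field A U Y" and Z: "vector_field A U Z"
    and V: "vector_field A U V" and p: "p \<in> U"
  shows "curvature A g Dc p X Y Z V + curvature A g Dc p Y Z X V + curvature A g Dc p Z X Y V =
    torsion_form p (V p) (torsion X Y p) (Z p) + torsion_form p (V p) (torsion Y Z p) (X p)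
    + torsion_form p (V p) (torsion Z X p) (Y p)"
proof -
  have v: "V p \<in> TS p" using vector_fieldD(2)[OF V p] .
  have step: "g p (Dc p (X p) (\<lambda>q. Dc q (Y q) Z)) (V p) - g p (Dc p (X p) (\<lambda>q. Dc q (Z q) Y)) (V p)
      - g p (Dc p (lie_bracket A Y Z p) X) (V p) =
      torsion_form p (V p) (Dc p (X p) Y) (Z p) - torsion_form p (V p) (Dc p (X p) Z) (Y p)
      - torsion_form p (V p) (Dc p (Y p) Z) (X p) + torsion_form p (V p) (Dc p (Z p) Y) (X p)
      + torsion_form p (V p) (torsion Y Z p) (X p)
      + g p (lie_bracket A X (lie_bracket A Y Z) p) (V p)"
    if X: "vector_field A U X" and Y: "vector_field A U Y" and Z: "vector_field A U Z" for X Y Z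
  proof -
    let ?B = "lie_bracket A Y Z"
    note x = vector_fieldD(2)[OF X p] and y = vector_fieldD(2)[OF Y p] and z = vector_fieldD(2)[OF Z p]
    note B = bracket_field[OF Y Z] and b = vector_fieldD(2)[OF bracket_field[OF Y Z] p]
    note dYZ = Dc_in[OF Z p y] and dZY = Dc_in[OF Y p z] and dXZ = Dc_in[OF Z p x]
    have c: "smooth_fun A U (\<lambda>q. - 1)" using smooth_fun_const vector_fieldD(1)[OF X] .
    have diff: "vector_field A U (\<lambda>q f. Dc q (Y q) Z f + - 1 * Dc q (Z q) Y f)"
      by (intro vector_field_add vector_field_mult c Dc_smooth Y Z)
    have 1: "g p (Dc p (X p) (torsion Y Z)) (V p) = g p (Dc p (X p) (\<lambda>q. Dc q (Y q) Z)) (V p)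
        - g p (Dc p (X p) (\<lambda>q. Dc q (Z q) Y)) (V p) - g p (Dc p (X p) ?B) (V p)"
      unfolding torsion_def Dc_add_diff[OF diff B p x v]
        Dc_add_diff[OF Dc_smooth[OF Y Z] Dc_smooth[OF Z Y] p x v] ..
    have 2: "torsion_form p (V p) (torsion Y Z p) (X p) = torsion_form p (V p) (Dc p (Y p) Z) (X p)
        - torsion_form p (V p) (Dc p (Z p) Y) (X p) - torsion_form p (V p) (?B p) (X p)"
      using torsion_form_linear(2)[OF tangent_space_linear[OF dYZ dZY, of 1 "- 1"] b v x, of 1 "- 1"]
        torsion_form_linear(2)[OF dYZ dZY v x, of 1 "- 1"]
      by (simp add: torsion_def)
    \<comment> \<open>\<open>Dc_torsion\<close> for \<open>X\<close> and the bracket of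
      \<open>Y\<close> and \<open>Z\<close> exchanges which of the two is differentiated. The
      torsion term this creates is the bracket part in fact 2, up to the order of its
      arguments.\<close>
    show ?thesis
      using 1 2 Dc_torsion_field[OF X Y Z V p] Dc_torsion[OF X B p v]
        torsion_form_swap[OF v x b] torsion_form_swap[OF v y dXZ]
      by simp
  qed
  note br = vector_fieldD(2)[OF bracket_field[OF X bracket_field[OF Y Z]] p]
    vector_fieldD(2)[OF bracket_field[OF Y bracket_field[OF Z X]] p]
    vector_fieldD(2)[OF bracket_field[OF Z bracket_field[OF X Y]] p]
  have "(\<lambda>f. 1 * (1 * lie_bracket A X (lie_bracket A Y Z) p f
      + 1 * lie_bracket A Y (lie_bracket A Z X) p f) + 1 * lie_bracket A Z (lie_bracket A X Y) p f) = (\<lambda>f. 0)"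
    using lie_bracket_jacobi[OF X Y Z p] by simp
  then have "g p (lie_bracket A X (lie_bracket A Y Z) p) (V p)
      + g p (lie_bracket A Y (lie_bracket A Z X) p) (V p)
      + g p (lie_bracket A Z (lie_bracket A X Y) p) (V p) = g p (\<lambda>f. 0) (V p)"
    using g_linear[OF br(1,2) v, of 1 1]
      g_linear[OF tangent_space_linear[OF br(1,2), of 1 1] br(3) v, of 1 1] by simp
  also have "\<dots> = 0" using g_linear[OF v v v, of 0 0] by simp
  finally have jacobi: "g p (lie_bracket A X (lie_bracket A Y Z) p) (V p)
      + g p (lie_bracket A Y (lie_bracket A Z X) p) (V p)
      + g p (lie_bracket A Z (lie_bracket A X Y) p) (V p) = 0" .
  show ?thesis
    using step[OF X Y Z] step[OF Y Z X] step[OF Z X Y] jacobi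
      curvature_eq[OF X Y Z V p] curvature_eq[OF Y Z X V p] curvature_eq[OF Z X Y V p]
    by simp
qed

text \<open>In the i-th summand the 2-form has values \<open>torsion_form\<close> with
  \<open>e i\<close> as the direction paired with the torsion, the 1-form those with
  \<open>e i\<close> inserted into the torsion. Evaluating a 2-form times a 1-form on three vectors
  gives the cyclic sum.\<close>

lemma form_eval_bianchi_form:
  assumes e: "adapted_frame A g \<rho> p e" and t: "x \<in> TS p" "y \<in> TS p" "z \<in> TS p" "v \<in> TS p"
  defines "c \<equiv> vec_in (g p) e"
  shows "form_eval (bianchi_form (form_in 3 e (\<rho> p)) (form_in 3 e (T p)) (form_in 4 e (F p)) (c v))
      [c x, c y, c z] =
    (\<Sum>i\<in>UNIV. torsion_form p (e i) x y * torsion_form p v (e i) z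
      + torsion_form p (e i) y z * torsion_form p v (e i) x
      + torsion_form p (e i) z x * torsion_form p v (e i) y)"
proof -
  let ?r = "form_in 3 e (\<rho> p)" and ?t = "form_in 3 e (T p)" and ?\<phi> = "form_in 4 e (F p)"
  define \<alpha> where "\<alpha> = (\<lambda>i. hook_e i ?t - sigma 2 (hook_e i ?r) ?\<phi>)"
  define \<beta> where "\<beta> = (\<lambda>i. hook_e i (hook (c v) ?t) - hook_e i (sigma 2 (hook (c v) ?r) ?\<phi>))"
  have ei: "e i \<in> TS p" and ce: "c (e i) = unit8 i" for i
    using frame_in[OF e] vec_in_frame[OF e] by (simp_all add: c_def)
  have \<alpha>: "\<alpha> i \<in> Lam 2" and \<beta>: "\<beta> i \<in> Lam 1" for i
    unfolding \<alpha>_def \<beta>_def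
    by (intro subspace_diff subspace_Lam Lam_hook_e_numeral Lam_hook_numeral Lam_sigma_2 form_in_Lam)+
  have T: "form_eval ?t [c a, c b, c d] = T p [a, b, d]" if "a \<in> TS p" "b \<in> TS p" "d \<in> TS p" for a b d
    using form_eval_vec_in[OF alternating_T e, of "[a, b, d]"] that by (simp add: c_def)
  have P: "form_eval (sigma 2 (hook (c a) ?r) ?\<phi>) [c b, c d] = contraction p a b d"
    if "a \<in> TS p" "b \<in> TS p" "d \<in> TS p" for a b d
    using contraction_frame[OF e that] by (simp add: frame_contraction_def c_def)
  have A: "form_eval (\<alpha> i) [c a, c b] = torsion_form p (e i) a b" if "a \<in> TS p" "b \<in> TS p" for i a b
    using T[OF ei that, of i] P[OF ei that, of i]
    by (simp add: \<alpha>_def form_eval_simps torsion_form_def ce hook_unit8 form_eval_Cons[of ?t])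
  have B: "form_eval (\<beta> i) [c a] = torsion_form p v (e i) a" if "a \<in> TS p" for i a
    using T[OF t(4) ei that, of i] P[OF t(4) ei that, of i]
    by (simp add: \<beta>_def form_eval_simps torsion_form_def ce hook_unit8 form_eval_Cons[of ?t]
        form_eval_Cons[of "hook (c v) ?t"] form_eval_Cons[of "sigma 2 _ _"])
  have "bianchi_form ?r ?t ?\<phi> (c v) = (\<Sum>i\<in>UNIV. wedge (\<alpha> i) (\<beta> i))"
    by (simp add: bianchi_form_def \<alpha>_def \<beta>_def)
  then show ?thesis
    by (simp add: form_eval_simps form_eval_wedge_2_1[OF \<alpha> \<beta>] A B t)
qed

lemma bianchi:
  assumes X: "vector_field A U X" and Y: "vector_field A U Y" and Z: "vector_field A U Z"
    and V: "vector_field A U V" and p: "p \<in> U" and e: "adapted_frame A g \<rho> p e"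
  shows "curvature A g Dc p X Y Z V + curvature A g Dc p Y Z X V + curvature A g Dc p Z X Y V =
      form_eval
        (bianchi_form (form_in 3 e (\<rho> p)) (form_in 3 e (T p)) (form_in 4 e (F p))
           (vec_in (g p) e (V p)))
        [vec_in (g p) e (X p), vec_in (g p) e (Y p), vec_in (g p) e (Z p)]"
proof -
  note t = vector_fieldD(2)[OF X p] vector_fieldD(2)[OF Y p] vector_fieldD(2)[OF Z p]
    vector_fieldD(2)[OF V p]
  have "torsion_form p (V p) (torsion X Y p) (Z p) =
      (\<Sum>i\<in>UNIV. torsion_form p (e i) (X p) (Y p) * torsion_form p (V p) (e i) (Z p))"
    if X: "vector_field A U X" and Y: "vector_field A U Y" and Z: "vector_field A U Z" for X Y Z
  proof -
    have "torsion_form p (V p) (torsion X Y p) (Z p) =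
        (\<Sum>i\<in>UNIV. g p (torsion X Y p) (e i) * torsion_form p (V p) (e i) (Z p))"
      by (rule linear_expand[OF e vector_fieldD(2)[OF torsion_field[OF X Y] p]])
        (rule torsion_form_linear(2)[OF _ _ t(4) vector_fieldD(2)[OF Z p]])
    then show ?thesis by (simp add: g_torsion[OF X Y p frame_in[OF e]])
  qed
  then show ?thesis
    unfolding bianchi_torsion[OF X Y Z V p] form_eval_bianchi_form[OF e t]
    using X Y Z by (simp add: sum.distrib)
qed

end

theorem corollary5p3:
  fixes A :: "'m::{t2_space,second_countable_topology} atlas"
    and g :: "'m \<Rightarrow> 'm tvec \<Rightarrow> 'm tvec \<Rightarrow> real"
    and \<rho> T F :: "'m \<Rightarrow> 'm tvec list \<Rightarrow> real"
    and Dg Dc :: "'m conn"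
  assumes "psu3_structure A g \<rho>"
    and "levi_civita A g Dg"
    and "type_with_characteristic_forms A g \<rho> Dg {1..5} T F"
    and "characteristic_connection A g \<rho> Dg T F Dc"
    and "parallel_form A Dc 3 T"
    and "parallel_form A Dc 4 F"
  shows "\<forall>U X Y Z V p e.
    vector_field A U X \<and> vector_field A U Y \<and> vector_field A U Z \<and> vector_field A U V \<and>
    p \<in> U \<and> adapted_frame A g \<rho> p e \<longrightarrow>
    curvature A g Dc p X Y Z V + curvature A g Dc p Y Z X V + curvature A g Dc p Z X Y V =
      form_eval
        (bianchi_form (form_in 3 e (\<rho> p)) (form_in 3 e (T p)) (form_in 4 e (F p))
           (vec_in (g p) e (V p)))
        [vec_in (g p) e (X p), vec_in (g p) e (Y p), vec_in (g p) e (Z p)]"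
proof -
  interpret psu3_parallel A g \<rho> T F Dg Dc
    using assms by unfold_locales (auto simp: psu3_structure_def)
  show ?thesis using bianchi by blast
qed

end
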